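(* Let $U\subset\mathbb{R}^m$ be a nonempty open set with nonempty complement $\mathbb{R}^m\setminus U$ and $\overline{U}\subset\mathcal{X}$. Fix $x_*\in\partial U$ and $g\in C(\mathcal{X})$. Assume that $x_t$ is nonexplosive and $\mathbf{P}_x\{\tau<\infty\}=1$ for all $x\in U$. Suppose that: (a) for some $\delta>0$ the family of random variables $\{g(x_\tau(x)): |x-x_*|<\delta,\ x\in U\}$ is uniformly integrable; (b) for every $\delta_1>0$ there exist $n\in\mathbb{N}$ and $\delta_2>0$ such that $\mathbf{P}_x\{\tau_{\mathcal{X}_n}<\tau\}<\delta_1$ for all $x\in U$ with $|x-x_*|<\delta_2$; (c) $x_*$ is regular, i.e. $\mathbf{P}_{x_*}\{\overline{\tau}=0\}=1$. Then $u(x):=\mathbf{E}_x\,g(x_\tau)\to g(x_* )$ as $x\to x_*$, $x\in U$.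
   Context: Let $m,r\in\mathbb{N}$, let $\mathcal{X}\subset\mathbb{R}^m$ be open, $b\in C^\infty(\mathcal{X};\mathbb{R}^m)$, $\sigma\in C^\infty(\mathcal{X};\mathbb{R}^{m\times r})$. Let $x_t$ be the (maximal, pathwise unique) solution in $\mathcal{X}$ of the Itô SDE $dx_t=b(x_t)\,dt+\sigma(x_t)\,d\mathbf{W}_t$, where $\mathbf{W}_t$ is a standard $r$-dimensional Brownian motion; $\mathbf{P}_x,\mathbf{E}_x$ denote probability and expectation when $x_0=x$. Fix bounded open sets $\mathcal{X}_n$ with $\overline{\mathcal{X}_n}\subset\mathcal{X}_{n+1}$ and $\bigcup_n\mathcal{X}_n=\mathcal{X}$, and let $\tau_{\mathcal{X}_n}=\inf\{t>0: x_t\notin\mathcal{X}_n\}$. The process $x_t$ is nonexplosive if $\mathbf{P}_x\{\lim_n\tau_{\mathcal{X}_n}<\infty\}=0$ for all $x\in\mathcal{X}$. $\tau=\inf\{t>0: x_t\notin U\}$ and $\overline{\tau}=\inf\{t\ge0: x_t\notin\overline{U}\}$, with $\inf\emptyset=\infty$. The notation $x_\tau(x)$ means $x_\tau$ for the process started at $x_0=x$ (all started processes are driven by the same Brownian motion). *)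

theory Defs
  imports "HOL-Probability.Probability"
begin

section \<open>Smooth functions on an open set\<close>

text \<open>For open \<open>S\<close>, \<open>C_k_on k S f\<close> says that \<open>f\<close> is \<open>k\<close> times continuously
  (Frechet) differentiable on \<open>S\<close>: all iterated directional derivatives up to order \<open>k\<close>
  exist and those of order \<open>k\<close> are continuous.\<close>

primrec C_k_on :: "nat \<Rightarrow> 'a::real_normed_vector set \<Rightarrow> ('a \<Rightarrow> 'b::real_normed_vector) \<Rightarrow> bool" where
  "C_k_on 0 S f \<longleftrightarrow> continuous_on S f"
| "C_k_on (Suc k) S f \<longleftrightarrow>
     (\<forall>x\<in>S. f differentiable (at x)) \<and>
     (\<forall>v. C_k_on k S (\<lambda>x. frechet_derivative f (at x) v))"

definition smooth_on :: "'a::real_normed_vector set \<Rightarrow> ('a \<Rightarrow> 'b::real_normed_vector) \<Rightarrow> bool" where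
  "smooth_on S f \<longleftrightarrow> (\<forall>k. C_k_on k S f)"


section \<open>Brownian motion\<close>

text \<open>Time is real, and only the indices \<open>t \<ge> 0\<close> matter; a filtration given for \<open>t \<ge> 0\<close> is
  extended by \<open>F t = F 0\<close> for \<open>t < 0\<close>.  The filtration is arbitrary: it may, but need not, be the
  completed filtration generated by the Brownian motion.\<close>

definition filtered_prob_space :: "'w measure \<Rightarrow> (real \<Rightarrow> 'w measure) \<Rightarrow> bool" where
  "filtered_prob_space M F \<longleftrightarrow>
     prob_space M \<and> filtration (space M) F \<and> (\<forall>t. subalgebra M (F t))"

definition brownian_motion ::
    "'w measure \<Rightarrow> (real \<Rightarrow> 'w measure) \<Rightarrow> (real \<Rightarrow> 'w \<Rightarrow> real ^ 'r) \<Rightarrow> bool" where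
  "brownian_motion M F W \<longleftrightarrow>
     (\<forall>\<omega>\<in>space M. W 0 \<omega> = 0 \<and> continuous_on {0..} (\<lambda>t. W t \<omega>)) \<and>
     (\<forall>t\<ge>0. W t \<in> borel_measurable (F t)) \<and>
     (\<forall>s t. 0 \<le> s \<longrightarrow> s < t \<longrightarrow>
        prob_space.indep_set M (sets (F s))
          {(\<lambda>\<omega>. W t \<omega> - W s \<omega>) -` A \<inter> space M | A. A \<in> sets borel} \<and>
        distributed M lborel (\<lambda>\<omega>. W t \<omega> - W s \<omega>)
          (\<lambda>y. ennreal (\<Prod>i\<in>UNIV. normal_density 0 (sqrt (t - s)) (y $ i))))"


section \<open>The Ito integral of square integrable matrix-valued integrands\<close>

text \<open>\<open>n\<close>, \<open>s\<close>, \<open>e\<close> encode the elementary integrand with value \<open>e i\<close> on \<open>[s i, s (i+1))\<close>, \<open>i < n\<close>,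
  where \<open>0 = s 0 \<le> s 1 \<le> \<dots> \<le> s n = T\<close> and each \<open>e i\<close> is bounded and \<open>F (s i)\<close>-measurable.\<close>

definition elementary_integrand ::
    "'w measure \<Rightarrow> (real \<Rightarrow> 'w measure) \<Rightarrow> real \<Rightarrow>
     nat \<Rightarrow> (nat \<Rightarrow> real) \<Rightarrow> (nat \<Rightarrow> 'w \<Rightarrow> real ^ 'r ^ 'm) \<Rightarrow> bool" where
  "elementary_integrand M F T n s e \<longleftrightarrow>
     s 0 = 0 \<and> s n = T \<and>
     (\<forall>i<n. s i \<le> s (Suc i) \<and> e i \<in> borel_measurable (F (s i)) \<and>
            (\<exists>C. \<forall>\<omega>\<in>space M. norm (e i \<omega>) \<le> C))"

definition elementary_process ::
    "nat \<Rightarrow> (nat \<Rightarrow> real) \<Rightarrow> (nat \<Rightarrow> 'w \<Rightarrow> real ^ 'r ^ 'm) \<Rightarrow> real \<Rightarrow> 'w \<Rightarrow> real ^ 'r ^ 'm" where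
  "elementary_process n s e t \<omega> = (\<Sum>i<n. indicator {s i..<s (Suc i)} t *\<^sub>R e i \<omega>)"

definition elementary_integral ::
    "(real \<Rightarrow> 'w \<Rightarrow> real ^ 'r) \<Rightarrow>
     nat \<Rightarrow> (nat \<Rightarrow> real) \<Rightarrow> (nat \<Rightarrow> 'w \<Rightarrow> real ^ 'r ^ 'm) \<Rightarrow> 'w \<Rightarrow> real ^ 'm" where
  "elementary_integral W n s e \<omega> = (\<Sum>i<n. e i \<omega> *v (W (s (Suc i)) \<omega> - W (s i) \<omega>))"

text \<open>\<open>has_ito_integral M F W T H J\<close>: the random variable \<open>J\<close> is (a version of) the integral of
  \<open>H\<close> against \<open>W\<close> over \<open>[0,T]\<close>, that is, the \<open>L\<^sup>2\<close>-limit of the integrals of elementary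
  integrands converging to \<open>H\<close> in \<open>L\<^sup>2\<close>.  By the Ito isometry \<open>J\<close> does not depend, up to a null
  set, on the approximating sequence.  The norm on matrices is the Frobenius norm.\<close>

definition has_ito_integral ::
    "'w measure \<Rightarrow> (real \<Rightarrow> 'w measure) \<Rightarrow> (real \<Rightarrow> 'w \<Rightarrow> real ^ 'r) \<Rightarrow> real \<Rightarrow>
     (real \<Rightarrow> 'w \<Rightarrow> real ^ 'r ^ 'm) \<Rightarrow> ('w \<Rightarrow> real ^ 'm) \<Rightarrow> bool" where
  "has_ito_integral M F W T H J \<longleftrightarrow>
     (\<lambda>(t, \<omega>). H t \<omega>) \<in> borel_measurable (restrict_space borel {0..T} \<Otimes>\<^sub>M M) \<and>
     (\<forall>t\<in>{0..T}. H t \<in> borel_measurable (F t)) \<and>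
     (\<integral>\<^sup>+\<omega>. (\<integral>\<^sup>+t\<in>{0..T}. ennreal ((norm (H t \<omega>))\<^sup>2) \<partial>lborel) \<partial>M) < \<infinity> \<and>
     J \<in> borel_measurable M \<and>
     (\<exists>n s e.
        (\<forall>k. elementary_integrand M F T (n k) (s k) (e k)) \<and>
        (\<lambda>k. \<integral>\<^sup>+\<omega>. (\<integral>\<^sup>+t\<in>{0..T}.
               ennreal ((norm (H t \<omega> - elementary_process (n k) (s k) (e k) t \<omega>))\<^sup>2) \<partial>lborel) \<partial>M)
          \<longlonglongrightarrow> 0 \<and>
        (\<lambda>k. \<integral>\<^sup>+\<omega>. ennreal ((norm (J \<omega> - elementary_integral W (n k) (s k) (e k) \<omega>))\<^sup>2) \<partial>M)
          \<longlonglongrightarrow> 0)"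


section \<open>Paths with finite lifetime and exit times\<close>

text \<open>A path that may explode is a function \<open>real \<Rightarrow> 'a option\<close>, considered for \<open>t \<ge> 0\<close>, with
  \<open>None\<close> as cemetery.  A dead path counts as being outside of every set.\<close>

definition lifetime :: "(real \<Rightarrow> 'a option) \<Rightarrow> ereal" where
  "lifetime p = Inf (ereal ` {t. 0 \<le> t \<and> p t = None})"

text \<open>\<open>exit_time\<close> looks at times \<open>t > 0\<close> only, \<open>exit_time0\<close> at all \<open>t \<ge> 0\<close>.\<close>

definition exit_time :: "(real \<Rightarrow> 'a option) \<Rightarrow> 'a set \<Rightarrow> ereal" where
  "exit_time p D = Inf (ereal ` {t. 0 < t \<and> p t \<notin> Some ` D})"

definition exit_time0 :: "(real \<Rightarrow> 'a option) \<Rightarrow> 'a set \<Rightarrow> ereal" where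
  "exit_time0 p D = Inf (ereal ` {t. 0 \<le> t \<and> p t \<notin> Some ` D})"

text \<open>\<open>g (p (exit_time p D))\<close>, with the convention that the value is \<open>0\<close> if the path never leaves
  \<open>D\<close> or leaves it by dying.\<close>

definition exit_value :: "('a \<Rightarrow> real) \<Rightarrow> (real \<Rightarrow> 'a option) \<Rightarrow> 'a set \<Rightarrow> real" where
  "exit_value g p D =
     (if exit_time p D = \<infinity> then 0
      else case p (real_of_ereal (exit_time p D)) of None \<Rightarrow> 0 | Some y \<Rightarrow> g y)"


section \<open>Solutions of the SDE up to explosion\<close>

text \<open>The SDE is localized: for each open \<open>V\<close> containing \<open>x\<close> with compact closure in the state
  space \<open>S\<close>, it holds in integral form up to the exit time of \<open>V\<close>, the integrand of the Ito
  integral being set to zero from that time on (hence bounded).\<close>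

definition local_solution ::
    "'w measure \<Rightarrow> (real \<Rightarrow> 'w measure) \<Rightarrow> (real \<Rightarrow> 'w \<Rightarrow> real ^ 'r) \<Rightarrow> (real ^ 'm) set \<Rightarrow>
     (real ^ 'm \<Rightarrow> real ^ 'm) \<Rightarrow> (real ^ 'm \<Rightarrow> real ^ 'r ^ 'm) \<Rightarrow>
     real ^ 'm \<Rightarrow> (real \<Rightarrow> 'w \<Rightarrow> (real ^ 'm) option) \<Rightarrow> bool" where
  "local_solution M F W S b \<sigma> x X \<longleftrightarrow>
     (\<forall>\<omega>\<in>space M.
        X 0 \<omega> = Some x \<and>
        (\<forall>t\<ge>0. X t \<omega> \<in> insert None (Some ` S)) \<and>
        (\<forall>t\<ge>0. X t \<omega> \<noteq> None \<longleftrightarrow> ereal t < lifetime (\<lambda>t. X t \<omega>)) \<and>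
        continuous_on {t. 0 \<le> t \<and> ereal t < lifetime (\<lambda>t. X t \<omega>)} (\<lambda>t. the (X t \<omega>))) \<and>
     (\<forall>t\<ge>0. \<forall>A\<in>sets borel. {\<omega>\<in>space M. X t \<omega> \<in> Some ` A} \<in> sets (F t)) \<and>
     (\<forall>V. open V \<longrightarrow> x \<in> V \<longrightarrow> compact (closure V) \<longrightarrow> closure V \<subseteq> S \<longrightarrow>
       (\<forall>t\<ge>0. \<exists>J.
          has_ito_integral M F W t
            (\<lambda>s \<omega>. if ereal s < exit_time (\<lambda>t. X t \<omega>) V then \<sigma> (the (X s \<omega>)) else 0) J \<and>
          (AE \<omega> in M. ereal t < exit_time (\<lambda>t. X t \<omega>) V \<longrightarrow>
             the (X t \<omega>) = x + integral {0..t} (\<lambda>s. b (the (X s \<omega>))) + J \<omega>)))"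

text \<open>Maximality and pathwise uniqueness: almost surely, \<open>X\<close> extends every local solution with the
  same starting point and the same Brownian motion.\<close>

definition maximal_solution ::
    "'w measure \<Rightarrow> (real \<Rightarrow> 'w measure) \<Rightarrow> (real \<Rightarrow> 'w \<Rightarrow> real ^ 'r) \<Rightarrow> (real ^ 'm) set \<Rightarrow>
     (real ^ 'm \<Rightarrow> real ^ 'm) \<Rightarrow> (real ^ 'm \<Rightarrow> real ^ 'r ^ 'm) \<Rightarrow>
     real ^ 'm \<Rightarrow> (real \<Rightarrow> 'w \<Rightarrow> (real ^ 'm) option) \<Rightarrow> bool" where
  "maximal_solution M F W S b \<sigma> x X \<longleftrightarrow>
     local_solution M F W S b \<sigma> x X \<and>
     (\<forall>Y. local_solution M F W S b \<sigma> x Y \<longrightarrow>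
        (AE \<omega> in M. \<forall>t\<ge>0. Y t \<omega> \<noteq> None \<longrightarrow> X t \<omega> = Y t \<omega>))"


section \<open>Uniform integrability\<close>

definition uniformly_integrable :: "'w measure \<Rightarrow> 'i set \<Rightarrow> ('i \<Rightarrow> 'w \<Rightarrow> real) \<Rightarrow> bool" where
  "uniformly_integrable M I f \<longleftrightarrow>
     (\<forall>i\<in>I. integrable M (f i)) \<and>
     (\<forall>\<epsilon>>0. \<exists>K. \<forall>i\<in>I. (\<integral>\<omega>. \<bar>f i \<omega>\<bar> * indicator {\<omega>. \<bar>f i \<omega>\<bar> > K} \<omega> \<partial>M) < \<epsilon>)"

end

theory Submission
  imports Defs
begin

text \<open>
  Two facts about the equation near \<open>xs\<close> carry the proof.  First, solutions leave a ball slowly: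
  the probability of moving by \<open>r\<close> before time \<open>T\<close> tends to \<open>0\<close> with \<open>T\<close>, uniformly for starting
  points near \<open>xs\<close> (\<open>leaves_slowly\<close>).  Secondly, as long as they stay in a ball where the coefficients
  are Lipschitz, solutions for the same Brownian motion depend continuously in mean square on the
  starting point, at each fixed small time (\<open>stability\<close>).

  Regularity of \<open>xs\<close> says that the path from \<open>xs\<close> visits the complement of the closure of \<open>U\<close> at
  arbitrarily small times.  That complement is open and paths are continuous, so for given \<open>T\<close> and up
  to a small probability, one of finitely many times before \<open>T\<close> finds the path at a definite distance
  from \<open>U\<close>.  By stability, the path from a nearby \<open>x\<close> in \<open>U\<close> is then outside of \<open>U\<close> at the same
  time.  So with high probability it exits before \<open>T\<close>, and, as it moves slowly, near \<open>xs\<close>.  Hence the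
  exit value converges to \<open>g xs\<close> in probability, and uniform integrability turns this into convergence
  of expectations (\<open>expectation_near\<close>).

  Both facts rest on estimates for the Ito integral, which is a mean square limit of elementary
  integrals for each fixed time.  The tools are the mean square bound \<open>ito_inequality\<close>
  and the rule \<open>ito_restrict\<close> for multiplying an integral over later times by a past event.
  Instead of stopping an integral at an exit time, its integrand is switched off at the points of a
  grid (\<open>ito_stopped_grid\<close>).  Doing so at the first grid point where a threshold is crossed gives the
  maximal inequality \<open>ito_maximal_inequality\<close>; refining the grid gives \<open>stopped_ito_inequality\<close>,
  which bounds the integral on the event of not having left a region by the integrand before leaving
  it.  The latter inequality yields stability: over short times the difference of two solutions
  is bounded by the distance of the starting points plus half of its own supremum.

  Nonexplosiveness enters in \<open>nonexplosive_AE_alive\<close>: almost surely a solution is alive at all times,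
  so that \<open>local_solution_solves_in\<close> allows for treating it as a process with continuous paths.
\<close>

section \<open>Moments of Brownian increments\<close>

lemma borel_measurable_vec_nth_compose [measurable (raw)]:
  fixes f :: "'a \<Rightarrow> ('b :: real_normed_vector) ^ 'n"
  assumes "f \<in> borel_measurable M"
  shows "(\<lambda>x. f x $ i) \<in> borel_measurable M"
  by (rule borel_measurable_continuous_on[OF _ assms]) (intro continuous_intros)

lemma Basis_vec_bij: "bij_betw (\<lambda>i. axis i (1::real)) UNIV (Basis :: (real ^ 'r) set)"
  by (auto simp: bij_betw_def inj_on_def axis_eq_axis Basis_vec_def)

lemmas prod_Basis_vec = prod.reindex_bij_betw[OF Basis_vec_bij, symmetric]
  and sum_Basis_vec = sum.reindex_bij_betw[OF Basis_vec_bij, symmetric]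

definition gauss_density :: "real \<Rightarrow> real ^ 'r \<Rightarrow> real" where
  "gauss_density v y = (\<Prod>i\<in>UNIV. normal_density 0 v (y $ i))"

lemma gauss_density_measurable [measurable]: "gauss_density v \<in> borel_measurable borel"
  unfolding gauss_density_def by measurable

lemma gauss_density_nonneg: "gauss_density v y \<ge> 0"
  unfolding gauss_density_def by (intro prod_nonneg) auto

definition reflect :: "'r \<Rightarrow> real ^ 'r \<Rightarrow> real ^ 'r" where
  "reflect i y = (\<chi> j. if j = i then - (y $ j) else y $ j)"

lemma reflect_eq_sum:
  "reflect i y = (\<Sum>b\<in>Basis. ((if b = axis i 1 then - 1 else 1) * (y \<bullet> b)) *\<^sub>R b)"
proof -
  have "(\<Sum>b\<in>Basis. ((if b = axis i 1 then - 1 else 1) * (y \<bullet> b)) *\<^sub>R b)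
      = (\<Sum>j\<in>UNIV. ((if j = i then - 1 else 1) * (y $ j)) *\<^sub>R axis j 1)"
    by (subst sum_Basis_vec) (simp add: axis_eq_axis cart_eq_inner_axis)
  also have "\<dots> = reflect i y"
    by (auto simp: vec_eq_iff reflect_def sum_component axis_def if_distrib cong: if_cong)
  finally show ?thesis by simp
qed

lemma reflect_measurable [measurable]: "reflect i \<in> borel_measurable borel"
  unfolding reflect_eq_sum[abs_def] by measurable

lemma gauss_density_reflect: "gauss_density v (reflect i y) = gauss_density v y"
  unfolding gauss_density_def reflect_def
  by (intro prod.cong) (auto simp: normal_density_def)

text \<open>The integrand is a product over the coordinates, so Tonelli's theorem reduces the claim to
  one-dimensional normal moments.\<close>

lemma gauss_density_second_moment:
  assumes "v > 0"
  shows "(\<integral>\<^sup>+y. ennreal (gauss_density v y) * ennreal ((y $ i)\<^sup>2) \<partial>(lborel :: (real^'r) measure)) = ennreal (v\<^sup>2)"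
proof -
  define f where "f b x = ennreal (normal_density 0 v x) * (if b = axis i 1 then ennreal (x\<^sup>2) else 1)" for b :: "real ^ 'r" and x
  have m[measurable]: "f b \<in> borel_measurable borel" for b
    unfolding f_def by measurable
  have "ennreal (gauss_density v y) * ennreal ((y $ i)\<^sup>2) = (\<Prod>b\<in>Basis. f b (y \<bullet> b))" for y
  proof -
    have "(\<Prod>b\<in>Basis. f b (y \<bullet> b)) = (\<Prod>j\<in>UNIV. ennreal (normal_density 0 v (y $ j)) * (if j = i then ennreal ((y $ j)\<^sup>2) else 1))"
      by (simp add: prod_Basis_vec f_def axis_eq_axis inner_axis cong: if_cong)
    also have "\<dots> = ennreal (gauss_density v y) * ennreal ((y $ i)\<^sup>2)"
      by (simp add: prod.distrib prod_ennreal gauss_density_def)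
    finally show ?thesis by simp
  qed
  then have "(\<integral>\<^sup>+y. ennreal (gauss_density v y) * ennreal ((y $ i)\<^sup>2) \<partial>(lborel :: (real^'r) measure))
      = (\<Prod>b\<in>Basis. \<integral>\<^sup>+x. f b x \<partial>lborel)"
    by (simp add: nn_integral_lborel_prod)
  also have "\<dots> = (\<Prod>j\<in>(UNIV::'r set). if j = i then ennreal (v\<^sup>2) else 1)"
    unfolding prod_Basis_vec
  proof (intro prod.cong refl)
    fix j :: 'r
    have 1: "(\<integral>\<^sup>+x. ennreal (normal_density 0 v x) \<partial>lborel) = 1"
      by (subst nn_integral_eq_integral) (auto simp: assms)
    have 2: "has_bochner_integral lborel (\<lambda>x. normal_density 0 v x * x\<^sup>2) (v\<^sup>2)"
      using normal_moment_even[OF assms, of 0 1] by (simp add: power2_eq_square)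
    have "(\<integral>\<^sup>+x. ennreal (normal_density 0 v x) * ennreal (x\<^sup>2) \<partial>lborel) =
      (\<integral>\<^sup>+x. ennreal (normal_density 0 v x * x\<^sup>2) \<partial>lborel)"
      by (simp add: ennreal_mult')
    also have "\<dots> = ennreal (v\<^sup>2)"
      using 2 by (subst nn_integral_eq_integral) (auto simp: has_bochner_integral_iff)
    finally show "(\<integral>\<^sup>+x. f (axis j 1) x \<partial>lborel) = (if j = i then ennreal (v\<^sup>2) else 1)"
      using 1 by (simp add: f_def axis_eq_axis)
  qed
  also have "\<dots> = ennreal (v\<^sup>2)" by simp
  finally show ?thesis .
qed

lemma lborel_reflect: "distr lborel borel (reflect i) = (lborel :: (real^'r) measure)"
proof -
  define c where "c b = (if b = axis i 1 then - 1 else (1::real))" for b :: "real ^ 'r"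
  have "lborel = density (distr lborel borel (\<lambda>x. 0 + (\<Sum>b\<in>Basis. (c b * (x \<bullet> b)) *\<^sub>R b)))
      (\<lambda>_. ennreal (\<Prod>b\<in>Basis. \<bar>c b\<bar>))"
    by (rule lborel_affine_euclidean) (simp add: c_def)
  also have "(\<lambda>x. 0 + (\<Sum>b\<in>Basis. (c b * (x \<bullet> b)) *\<^sub>R b)) = reflect i"
    by (simp add: reflect_eq_sum[abs_def] c_def)
  also have "(\<Prod>b\<in>Basis. \<bar>c b\<bar>) = 1"
    by (rule prod.neutral) (simp add: c_def)
  finally show ?thesis by (simp add: density_1)
qed

locale ito_setting =
  fixes M :: "'w measure" and F :: "real \<Rightarrow> 'w measure" and W :: "real \<Rightarrow> 'w \<Rightarrow> real ^ 'r"
  assumes filtered: "filtered_prob_space M F"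
    and brownian: "brownian_motion M F W"
begin

sublocale prob_space M
  using filtered by (simp add: filtered_prob_space_def)

lemma space_F [simp]: "space (F t) = space M"
  using filtered by (simp add: filtered_prob_space_def subalgebra_def)

lemma sets_F_subset: "sets (F t) \<subseteq> sets M"
  using filtered by (simp add: filtered_prob_space_def subalgebra_def)

lemma sets_F_mono: "s \<le> t \<Longrightarrow> sets (F s) \<subseteq> sets (F t)"
  using filtered filtration.sets_F_mono unfolding filtered_prob_space_def by blast

lemma measurable_F_mono: "f \<in> measurable (F s) N \<Longrightarrow> s \<le> t \<Longrightarrow> f \<in> measurable (F t) N"
  using measurable_mono[of N N "F s" "F t"] sets_F_mono[of s t] by auto

lemma measurable_F_M: "f \<in> measurable (F s) N \<Longrightarrow> f \<in> measurable M N"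
  using measurable_mono[of N N "F s" M] sets_F_subset[of s] by auto

lemma W_measurable_F: "0 \<le> t \<Longrightarrow> W t \<in> borel_measurable (F t)"
  using brownian by (simp add: brownian_motion_def)

lemma W_measurable: "0 \<le> t \<Longrightarrow> W t \<in> borel_measurable M"
  using W_measurable_F measurable_F_M by blast

lemma distributed_increment:
  assumes "0 \<le> s" "s < t"
  shows "distributed M lborel (\<lambda>\<omega>. W t \<omega> - W s \<omega>) (\<lambda>y. ennreal (gauss_density (sqrt (t - s)) y))"
  using brownian assms by (simp add: brownian_motion_def gauss_density_def)

lemma increment_second_moment_nn:
  assumes "0 \<le> s" "s \<le> t"
  shows "(\<integral>\<^sup>+\<omega>. ennreal (((W t \<omega> - W s \<omega>) $ i)\<^sup>2) \<partial>M) = ennreal (t - s)"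
proof (cases "s < t")
  case True
  have "(\<integral>\<^sup>+\<omega>. ennreal (((W t \<omega> - W s \<omega>) $ i)\<^sup>2) \<partial>M)
      = (\<integral>\<^sup>+y. ennreal (gauss_density (sqrt (t - s)) y) * ennreal ((y $ i)\<^sup>2) \<partial>(lborel :: (real^'r) measure))"
    by (rule distributed_nn_integral[OF distributed_increment[OF assms(1) True], symmetric]) simp
  also have "\<dots> = ennreal ((sqrt (t - s))\<^sup>2)"
    using True by (intro gauss_density_second_moment) auto
  finally show ?thesis using assms by simp
qed (use assms in simp)

lemma increment_square_integrable:
  assumes "0 \<le> s" "s \<le> t"
  shows "integrable M (\<lambda>\<omega>. ((W t \<omega> - W s \<omega>) $ i)\<^sup>2)"
    and "(\<integral>\<omega>. ((W t \<omega> - W s \<omega>) $ i)\<^sup>2 \<partial>M) = t - s"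
proof -
  have m[measurable]: "W t \<in> borel_measurable M" "W s \<in> borel_measurable M"
    using W_measurable assms by auto
  have [measurable]: "(\<lambda>\<omega>. ((W t \<omega> - W s \<omega>) $ i)\<^sup>2) \<in> borel_measurable M"
    by measurable
  show "integrable M (\<lambda>\<omega>. ((W t \<omega> - W s \<omega>) $ i)\<^sup>2)"
    using increment_second_moment_nn[OF assms, of i] by (intro integrableI_nonneg) (simp_all del: vector_minus_component)
  show "(\<integral>\<omega>. ((W t \<omega> - W s \<omega>) $ i)\<^sup>2 \<partial>M) = t - s"
    using increment_second_moment_nn[OF assms, of i] assms
    by (subst integral_eq_nn_integral) (simp_all del: vector_minus_component)
qed

lemma square_integrable_prod:
  fixes f g :: "'w \<Rightarrow> real"
  assumes [measurable]: "f \<in> borel_measurable M" "g \<in> borel_measurable M"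
    and "integrable M (\<lambda>\<omega>. (f \<omega>)\<^sup>2)" "integrable M (\<lambda>\<omega>. (g \<omega>)\<^sup>2)"
  shows "integrable M (\<lambda>\<omega>. f \<omega> * g \<omega>)"
proof (rule Bochner_Integration.integrable_bound)
  show "integrable M (\<lambda>\<omega>. (f \<omega>)\<^sup>2 + (g \<omega>)\<^sup>2)" using assms by simp
  have "\<bar>x * y\<bar> \<le> x\<^sup>2 + y\<^sup>2" for x y :: real
    using sum_squares_bound[of x y] sum_squares_bound[of x "- y"]
    by (auto simp: abs_le_iff)
  then show "AE \<omega> in M. norm (f \<omega> * g \<omega>) \<le> norm ((f \<omega>)\<^sup>2 + (g \<omega>)\<^sup>2)"
    by simp
qed simp

lemma increment_reflect_integral:
  fixes h :: "real^'r \<Rightarrow> real"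
  assumes "0 \<le> s" "s < t" and [measurable]: "h \<in> borel_measurable borel"
  shows "(\<integral>\<omega>. h (W t \<omega> - W s \<omega>) \<partial>M) = (\<integral>\<omega>. h (reflect i (W t \<omega> - W s \<omega>)) \<partial>M)"
proof -
  let ?d = "gauss_density (sqrt (t - s)) :: real^'r \<Rightarrow> real"
  note D = distributed_increment[OF assms(1,2)]
  have "(\<integral>\<omega>. h (W t \<omega> - W s \<omega>) \<partial>M) = (\<integral>y. ?d y * h y \<partial>lborel)"
    by (rule distributed_integral[OF D, symmetric]) (auto simp: gauss_density_nonneg)
  also have "\<dots> = (\<integral>y. ?d y * h y \<partial>distr lborel borel (reflect i))"
    by (simp add: lborel_reflect)
  also have "\<dots> = (\<integral>y. ?d y * h (reflect i y) \<partial>lborel)"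
    by (subst integral_distr) (auto simp: gauss_density_reflect)
  also have "\<dots> = (\<integral>\<omega>. h (reflect i (W t \<omega> - W s \<omega>)) \<partial>M)"
    by (rule distributed_integral[OF D]) (auto simp: gauss_density_nonneg)
  finally show ?thesis .
qed

text \<open>Reflecting one coordinate preserves the law of an increment but changes the sign of its
  first moment and of its mixed second moments, so that these vanish.\<close>

lemma increment_moments:
  assumes "0 \<le> s" "s \<le> t"
  shows "(\<integral>\<omega>. (W t \<omega> - W s \<omega>) $ i \<partial>M) = 0"
    and "(\<integral>\<omega>. (W t \<omega> - W s \<omega>) $ i * (W t \<omega> - W s \<omega>) $ j \<partial>M) = (if i = j then t - s else 0)"
proof -
  have "(\<integral>\<omega>. (W t \<omega> - W s \<omega>) $ i \<partial>M) = 0 \<and>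
    (i \<noteq> j \<longrightarrow> (\<integral>\<omega>. (W t \<omega> - W s \<omega>) $ i * (W t \<omega> - W s \<omega>) $ j \<partial>M) = 0)"
  proof (cases "s < t")
    case True
    let ?Z = "\<lambda>\<omega>. W t \<omega> - W s \<omega>"
    have reflect: "reflect i y $ i = - (y $ i)" "j \<noteq> i \<Longrightarrow> reflect i y $ j = y $ j" for y
      by (simp_all add: reflect_def)
    have "(\<integral>\<omega>. ?Z \<omega> $ i \<partial>M) = (\<integral>\<omega>. reflect i (?Z \<omega>) $ i \<partial>M)"
      by (rule increment_reflect_integral[OF assms(1) True, of "\<lambda>y. y $ i" i]) measurable
    also have "\<dots> = - (\<integral>\<omega>. ?Z \<omega> $ i \<partial>M)"
      by (simp only: reflect Bochner_Integration.integral_minus)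
    finally have 1: "(\<integral>\<omega>. ?Z \<omega> $ i \<partial>M) = 0" by linarith
    have "(\<integral>\<omega>. ?Z \<omega> $ i * ?Z \<omega> $ j \<partial>M) = 0" if "i \<noteq> j"
    proof -
      have "(\<integral>\<omega>. ?Z \<omega> $ i * ?Z \<omega> $ j \<partial>M) = (\<integral>\<omega>. reflect i (?Z \<omega>) $ i * reflect i (?Z \<omega>) $ j \<partial>M)"
        by (rule increment_reflect_integral[OF assms(1) True, of "\<lambda>y. y $ i * y $ j" i]) measurable
      also have "\<dots> = - (\<integral>\<omega>. ?Z \<omega> $ i * ?Z \<omega> $ j \<partial>M)"
        using that by (simp only: reflect(1) reflect(2)[OF that[symmetric]] mult_minus_left Bochner_Integration.integral_minus)
      finally show ?thesis by linarith
    qed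
    with 1 show ?thesis by blast
  qed (use assms in auto)
  then show "(\<integral>\<omega>. (W t \<omega> - W s \<omega>) $ i \<partial>M) = 0"
    "(\<integral>\<omega>. (W t \<omega> - W s \<omega>) $ i * (W t \<omega> - W s \<omega>) $ j \<partial>M) = (if i = j then t - s else 0)"
    using increment_square_integrable(2)[OF assms, of i] unfolding power2_eq_square
    by (simp_all only: if_True if_False split: if_split) blast+
qed

text \<open>Every event described by \<open>h\<close> of the increment belongs to the \<open>\<sigma>\<close>-algebra generated by the
  increment, which is independent of the past by definition of Brownian motion.\<close>

lemma indep_past_increment:
  fixes Y :: "'w \<Rightarrow> real" and h :: "real^'r \<Rightarrow> real"
  assumes st: "0 \<le> s" "s < t" and Y: "Y \<in> borel_measurable (F s)"
    and h[measurable]: "h \<in> borel_measurable borel"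
  shows "indep_var borel Y borel (\<lambda>\<omega>. h (W t \<omega> - W s \<omega>))"
proof -
  let ?Z = "\<lambda>\<omega>. W t \<omega> - W s \<omega>"
  have m[measurable]: "W t \<in> borel_measurable M" "W s \<in> borel_measurable M"
    using W_measurable st by auto
  have YM[measurable]: "Y \<in> borel_measurable M" using Y by (rule measurable_F_M)
  have ind: "indep_set (sets (F s)) {?Z -` A \<inter> space M | A. A \<in> sets borel}"
    using brownian st by (simp add: brownian_motion_def)
  have 1: "sigma_sets (space M) {Y -` A \<inter> space M | A. A \<in> sets borel} \<subseteq> sets (F s)"
  proof -
    have "{Y -` A \<inter> space M | A. A \<in> sets borel} \<subseteq> sets (F s)"
      using measurable_sets[OF Y] by auto
    from sets.sigma_sets_subset[OF this] show ?thesis by simp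
  qed
  have "(\<lambda>\<omega>. h (?Z \<omega>)) \<in> measurable (vimage_algebra (space M) ?Z borel) borel"
    by (rule measurable_compose[OF measurable_vimage_algebra1 h]) auto
  from measurable_sets[OF this]
  have "{(\<lambda>\<omega>. h (?Z \<omega>)) -` A \<inter> space M | A. A \<in> sets borel} \<subseteq> sets (vimage_algebra (space M) ?Z borel)"
    by auto
  then have "sigma_sets (space M) {(\<lambda>\<omega>. h (?Z \<omega>)) -` A \<inter> space M | A. A \<in> sets borel}
      \<subseteq> sets (vimage_algebra (space M) ?Z borel)"
    using sets.sigma_sets_subset[of _ "vimage_algebra (space M) ?Z borel"] by simp
  also have "\<dots> = {?Z -` A \<inter> space M | A. A \<in> sets borel}"
    by (subst sets_vimage_algebra2) auto
  finally have 2: "sigma_sets (space M) {(\<lambda>\<omega>. h (?Z \<omega>)) -` A \<inter> space M | A. A \<in> sets borel}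
      \<subseteq> {?Z -` A \<inter> space M | A. A \<in> sets borel}" .
  have "indep_set (sigma_sets (space M) {Y -` A \<inter> space M | A. A \<in> sets borel})
      (sigma_sets (space M) {(\<lambda>\<omega>. h (?Z \<omega>)) -` A \<inter> space M | A. A \<in> sets borel})"
    using ind unfolding indep_set_def
    by (rule indep_sets_mono_sets) (use 1 2 in \<open>auto split: bool.split\<close>)
  then show ?thesis
    unfolding indep_var_eq by simp
qed

lemma past_times_increment:
  fixes Y :: "'w \<Rightarrow> real" and h :: "real^'r \<Rightarrow> real"
  assumes st: "0 \<le> s" "s \<le> t" and Y: "Y \<in> borel_measurable (F s)" "integrable M Y"
    and h[measurable]: "h \<in> borel_measurable borel" and hi: "integrable M (\<lambda>\<omega>. h (W t \<omega> - W s \<omega>))"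
  shows "integrable M (\<lambda>\<omega>. Y \<omega> * h (W t \<omega> - W s \<omega>))"
    and "(\<integral>\<omega>. Y \<omega> * h (W t \<omega> - W s \<omega>) \<partial>M) = (\<integral>\<omega>. Y \<omega> \<partial>M) * (\<integral>\<omega>. h (W t \<omega> - W s \<omega>) \<partial>M)"
proof -
  have "integrable M (\<lambda>\<omega>. Y \<omega> * h (W t \<omega> - W s \<omega>)) \<and>
   (\<integral>\<omega>. Y \<omega> * h (W t \<omega> - W s \<omega>) \<partial>M) = (\<integral>\<omega>. Y \<omega> \<partial>M) * (\<integral>\<omega>. h (W t \<omega> - W s \<omega>) \<partial>M)"
  proof (cases "s < t")
    case True
    show ?thesis
      using indep_var_integrable[OF indep_past_increment[OF st(1) True Y(1) h] Y(2) hi]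
        indep_var_lebesgue_integral[OF indep_past_increment[OF st(1) True Y(1) h] Y(2) hi] by auto
  qed (use st Y in \<open>auto simp: prob_space\<close>)
  then show "integrable M (\<lambda>\<omega>. Y \<omega> * h (W t \<omega> - W s \<omega>))"
    and "(\<integral>\<omega>. Y \<omega> * h (W t \<omega> - W s \<omega>) \<partial>M) = (\<integral>\<omega>. Y \<omega> \<partial>M) * (\<integral>\<omega>. h (W t \<omega> - W s \<omega>) \<partial>M)"
    by auto
qed

end

section \<open>Square norms\<close>

text \<open>The squared \<open>L\<^sup>2\<close> seminorm.  Its values are extended nonnegative reals, so that estimates can be
  chained before finiteness is known.\<close>

definition sqnorm :: "'a measure \<Rightarrow> ('a \<Rightarrow> 'b :: real_normed_vector) \<Rightarrow> ennreal" where
  "sqnorm N f = (\<integral>\<^sup>+z. ennreal ((norm (f z))\<^sup>2) \<partial>N)"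

lemma norm_add_squared_le:
  fixes a b :: "'a :: real_normed_vector"
  shows "(norm (a + b))\<^sup>2 \<le> 2 * (norm a)\<^sup>2 + 2 * (norm b)\<^sup>2"
proof -
  have "(norm (a + b))\<^sup>2 \<le> (norm a + norm b)\<^sup>2"
    by (intro power_mono norm_triangle_ineq) auto
  also have "\<dots> \<le> 2 * (norm a)\<^sup>2 + 2 * (norm b)\<^sup>2"
    using sum_squares_bound[of "norm a" "norm b"] by (simp add: power2_sum)
  finally show ?thesis .
qed

lemma sqnorm_add:
  fixes f g :: "'a \<Rightarrow> 'b :: euclidean_space"
  assumes [measurable]: "f \<in> borel_measurable N" "g \<in> borel_measurable N"
  shows "sqnorm N (\<lambda>z. f z + g z) \<le> 2 * sqnorm N f + 2 * sqnorm N g"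
proof -
  have "sqnorm N (\<lambda>z. f z + g z) \<le> (\<integral>\<^sup>+z. 2 * ennreal ((norm (f z))\<^sup>2) + 2 * ennreal ((norm (g z))\<^sup>2) \<partial>N)"
    unfolding sqnorm_def
  proof (rule nn_integral_mono)
    fix z
    have "ennreal ((norm (f z + g z))\<^sup>2) \<le> ennreal (2 * (norm (f z))\<^sup>2 + 2 * (norm (g z))\<^sup>2)"
      using norm_add_squared_le by (rule ennreal_leI)
    then show "ennreal ((norm (f z + g z))\<^sup>2) \<le> 2 * ennreal ((norm (f z))\<^sup>2) + 2 * ennreal ((norm (g z))\<^sup>2)"
      by (simp add: ennreal_plus ennreal_mult)
  qed
  also have "\<dots> = 2 * sqnorm N f + 2 * sqnorm N g"
    unfolding sqnorm_def by (simp add: nn_integral_add nn_integral_cmult)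
  finally show ?thesis .
qed

lemma sqnorm_minus_commute: "sqnorm N (\<lambda>z. f z - g z) = sqnorm N (\<lambda>z. g z - f z)"
  by (simp add: sqnorm_def norm_minus_commute)

lemma sqnorm_mono_AE:
  assumes "AE z in N. norm (f z) \<le> norm (g z)"
  shows "sqnorm N f \<le> sqnorm N g"
  unfolding sqnorm_def
  by (rule nn_integral_mono_AE, use assms in eventually_elim) (auto intro!: ennreal_leI power_mono)

lemma sqnorm_tendsto_0_add:
  fixes f g :: "nat \<Rightarrow> 'a \<Rightarrow> 'b :: euclidean_space"
  assumes "\<And>k. f k \<in> borel_measurable N" "\<And>k. g k \<in> borel_measurable N"
    and "(\<lambda>k. sqnorm N (f k)) \<longlonglongrightarrow> 0" "(\<lambda>k. sqnorm N (g k)) \<longlonglongrightarrow> 0"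
    and "\<And>k z. z \<in> space N \<Longrightarrow> norm (h k z) \<le> norm (f k z + g k z)"
  shows "(\<lambda>k. sqnorm N (h k)) \<longlonglongrightarrow> 0"
proof (rule tendsto_sandwich[of "\<lambda>_. 0"])
  have "sqnorm N (h k) \<le> 2 * sqnorm N (f k) + 2 * sqnorm N (g k)" for k
    using sqnorm_mono_AE[of "h k" "\<lambda>z. f k z + g k z" N] assms(5) sqnorm_add[OF assms(1,2), of k k]
    by (meson AE_I2 order_trans)
  then show "\<forall>\<^sub>F k in sequentially. sqnorm N (h k) \<le> 2 * sqnorm N (f k) + 2 * sqnorm N (g k)"
    by simp
  have "(\<lambda>k. 2 * sqnorm N (f k) + 2 * sqnorm N (g k)) \<longlonglongrightarrow> 2 * 0 + 2 * 0"
    by (intro tendsto_add ennreal_tendsto_cmult assms) auto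
  then show "(\<lambda>k. 2 * sqnorm N (f k) + 2 * sqnorm N (g k)) \<longlonglongrightarrow> 0"
    by simp
qed auto

lemma borel_measurable_matrix_vector_mult [measurable (raw)]:
  fixes A :: "'a \<Rightarrow> real ^ 'n ^ 'm"
  assumes "A \<in> borel_measurable N" "x \<in> borel_measurable N"
  shows "(\<lambda>z. A z *v x z) \<in> borel_measurable N"
proof (rule borel_measurable_continuous_Pair[OF assms])
  show "continuous_on UNIV (\<lambda>p :: (real ^ 'n ^ 'm) \<times> (real ^ 'n). fst p *v snd p)"
    unfolding matrix_vector_mult_def
    by (intro continuous_on_vec_lambda continuous_intros)
qed

context ito_setting
begin

section \<open>The isometry for simple integrands\<close>

lemma inner_matrix_vector_eq_sum:
  fixes e f :: "real ^ 'r ^ 'm" and x y :: "real ^ 'r"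
  shows "(e *v x) \<bullet> (f *v y) = (\<Sum>k\<in>UNIV. \<Sum>i\<in>UNIV. \<Sum>j\<in>UNIV. (e $ k $ i * x $ i) * (f $ k $ j * y $ j))"
  by (simp add: inner_vec_def matrix_vector_mult_def sum_product)

lemma bounded_component:
  fixes e :: "'w \<Rightarrow> real ^ 'r ^ 'm"
  assumes "\<forall>\<omega>\<in>space M. norm (e \<omega>) \<le> C" "\<omega> \<in> space M"
  shows "\<bar>e \<omega> $ k $ i\<bar> \<le> C"
  using assms component_le_norm_cart[of "e \<omega> $ k" i] Finite_Cartesian_Product.norm_nth_le[of "e \<omega>" k]
  by (smt (verit, best))

text \<open>Independence of the past splits each coordinate product into a moment of the coefficients and
  a second moment of the increment, and only equal coordinates of the increment contribute.\<close>

lemma pairing_same_increment: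
  fixes e f :: "'w \<Rightarrow> real ^ 'r ^ 'm"
  assumes cd: "0 \<le> c" "c \<le> d"
    and e: "e \<in> borel_measurable (F c)" "\<forall>\<omega>\<in>space M. norm (e \<omega>) \<le> C"
    and f: "f \<in> borel_measurable (F c)" "\<forall>\<omega>\<in>space M. norm (f \<omega>) \<le> C'"
  shows "has_bochner_integral M (\<lambda>\<omega>. (e \<omega> *v (W d \<omega> - W c \<omega>)) \<bullet> (f \<omega> *v (W d \<omega> - W c \<omega>)))
     ((d - c) * (\<integral>\<omega>. e \<omega> \<bullet> f \<omega> \<partial>M))"
proof -
  let ?Z = "\<lambda>\<omega>. W d \<omega> - W c \<omega>"
  have [measurable]: "W c \<in> borel_measurable M" "W d \<in> borel_measurable M"
    using W_measurable cd by auto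
  have eM[measurable]: "e \<in> borel_measurable M" "f \<in> borel_measurable M"
    using measurable_F_M[OF e(1)] measurable_F_M[OF f(1)] by auto
  have Yi: "integrable M (\<lambda>\<omega>. e \<omega> $ k $ i * f \<omega> $ k $ j)" for k i j
  proof (rule integrable_const_bound[of _ "C * C'"])
    show "AE \<omega> in M. norm (e \<omega> $ k $ i * f \<omega> $ k $ j) \<le> C * C'"
      using bounded_component[OF e(2)] bounded_component[OF f(2)]
      by (intro AE_I2) (auto simp: abs_mult intro!: mult_mono order_trans[OF abs_ge_zero])
  qed measurable
  have Ym: "(\<lambda>\<omega>. e \<omega> $ k $ i * f \<omega> $ k $ j) \<in> borel_measurable (F c)" for k i j
    using e(1) f(1) by measurable
  have hi: "integrable M (\<lambda>\<omega>. ?Z \<omega> $ i * ?Z \<omega> $ j)" for i j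
    by (intro square_integrable_prod increment_square_integrable cd) measurable
  have 1: "has_bochner_integral M (\<lambda>\<omega>. (e \<omega> $ k $ i * ?Z \<omega> $ i) * (f \<omega> $ k $ j * ?Z \<omega> $ j))
    ((\<integral>\<omega>. e \<omega> $ k $ i * f \<omega> $ k $ j \<partial>M) * (if i = j then d - c else 0))" for k i j
  proof -
    have eq: "(e \<omega> $ k $ i * ?Z \<omega> $ i) * (f \<omega> $ k $ j * ?Z \<omega> $ j) = (e \<omega> $ k $ i * f \<omega> $ k $ j) * (?Z \<omega> $ i * ?Z \<omega> $ j)" for \<omega>
      by (simp only: mult_ac)
    show ?thesis
      unfolding eq has_bochner_integral_iff
      using past_times_increment[OF cd Ym Yi, of "\<lambda>y. y $ i * y $ j" k i j] hi[of i j]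
        increment_moments(2)[OF cd, of i j] by (simp del: vector_minus_component)
  qed
  have 2: "(\<integral>\<omega>. e \<omega> \<bullet> f \<omega> \<partial>M) = (\<Sum>k\<in>UNIV. \<Sum>i\<in>UNIV. \<integral>\<omega>. e \<omega> $ k $ i * f \<omega> $ k $ i \<partial>M)"
    unfolding inner_vec_def by (simp add: Yi)
  have "has_bochner_integral M (\<lambda>\<omega>. (e \<omega> *v ?Z \<omega>) \<bullet> (f \<omega> *v ?Z \<omega>))
    (\<Sum>k\<in>UNIV. \<Sum>i\<in>UNIV. \<Sum>j\<in>UNIV. (\<integral>\<omega>. e \<omega> $ k $ i * f \<omega> $ k $ j \<partial>M) * (if i = j then d - c else 0))"
    unfolding inner_matrix_vector_eq_sum by (intro has_bochner_integral_sum 1)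
  also have "(\<Sum>k\<in>UNIV. \<Sum>i\<in>UNIV. \<Sum>j\<in>UNIV. (\<integral>\<omega>. e \<omega> $ k $ i * f \<omega> $ k $ j \<partial>M) * (if i = j then d - c else 0))
     = (d - c) * (\<integral>\<omega>. e \<omega> \<bullet> f \<omega> \<partial>M)"
    unfolding 2 by (simp add: sum_distrib_left mult.commute if_distrib cong: if_cong)
  finally show ?thesis .
qed

text \<open>At time \<open>c\<close> everything except the later increment is known, and that increment has mean zero.\<close>

lemma pairing_disjoint_increments:
  fixes e f :: "'w \<Rightarrow> real ^ 'r ^ 'm"
  assumes ab: "0 \<le> a" "a \<le> b" and cd: "b \<le> c" "c \<le> d"
    and e: "e \<in> borel_measurable (F c)" "\<forall>\<omega>\<in>space M. norm (e \<omega>) \<le> C"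
    and f: "f \<in> borel_measurable (F c)" "\<forall>\<omega>\<in>space M. norm (f \<omega>) \<le> C'"
  shows "has_bochner_integral M (\<lambda>\<omega>. (e \<omega> *v (W b \<omega> - W a \<omega>)) \<bullet> (f \<omega> *v (W d \<omega> - W c \<omega>))) 0"
proof -
  let ?X = "\<lambda>\<omega>. W b \<omega> - W a \<omega>" and ?Z = "\<lambda>\<omega>. W d \<omega> - W c \<omega>"
  have c0: "0 \<le> c" using ab cd by simp
  have mM[measurable]: "W c \<in> borel_measurable M" "W d \<in> borel_measurable M"
    "W a \<in> borel_measurable M" "W b \<in> borel_measurable M"
    using W_measurable cd ab by auto
  have mF: "W a \<in> borel_measurable (F c)" "W b \<in> borel_measurable (F c)"
    using ab cd by (auto intro: measurable_F_mono[OF W_measurable_F])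
  have eM[measurable]: "e \<in> borel_measurable M" "f \<in> borel_measurable M"
    using measurable_F_M[OF e(1)] measurable_F_M[OF f(1)] by auto
  have Xi: "integrable M (\<lambda>\<omega>. ?X \<omega> $ i)" for i
    using square_integrable_prod[of "\<lambda>\<omega>. ?X \<omega> $ i" "\<lambda>_. 1"] increment_square_integrable(1)[OF ab, of i]
    by (simp del: vector_minus_component)
  have Zi: "integrable M (\<lambda>\<omega>. ?Z \<omega> $ i)" for i
    using square_integrable_prod[of "\<lambda>\<omega>. ?Z \<omega> $ i" "\<lambda>_. 1"] increment_square_integrable(1)[OF c0 cd(2), of i]
    by (simp del: vector_minus_component)
  have Yi: "integrable M (\<lambda>\<omega>. (e \<omega> $ k $ i * f \<omega> $ k $ j) * ?X \<omega> $ i)" for k i j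
  proof (rule Bochner_Integration.integrable_bound)
    show "integrable M (\<lambda>\<omega>. (C * C') * ?X \<omega> $ i)" using Xi by (intro integrable_mult_right)
    show "AE \<omega> in M. norm ((e \<omega> $ k $ i * f \<omega> $ k $ j) * ?X \<omega> $ i) \<le> norm ((C * C') * ?X \<omega> $ i)"
    proof (rule AE_I2)
      fix \<omega> assume w: "\<omega> \<in> space M"
      have "\<bar>e \<omega> $ k $ i * f \<omega> $ k $ j\<bar> \<le> C * C'"
        using bounded_component[OF e(2) w] bounded_component[OF f(2) w]
        by (auto simp: abs_mult intro!: mult_mono order_trans[OF abs_ge_zero])
      then have "\<bar>e \<omega> $ k $ i * f \<omega> $ k $ j\<bar> \<le> \<bar>C * C'\<bar>" by simp
      then show "norm ((e \<omega> $ k $ i * f \<omega> $ k $ j) * ?X \<omega> $ i) \<le> norm ((C * C') * ?X \<omega> $ i)"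
        unfolding norm_mult real_norm_def abs_mult[of _ "?X \<omega> $ i"] by (intro mult_right_mono) auto
    qed
  qed measurable
  have Ym: "(\<lambda>\<omega>. (e \<omega> $ k $ i * f \<omega> $ k $ j) * ?X \<omega> $ i) \<in> borel_measurable (F c)" for k i j
    using e(1) f(1) mF by measurable
  have 1: "has_bochner_integral M (\<lambda>\<omega>. (e \<omega> $ k $ i * ?X \<omega> $ i) * (f \<omega> $ k $ j * ?Z \<omega> $ j)) 0" for k i j
  proof -
    have eq: "(e \<omega> $ k $ i * ?X \<omega> $ i) * (f \<omega> $ k $ j * ?Z \<omega> $ j) = ((e \<omega> $ k $ i * f \<omega> $ k $ j) * ?X \<omega> $ i) * (?Z \<omega> $ j)" for \<omega>
      by (simp only: mult_ac)
    show ?thesis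
      unfolding eq has_bochner_integral_iff
      using past_times_increment[OF c0 cd(2) Ym Yi, of "\<lambda>y. y $ j" k i j] Zi[of j]
        increment_moments(1)[OF c0 cd(2), of j] by (simp del: vector_minus_component)
  qed
  have "has_bochner_integral M (\<lambda>\<omega>. (e \<omega> *v ?X \<omega>) \<bullet> (f \<omega> *v ?Z \<omega>))
    (\<Sum>k\<in>(UNIV::'m set). \<Sum>i\<in>(UNIV::'r set). \<Sum>j\<in>(UNIV::'r set). 0)"
    unfolding inner_matrix_vector_eq_sum by (intro has_bochner_integral_sum 1)
  then show ?thesis by simp
qed

text \<open>Cut both intervals at the ends of their overlap \<open>[c, m]\<close>.  The overlap paired with itself gives
  its length; all other pairs are disjoint, apart from the two pieces after \<open>m\<close>, one of which is
  degenerate.\<close>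

lemma pairing_increments_ordered:
  fixes e f :: "'w \<Rightarrow> real ^ 'r ^ 'm"
  assumes ab: "0 \<le> a" "a \<le> b" and cd: "a \<le> c" "c \<le> d"
    and e: "e \<in> borel_measurable (F a)" "\<forall>\<omega>\<in>space M. norm (e \<omega>) \<le> C"
    and f: "f \<in> borel_measurable (F c)" "\<forall>\<omega>\<in>space M. norm (f \<omega>) \<le> C'"
  shows "has_bochner_integral M (\<lambda>\<omega>. (e \<omega> *v (W b \<omega> - W a \<omega>)) \<bullet> (f \<omega> *v (W d \<omega> - W c \<omega>)))
    (max 0 (min b d - c) * (\<integral>\<omega>. e \<omega> \<bullet> f \<omega> \<partial>M))"
proof (cases "b \<le> c")
  case True
  then show ?thesis
    using pairing_disjoint_increments[OF ab True cd(2) measurable_F_mono[OF e(1) cd(1)] e(2) f] by simp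
next
  case False
  define m where "m = min b d"
  have o: "0 \<le> c" "c \<le> m" "m \<le> b" "m \<le> d" using False ab cd by (auto simp: m_def)
  note ec = measurable_F_mono[OF e(1) cd(1)]
  note em = measurable_F_mono[OF ec o(2)] note fm = measurable_F_mono[OF f(1) o(2)]
  have split: "(e \<omega> *v (W b \<omega> - W a \<omega>)) \<bullet> (f \<omega> *v (W d \<omega> - W c \<omega>)) =
     (e \<omega> *v (W c \<omega> - W a \<omega>)) \<bullet> (f \<omega> *v (W d \<omega> - W c \<omega>))
     + (e \<omega> *v (W m \<omega> - W c \<omega>)) \<bullet> (f \<omega> *v (W m \<omega> - W c \<omega>))
     + (e \<omega> *v (W m \<omega> - W c \<omega>)) \<bullet> (f \<omega> *v (W d \<omega> - W m \<omega>))
     + (f \<omega> *v (W m \<omega> - W c \<omega>)) \<bullet> (e \<omega> *v (W b \<omega> - W m \<omega>))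
     + (e \<omega> *v (W b \<omega> - W m \<omega>)) \<bullet> (f \<omega> *v (W d \<omega> - W m \<omega>))" for \<omega>
    by (simp add: matrix_vector_mult_diff_distrib inner_diff_left inner_diff_right inner_commute)
  have last: "(e \<omega> *v (W b \<omega> - W m \<omega>)) \<bullet> (f \<omega> *v (W d \<omega> - W m \<omega>)) = 0" for \<omega>
    by (cases "b \<le> d") (simp_all add: m_def)
  have "has_bochner_integral M (\<lambda>\<omega>. (e \<omega> *v (W b \<omega> - W a \<omega>)) \<bullet> (f \<omega> *v (W d \<omega> - W c \<omega>)))
    (0 + (m - c) * (\<integral>\<omega>. e \<omega> \<bullet> f \<omega> \<partial>M) + 0 + 0 + 0)"
    unfolding split last
    by (intro has_bochner_integral_add has_bochner_integral_zero
        pairing_disjoint_increments[OF ab(1) cd(1) order_refl cd(2) ec e(2) f]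
        pairing_same_increment[OF o(1,2) ec e(2) f]
        pairing_disjoint_increments[OF o(1,2) order_refl o(4) em e(2) fm f(2)]
        pairing_disjoint_increments[OF o(1,2) order_refl o(3) fm f(2) em e(2)])
  then show ?thesis using o by (simp add: m_def max_def)
qed

lemma pairing_increments:
  fixes e f :: "'w \<Rightarrow> real ^ 'r ^ 'm"
  assumes ab: "0 \<le> a" "a \<le> b" and cd: "0 \<le> c" "c \<le> d"
    and e: "e \<in> borel_measurable (F a)" "\<forall>\<omega>\<in>space M. norm (e \<omega>) \<le> C"
    and f: "f \<in> borel_measurable (F c)" "\<forall>\<omega>\<in>space M. norm (f \<omega>) \<le> C'"
  shows "has_bochner_integral M (\<lambda>\<omega>. (e \<omega> *v (W b \<omega> - W a \<omega>)) \<bullet> (f \<omega> *v (W d \<omega> - W c \<omega>)))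
    (max 0 (min b d - max a c) * (\<integral>\<omega>. e \<omega> \<bullet> f \<omega> \<partial>M))"
proof (cases "a \<le> c")
  case True
  then show ?thesis
    using pairing_increments_ordered[OF ab True cd(2) e f] by (simp add: max_absorb2)
next
  case False
  then have "c \<le> a" by simp
  from pairing_increments_ordered[OF cd this ab(2) f e] False
  show ?thesis by (simp add: inner_commute min.commute max_def)
qed

abbreviation P :: "('w \<times> real) measure" where "P \<equiv> M \<Otimes>\<^sub>M lborel"

text \<open>Simple integrands, as functions of outcome and time, together with their integrals.  The intervals
  may overlap: in this way sums of simple integrands are simple without a common refinement of
  partitions.\<close>

inductive simple_process :: "('w \<times> real \<Rightarrow> real ^ 'r ^ 'm) \<Rightarrow> ('w \<Rightarrow> real ^ 'm) \<Rightarrow> bool" where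
  zero: "simple_process (\<lambda>_. 0) (\<lambda>_. 0)"
| step: "0 \<le> a \<Longrightarrow> a \<le> b \<Longrightarrow> e \<in> borel_measurable (F a) \<Longrightarrow> \<forall>\<omega>\<in>space M. norm (e \<omega>) \<le> C \<Longrightarrow>
    simple_process \<phi> I \<Longrightarrow>
    simple_process (\<lambda>z. indicator {a..<b} (snd z) *\<^sub>R e (fst z) + \<phi> z)
      (\<lambda>\<omega>. e \<omega> *v (W b \<omega> - W a \<omega>) + I \<omega>)"

lemma simple_process_add:
  assumes "simple_process \<phi> I" "simple_process \<psi> J"
  shows "simple_process (\<lambda>z. \<phi> z + \<psi> z) (\<lambda>\<omega>. I \<omega> + J \<omega>)"
  using assms(1)
proof induction
  case zero
  then show ?case using assms(2) by simp
next
  case (step a b e C \<phi> I)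
  from simple_process.step[OF step.hyps(1-4) step.IH] show ?case
    by (simp add: add.assoc)
qed

lemma simple_process_uminus:
  assumes "simple_process \<phi> I"
  shows "simple_process (\<lambda>z. - \<phi> z) (\<lambda>\<omega>. - I \<omega>)"
  using assms
proof induction
  case zero
  then show ?case using simple_process.zero by simp
next
  case (step a b e C \<phi> I)
  have "simple_process (\<lambda>z. indicator {a..<b} (snd z) *\<^sub>R (- e (fst z)) + - \<phi> z)
      (\<lambda>\<omega>. (- e \<omega>) *v (W b \<omega> - W a \<omega>) + - I \<omega>)"
    using step by (intro simple_process.step[where C = C]) auto
  moreover have "(- e \<omega>) *v x = - (e \<omega> *v x)" for \<omega> x
    by (simp add: vec_eq_iff matrix_vector_mult_def sum_negf)
  ultimately show ?case by simp
qed

lemma simple_process_diff: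
  assumes "simple_process \<phi> I" "simple_process \<psi> J"
  shows "simple_process (\<lambda>z. \<phi> z - \<psi> z) (\<lambda>\<omega>. I \<omega> - J \<omega>)"
  using simple_process_add[OF assms(1) simple_process_uminus[OF assms(2)]] by simp

lemma simple_process_measurable:
  assumes "simple_process \<phi> I"
  shows "\<phi> \<in> borel_measurable P" "I \<in> borel_measurable M"
proof -
  have "\<phi> \<in> borel_measurable P \<and> I \<in> borel_measurable M"
    using assms
  proof induction
    case (step a b e C \<phi> I)
    have [measurable]: "e \<in> borel_measurable M" using step measurable_F_M by auto
    have [measurable]: "W a \<in> borel_measurable M" "W b \<in> borel_measurable M"
      using step W_measurable by auto
    have [measurable]: "\<phi> \<in> borel_measurable P" "I \<in> borel_measurable M" using step by auto
    show ?case by (intro conjI; measurable)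
  qed auto
  then show "\<phi> \<in> borel_measurable P" "I \<in> borel_measurable M" by auto
qed

text \<open>An integrand may be cut off before time \<open>s\<close> and multiplied by a variable known at time \<open>s\<close>.  The
  point of the quantifier order is that one variable \<open>I'\<close>, the integral over the times after \<open>s\<close>,
  serves for all multipliers \<open>h\<close>; the choice \<open>h = 1\<close> identifies it.\<close>

lemma simple_process_restrict:
  assumes "simple_process \<phi> I" "0 \<le> s"
  shows "\<exists>I'. \<forall>h C. h \<in> borel_measurable (F s) \<longrightarrow> (\<forall>\<omega>\<in>space M. \<bar>h \<omega>\<bar> \<le> (C::real)) \<longrightarrow>
    simple_process (\<lambda>z. (indicator {s..} (snd z) * h (fst z)) *\<^sub>R \<phi> z) (\<lambda>\<omega>. h \<omega> *\<^sub>R I' \<omega>)"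
  using assms(1)
proof induction
  case zero
  show ?case using simple_process.zero by (intro exI[of _ "\<lambda>_. 0"]) auto
next
  case (step a b e C \<phi> I)
  from step.IH obtain I' where I': "\<And>h C. h \<in> borel_measurable (F s) \<Longrightarrow> (\<forall>\<omega>\<in>space M. \<bar>h \<omega>\<bar> \<le> (C::real)) \<Longrightarrow>
    simple_process (\<lambda>z. (indicator {s..} (snd z) * h (fst z)) *\<^sub>R \<phi> z) (\<lambda>\<omega>. h \<omega> *\<^sub>R I' \<omega>)"
    by blast
  let ?a = "max a s" and ?b = "max b s"
  show ?case
  proof (intro exI[of _ "\<lambda>\<omega>. e \<omega> *v (W ?b \<omega> - W ?a \<omega>) + I' \<omega>"] allI impI)
    fix h and D :: real assume h: "h \<in> borel_measurable (F s)" "\<forall>\<omega>\<in>space M. \<bar>h \<omega>\<bar> \<le> D"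
    have [measurable]: "h \<in> borel_measurable (F ?a)" "e \<in> borel_measurable (F ?a)"
      by (auto intro: measurable_F_mono[OF h(1)] measurable_F_mono[OF step.hyps(3)])
    have bd: "\<forall>\<omega>\<in>space M. norm (h \<omega> *\<^sub>R e \<omega>) \<le> D * C"
    proof
      fix \<omega> assume "\<omega> \<in> space M"
      then show "norm (h \<omega> *\<^sub>R e \<omega>) \<le> D * C"
        using h(2) step.hyps(4) abs_ge_zero[of "h \<omega>"] by (auto intro!: mult_mono intro: order_trans)
    qed
    have "simple_process (\<lambda>z. indicator {?a..<?b} (snd z) *\<^sub>R (h (fst z) *\<^sub>R e (fst z)) + (indicator {s..} (snd z) * h (fst z)) *\<^sub>R \<phi> z)
        (\<lambda>\<omega>. (h \<omega> *\<^sub>R e \<omega>) *v (W ?b \<omega> - W ?a \<omega>) + h \<omega> *\<^sub>R I' \<omega>)"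
      by (rule simple_process.step[OF _ _ _ bd I'[OF h]]) (use step.hyps assms in auto)
    also have "(\<lambda>z. indicator {?a..<?b} (snd z) *\<^sub>R (h (fst z) *\<^sub>R e (fst z)) + (indicator {s..} (snd z) * h (fst z)) *\<^sub>R \<phi> z)
       = (\<lambda>z. (indicator {s..} (snd z) * h (fst z)) *\<^sub>R (indicator {a..<b} (snd z) *\<^sub>R e (fst z) + \<phi> z))"
      by (auto simp: fun_eq_iff indicator_def scaleR_add_right)
    also have "(\<lambda>\<omega>. (h \<omega> *\<^sub>R e \<omega>) *v (W ?b \<omega> - W ?a \<omega>) + h \<omega> *\<^sub>R I' \<omega>)
       = (\<lambda>\<omega>. h \<omega> *\<^sub>R (e \<omega> *v (W ?b \<omega> - W ?a \<omega>) + I' \<omega>))"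
      by (simp add: scaleR_matrix_vector_assoc scaleR_add_right)
    finally show "simple_process (\<lambda>z. (indicator {s..} (snd z) * h (fst z)) *\<^sub>R (indicator {a..<b} (snd z) *\<^sub>R e (fst z) + \<phi> z))
        (\<lambda>\<omega>. h \<omega> *\<^sub>R (e \<omega> *v (W ?b \<omega> - W ?a \<omega>) + I' \<omega>))" .
  qed
qed

lemma isometry_single_single:
  fixes e f :: "'w \<Rightarrow> real ^ 'r ^ 'm"
  assumes ab: "0 \<le> a" "a \<le> b" and cd: "0 \<le> c" "c \<le> d"
    and e: "e \<in> borel_measurable (F a)" "\<forall>\<omega>\<in>space M. norm (e \<omega>) \<le> C"
    and f: "f \<in> borel_measurable (F c)" "\<forall>\<omega>\<in>space M. norm (f \<omega>) \<le> C'"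
  shows "has_bochner_integral P (\<lambda>z. (indicator {a..<b} (snd z) *\<^sub>R e (fst z)) \<bullet> (indicator {c..<d} (snd z) *\<^sub>R f (fst z)))
    (max 0 (min b d - max a c) * (\<integral>\<omega>. e \<omega> \<bullet> f \<omega> \<partial>M))"
proof -
  interpret PP: pair_sigma_finite M lborel ..
  have eM[measurable]: "e \<in> borel_measurable M" "f \<in> borel_measurable M"
    using measurable_F_M[OF e(1)] measurable_F_M[OF f(1)] by auto
  let ?l = "max 0 (min b d - max a c)" and ?S = "{max a c..<min b d}"
  have eq: "(indicator {a..<b} (snd z) *\<^sub>R e (fst z)) \<bullet> (indicator {c..<d} (snd z) *\<^sub>R f (fst z))
     = (e (fst z) \<bullet> f (fst z)) * indicator ?S (snd z)" for z :: "'w \<times> real"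
    by (auto simp: indicator_def)
  have Yi: "integrable M (\<lambda>\<omega>. e \<omega> \<bullet> f \<omega>)"
  proof (rule integrable_const_bound[of _ "C * C'"])
    show "AE \<omega> in M. norm (e \<omega> \<bullet> f \<omega>) \<le> C * C'"
    proof (rule AE_I2)
      fix \<omega> assume w: "\<omega> \<in> space M"
      have "\<bar>e \<omega> \<bullet> f \<omega>\<bar> \<le> norm (e \<omega>) * norm (f \<omega>)" by (rule Cauchy_Schwarz_ineq2)
      also have "\<dots> \<le> C * C'"
        using w e(2) f(2) norm_ge_zero[of "e \<omega>"] by (intro mult_mono) (auto intro: order_trans[OF norm_ge_zero])
      finally show "norm (e \<omega> \<bullet> f \<omega>) \<le> C * C'" by simp
    qed
  qed measurable
  have len: "measure lborel ?S = ?l" "emeasure lborel ?S < \<infinity>"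
  proof -
    have "measure lborel {p..<q} = max 0 (q - p) \<and> emeasure lborel {p..<q} < \<infinity>" for p q :: real
      by (cases "p \<le> q") auto
    then show "measure lborel ?S = ?l" "emeasure lborel ?S < \<infinity>" by blast+
  qed
  have Si: "integrable lborel (\<lambda>t. x * indicator ?S t)" "(\<integral>t. x * indicator ?S t \<partial>lborel) = x * ?l" for x :: real
    using len by auto
  let ?g = "\<lambda>z. (e (fst z) \<bullet> f (fst z)) * indicator ?S (snd z)"
  have int: "integrable P ?g"
  proof (rule PP.Fubini_integrable)
    have "(\<lambda>\<omega>. \<integral>t. norm (?g (\<omega>, t)) \<partial>lborel) = (\<lambda>\<omega>. norm (e \<omega> \<bullet> f \<omega>) * ?l)"
      by (simp add: abs_mult len(1))
    then show "integrable M (\<lambda>\<omega>. \<integral>t. norm (?g (\<omega>, t)) \<partial>lborel)" using Yi by simp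
  qed (use Si in auto)
  have "(\<integral>z. ?g z \<partial>P) = (\<integral>\<omega>. \<integral>t. ?g (\<omega>, t) \<partial>lborel \<partial>M)"
    using int by (simp add: PP.integral_fst'[symmetric])
  also have "\<dots> = ?l * (\<integral>\<omega>. e \<omega> \<bullet> f \<omega> \<partial>M)"
    by (simp add: len(1))
  finally show ?thesis using int unfolding eq by (simp add: has_bochner_integral_iff)
qed

lemma isometry_single_simple:
  fixes e :: "'w \<Rightarrow> real ^ 'r ^ 'm"
  assumes ab: "0 \<le> a" "a \<le> b" and e: "e \<in> borel_measurable (F a)" "\<forall>\<omega>\<in>space M. norm (e \<omega>) \<le> C"
    and "simple_process \<psi> J"
  shows "\<exists>v. has_bochner_integral M (\<lambda>\<omega>. (e \<omega> *v (W b \<omega> - W a \<omega>)) \<bullet> J \<omega>) v \<and>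
    has_bochner_integral P (\<lambda>z. (indicator {a..<b} (snd z) *\<^sub>R e (fst z)) \<bullet> \<psi> z) v"
  using assms(5)
proof induction
  case zero
  show ?case by (intro exI[of _ 0]) (auto intro: has_bochner_integral_zero)
next
  case (step c d f C' \<phi> I)
  from step.IH obtain v where v: "has_bochner_integral M (\<lambda>\<omega>. (e \<omega> *v (W b \<omega> - W a \<omega>)) \<bullet> I \<omega>) v"
    "has_bochner_integral P (\<lambda>z. (indicator {a..<b} (snd z) *\<^sub>R e (fst z)) \<bullet> \<phi> z) v" by blast
  note 1 = pairing_increments[OF ab step.hyps(1,2) e step.hyps(3,4)]
  note 2 = isometry_single_single[OF ab step.hyps(1,2) e step.hyps(3,4)]
  show ?case
    unfolding inner_add_right
    using has_bochner_integral_add[OF 1 v(1)] has_bochner_integral_add[OF 2 v(2)] by blast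
qed

text \<open>Both sides are bilinear, so that the isometry follows from the case of two single intervals by
  induction on both integrands.\<close>

lemma isometry_simple_simple:
  fixes \<phi> \<psi> :: "'w \<times> real \<Rightarrow> real ^ 'r ^ 'm"
  assumes "simple_process \<phi> I" "simple_process \<psi> J"
  shows "\<exists>v. has_bochner_integral M (\<lambda>\<omega>. I \<omega> \<bullet> J \<omega>) v \<and> has_bochner_integral P (\<lambda>z. \<phi> z \<bullet> \<psi> z) v"
  using assms(1)
proof induction
  case zero
  show ?case by (intro exI[of _ 0]) (auto intro: has_bochner_integral_zero)
next
  case (step a b e C \<phi> I)
  from step.IH obtain v where v: "has_bochner_integral M (\<lambda>\<omega>. I \<omega> \<bullet> J \<omega>) v"
    "has_bochner_integral P (\<lambda>z. \<phi> z \<bullet> \<psi> z) v" by blast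
  from isometry_single_simple[OF step.hyps(1-4) assms(2)] obtain w where
    w: "has_bochner_integral M (\<lambda>\<omega>. (e \<omega> *v (W b \<omega> - W a \<omega>)) \<bullet> J \<omega>) w"
    "has_bochner_integral P (\<lambda>z. (indicator {a..<b} (snd z) *\<^sub>R e (fst z)) \<bullet> \<psi> z) w" by blast
  show ?case
    unfolding inner_add_left
    using has_bochner_integral_add[OF w(1) v(1)] has_bochner_integral_add[OF w(2) v(2)] by blast
qed

lemma simple_isometry:
  assumes "simple_process \<phi> I"
  shows "sqnorm M I = sqnorm P \<phi>"
proof -
  from isometry_simple_simple[OF assms assms] obtain v where
    v: "has_bochner_integral M (\<lambda>\<omega>. I \<omega> \<bullet> I \<omega>) v" "has_bochner_integral P (\<lambda>z. \<phi> z \<bullet> \<phi> z) v" by blast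
  show ?thesis
    using v unfolding sqnorm_def power2_norm_eq_inner has_bochner_integral_iff
    by (simp add: nn_integral_eq_integral)
qed

section \<open>The Ito integral as a closure\<close>

text \<open>The \<open>L\<^sup>2\<close> closure of the graph of the elementary integral.  It determines \<open>J\<close> up to null sets.\<close>

definition ito :: "('w \<times> real \<Rightarrow> real ^ 'r ^ 'm) \<Rightarrow> ('w \<Rightarrow> real ^ 'm) \<Rightarrow> bool" where
  "ito H J \<longleftrightarrow> H \<in> borel_measurable P \<and> J \<in> borel_measurable M \<and>
     (\<exists>\<phi> I. (\<forall>k. simple_process (\<phi> k) (I k)) \<and>
        (\<lambda>k. sqnorm P (\<lambda>z. H z - \<phi> k z)) \<longlonglongrightarrow> 0 \<and>
        (\<lambda>k. sqnorm M (\<lambda>\<omega>. J \<omega> - I k \<omega>)) \<longlonglongrightarrow> 0)"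

lemma ito_measurable: "ito H J \<Longrightarrow> H \<in> borel_measurable P" "ito H J \<Longrightarrow> J \<in> borel_measurable M"
  by (auto simp: ito_def)

lemma ito_zero: "ito (\<lambda>_. 0) (\<lambda>_. 0)"
  unfolding ito_def
  by (intro conjI exI[of _ "\<lambda>_ _. 0"]) (auto intro: simple_process.zero simp: sqnorm_def)

lemma ito_add:
  assumes "ito H J" "ito H' J'"
  shows "ito (\<lambda>z. H z + H' z) (\<lambda>\<omega>. J \<omega> + J' \<omega>)"
proof -
  obtain \<phi> I \<phi>' I' where a: "\<And>k. simple_process (\<phi> k) (I k)" "\<And>k. simple_process (\<phi>' k) (I' k)"
    and l: "(\<lambda>k. sqnorm P (\<lambda>z. H z - \<phi> k z)) \<longlonglongrightarrow> 0" "(\<lambda>k. sqnorm M (\<lambda>\<omega>. J \<omega> - I k \<omega>)) \<longlonglongrightarrow> 0"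
      "(\<lambda>k. sqnorm P (\<lambda>z. H' z - \<phi>' k z)) \<longlonglongrightarrow> 0" "(\<lambda>k. sqnorm M (\<lambda>\<omega>. J' \<omega> - I' k \<omega>)) \<longlonglongrightarrow> 0"
    using assms unfolding ito_def by blast
  note [measurable] = ito_measurable[OF assms(1)] ito_measurable[OF assms(2)]
    simple_process_measurable[OF a(1)] simple_process_measurable[OF a(2)]
  have "(\<lambda>k. sqnorm P (\<lambda>z. (H z + H' z) - (\<phi> k z + \<phi>' k z))) \<longlonglongrightarrow> 0"
    by (rule sqnorm_tendsto_0_add[OF _ _ l(1) l(3)]) (measurable, measurable, simp add: algebra_simps)
  moreover have "(\<lambda>k. sqnorm M (\<lambda>\<omega>. (J \<omega> + J' \<omega>) - (I k \<omega> + I' k \<omega>))) \<longlonglongrightarrow> 0"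
    by (rule sqnorm_tendsto_0_add[OF _ _ l(2) l(4)]) (measurable, measurable, simp add: algebra_simps)
  moreover have "simple_process (\<lambda>z. \<phi> k z + \<phi>' k z) (\<lambda>\<omega>. I k \<omega> + I' k \<omega>)" for k
    by (rule simple_process_add[OF a])
  ultimately show ?thesis
    unfolding ito_def
    by (intro conjI exI[of _ "\<lambda>k z. \<phi> k z + \<phi>' k z"] exI[of _ "\<lambda>k \<omega>. I k \<omega> + I' k \<omega>"]) auto
qed

lemma ito_uminus:
  assumes "ito H J"
  shows "ito (\<lambda>z. - H z) (\<lambda>\<omega>. - J \<omega>)"
proof -
  obtain \<phi> I where a: "\<And>k. simple_process (\<phi> k) (I k)"
    and l: "(\<lambda>k. sqnorm P (\<lambda>z. H z - \<phi> k z)) \<longlonglongrightarrow> 0" "(\<lambda>k. sqnorm M (\<lambda>\<omega>. J \<omega> - I k \<omega>)) \<longlonglongrightarrow> 0"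
    using assms unfolding ito_def by blast
  show ?thesis
    unfolding ito_def
    using l simple_process_uminus[OF a] ito_measurable[OF assms(1)]
    by (intro conjI exI[of _ "\<lambda>k z. - \<phi> k z"] exI[of _ "\<lambda>k \<omega>. - I k \<omega>"])
      (auto simp: sqnorm_def norm_minus_commute)
qed

lemma ito_diff:
  assumes "ito H J" "ito H' J'"
  shows "ito (\<lambda>z. H z - H' z) (\<lambda>\<omega>. J \<omega> - J' \<omega>)"
  using ito_add[OF assms(1) ito_uminus[OF assms(2)]] by simp

lemma ito_sum:
  assumes "\<And>i. i < (n::nat) \<Longrightarrow> ito (H i) (J i)"
  shows "ito (\<lambda>z. \<Sum>i<n. H i z) (\<lambda>\<omega>. \<Sum>i<n. J i \<omega>)"
  using assms by (induction n) (auto intro: ito_zero ito_add)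

text \<open>The isometry for simple integrands passes to the limit.  Using the triangle inequality only in
  the form \<open>|a + b|\<^sup>2 \<le> 2 |a|\<^sup>2 + 2 |b|\<^sup>2\<close> costs the factor \<open>4\<close>, which is harmless below.\<close>

lemma ito_inequality:
  assumes "ito H J"
  shows "sqnorm M J \<le> 4 * sqnorm P H"
proof -
  obtain \<phi> I where a: "\<And>k. simple_process (\<phi> k) (I k)"
    and l: "(\<lambda>k. sqnorm P (\<lambda>z. H z - \<phi> k z)) \<longlonglongrightarrow> 0" "(\<lambda>k. sqnorm M (\<lambda>\<omega>. J \<omega> - I k \<omega>)) \<longlonglongrightarrow> 0"
    using assms unfolding ito_def by blast
  note [measurable] = ito_measurable[OF assms(1)] simple_process_measurable[OF a]
  have bd: "sqnorm M J \<le> 2 * sqnorm M (\<lambda>\<omega>. J \<omega> - I k \<omega>) + (4 * sqnorm P H + 4 * sqnorm P (\<lambda>z. H z - \<phi> k z))" for k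
  proof -
    have "sqnorm M J \<le> 2 * sqnorm M (\<lambda>\<omega>. J \<omega> - I k \<omega>) + 2 * sqnorm M (I k)"
      using sqnorm_add[of "\<lambda>\<omega>. J \<omega> - I k \<omega>" M "I k"] by simp
    moreover have "sqnorm M (I k) \<le> 2 * sqnorm P H + 2 * sqnorm P (\<lambda>z. H z - \<phi> k z)"
      using sqnorm_add[of H P "\<lambda>z. \<phi> k z - H z"] simple_isometry[OF a[of k]]
      by (simp add: sqnorm_minus_commute[of P H])
    then have "2 * sqnorm M (I k) \<le> 2 * (2 * sqnorm P H + 2 * sqnorm P (\<lambda>z. H z - \<phi> k z))"
      by (rule mult_left_mono) simp
    then have "2 * sqnorm M (I k) \<le> 4 * sqnorm P H + 4 * sqnorm P (\<lambda>z. H z - \<phi> k z)"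
      by (simp add: distrib_left mult.assoc[symmetric])
    ultimately show ?thesis
      by (meson add_left_mono order_trans)
  qed
  have "(\<lambda>k. 2 * sqnorm M (\<lambda>\<omega>. J \<omega> - I k \<omega>) + (4 * sqnorm P H + 4 * sqnorm P (\<lambda>z. H z - \<phi> k z)))
      \<longlonglongrightarrow> 2 * 0 + (4 * sqnorm P H + 4 * 0)"
    by (intro tendsto_add ennreal_tendsto_cmult l tendsto_const) auto
  from LIMSEQ_le_const[OF this] bd show ?thesis by simp
qed

text \<open>The integral over times after \<open>s\<close> commutes with multiplication by an event known at time \<open>s\<close>.
  For simple integrands this is \<open>simple_process_restrict\<close>.  In general, cutting the
  approximating integrands off at \<open>s\<close> changes them by no more than their distance from \<open>H\<close>, and the
  isometry carries this over to the integrals.\<close>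

lemma ito_restrict:
  assumes "ito H J" "0 \<le> s" "B \<in> sets (F s)"
    and vanish: "\<And>z. snd z < s \<Longrightarrow> H z = 0"
  shows "ito (\<lambda>z. indicator B (fst z) *\<^sub>R H z) (\<lambda>\<omega>. indicator B \<omega> *\<^sub>R J \<omega>)"
proof -
  obtain \<phi> I where a: "\<And>k. simple_process (\<phi> k) (I k)"
    and l: "(\<lambda>k. sqnorm P (\<lambda>z. H z - \<phi> k z)) \<longlonglongrightarrow> 0" "(\<lambda>k. sqnorm M (\<lambda>\<omega>. J \<omega> - I k \<omega>)) \<longlonglongrightarrow> 0"
    using assms unfolding ito_def by blast
  define Q where "Q k I' \<longleftrightarrow> (\<forall>h C. h \<in> borel_measurable (F s) \<longrightarrow> (\<forall>\<omega>\<in>space M. \<bar>h \<omega>\<bar> \<le> (C::real)) \<longrightarrow>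
    simple_process (\<lambda>z. (indicator {s..} (snd z) * h (fst z)) *\<^sub>R \<phi> k z) (\<lambda>\<omega>. h \<omega> *\<^sub>R I' \<omega>))" for k I'
  have "\<forall>k. \<exists>I'. Q k I'"
    unfolding Q_def using simple_process_restrict[OF a assms(2)] by blast
  then obtain I' where "\<And>k. Q k (I' k)" by metis
  then have I': "\<And>k h C. h \<in> borel_measurable (F s) \<Longrightarrow> (\<forall>\<omega>\<in>space M. \<bar>h \<omega>\<bar> \<le> (C::real)) \<Longrightarrow>
    simple_process (\<lambda>z. (indicator {s..} (snd z) * h (fst z)) *\<^sub>R \<phi> k z) (\<lambda>\<omega>. h \<omega> *\<^sub>R I' k \<omega>)"
    unfolding Q_def by blast
  have r1: "simple_process (\<lambda>z. indicator {s..} (snd z) *\<^sub>R \<phi> k z) (I' k)" for k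
    using I'[of "\<lambda>_. 1" 1 k] by simp
  have rB: "simple_process (\<lambda>z. (indicator {s..} (snd z) * indicator B (fst z)) *\<^sub>R \<phi> k z) (\<lambda>\<omega>. indicator B \<omega> *\<^sub>R I' k \<omega>)" for k
    using assms(3) by (intro I'[of _ 1]) (auto simp: indicator_def)
  have [measurable]: "B \<in> sets M" using assms(3) sets_F_subset by blast
  note [measurable] = ito_measurable[OF assms(1)] simple_process_measurable[OF a] simple_process_measurable[OF r1]
  have "sqnorm M (\<lambda>\<omega>. I k \<omega> - I' k \<omega>) \<le> sqnorm P (\<lambda>z. H z - \<phi> k z)" for k
  proof -
    have "sqnorm M (\<lambda>\<omega>. I k \<omega> - I' k \<omega>) = sqnorm P (\<lambda>z. \<phi> k z - indicator {s..} (snd z) *\<^sub>R \<phi> k z)"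
      by (rule simple_isometry[OF simple_process_diff[OF a r1]])
    also have "\<dots> \<le> sqnorm P (\<lambda>z. H z - \<phi> k z)"
      using vanish by (intro sqnorm_mono_AE AE_I2) (auto simp: indicator_def not_le)
    finally show ?thesis .
  qed
  then have l3: "(\<lambda>k. sqnorm M (\<lambda>\<omega>. I k \<omega> - I' k \<omega>)) \<longlonglongrightarrow> 0"
    by (intro tendsto_sandwich[OF _ _ tendsto_const l(1)]) auto
  have "(\<lambda>k. sqnorm M (\<lambda>\<omega>. indicator B \<omega> *\<^sub>R J \<omega> - indicator B \<omega> *\<^sub>R I' k \<omega>)) \<longlonglongrightarrow> 0"
    by (rule sqnorm_tendsto_0_add[OF _ _ l(2) l3]) (measurable, measurable, auto simp: indicator_def)
  moreover have "(\<lambda>k. sqnorm P (\<lambda>z. indicator B (fst z) *\<^sub>R H z - (indicator {s..} (snd z) * indicator B (fst z)) *\<^sub>R \<phi> k z)) \<longlonglongrightarrow> 0"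
  proof (rule tendsto_sandwich[OF _ _ tendsto_const l(1)])
    show "\<forall>\<^sub>F k in sequentially. sqnorm P (\<lambda>z. indicator B (fst z) *\<^sub>R H z - (indicator {s..} (snd z) * indicator B (fst z)) *\<^sub>R \<phi> k z)
      \<le> sqnorm P (\<lambda>z. H z - \<phi> k z)"
      using vanish by (intro always_eventually allI sqnorm_mono_AE AE_I2) (auto simp: indicator_def not_le)
  qed auto
  ultimately show ?thesis
    unfolding ito_def using rB
    by (intro conjI exI[of _ "\<lambda>k z. (indicator {s..} (snd z) * indicator B (fst z)) *\<^sub>R \<phi> k z"]
        exI[of _ "\<lambda>k \<omega>. indicator B \<omega> *\<^sub>R I' k \<omega>"]) auto
qed

end

lemma grid_mono:
  fixes g :: "nat \<Rightarrow> 'a :: preorder"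
  assumes "\<And>i. i < n \<Longrightarrow> g i \<le> g (Suc i)" "i \<le> j" "j \<le> n"
  shows "g i \<le> g j"
  using assms(2,3)
proof (induction j rule: dec_induct)
  case (step k)
  then show ?case using assms(1)[of k] by (meson Suc_leD Suc_le_lessD order_trans)
qed simp

lemma grid_point_le:
  assumes "0 \<le> T" "i \<le> Suc n"
  shows "T * real i / real (Suc n) \<le> T"
proof -
  have "T * real i \<le> T * real (Suc n)" using assms by (intro mult_left_mono) auto
  then show ?thesis by (simp add: divide_le_eq)
qed

lemma eventually_mesh_less:
  assumes "0 < (e::real)"
  shows "\<forall>\<^sub>F n in sequentially. T * inverse (real (Suc n)) < e"
proof (rule order_tendstoD(2)[OF _ assms])
  show "(\<lambda>n. T * inverse (real (Suc n))) \<longlonglongrightarrow> 0"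
    using tendsto_mult[OF tendsto_const[of T] LIMSEQ_inverse_real_of_nat] by simp
qed

context ito_setting
begin

lemma sqnorm_P_iterated:
  fixes f :: "'w \<times> real \<Rightarrow> 'b :: euclidean_space"
  assumes "f \<in> borel_measurable P"
  shows "sqnorm P f = (\<integral>\<^sup>+\<omega>. \<integral>\<^sup>+t. ennreal ((norm (f (\<omega>, t)))\<^sup>2) \<partial>lborel \<partial>M)"
proof -
  have "(\<lambda>z. ennreal ((norm (f z))\<^sup>2)) \<in> borel_measurable P"
    using assms by simp
  from lborel.nn_integral_fst[OF this] show ?thesis by (simp add: sqnorm_def)
qed

lemma measurable_process_extend:
  fixes H :: "real \<Rightarrow> 'w \<Rightarrow> real ^ 'r ^ 'm"
  assumes "(\<lambda>(t, \<omega>). H t \<omega>) \<in> borel_measurable (restrict_space borel {0..T} \<Otimes>\<^sub>M M)"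
  shows "(\<lambda>z. indicator {0..T} (snd z) *\<^sub>R H (snd z) (fst z)) \<in> borel_measurable P"
proof -
  let ?D = "{z. snd z \<in> {0..T}}"
  have "(\<lambda>z. snd z) \<in> measurable (restrict_space P ?D) (restrict_space borel {0..T})"
    by (rule measurable_restrict_space2)
      (auto simp: space_restrict_space intro!: measurable_restrict_space1 measurable_snd''[OF measurable_ident_sets])
  moreover have "(\<lambda>z. fst z) \<in> measurable (restrict_space P ?D) M"
    by (intro measurable_restrict_space1) measurable
  ultimately have "(\<lambda>z. (snd z, fst z)) \<in> measurable (restrict_space P ?D) (restrict_space borel {0..T} \<Otimes>\<^sub>M M)"
    by (rule measurable_Pair)
  from measurable_compose[OF this assms]
  have "(\<lambda>z. H (snd z) (fst z)) \<in> borel_measurable (restrict_space P ?D)"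
    by simp
  moreover have "?D \<inter> space P \<in> sets P" by measurable
  ultimately have "(\<lambda>z. indicator ?D z *\<^sub>R H (snd z) (fst z)) \<in> borel_measurable P"
    by (subst (asm) borel_measurable_restrict_space_iff) auto
  also have "(\<lambda>z. indicator ?D z *\<^sub>R H (snd z) (fst z)) = (\<lambda>z. indicator {0..T} (snd z) *\<^sub>R H (snd z) (fst z))"
    by (auto simp: indicator_def fun_eq_iff)
  finally show ?thesis .
qed

lemma elementary_grid_bounds:
  assumes "elementary_integrand M F T n s e" "i \<le> n"
  shows "0 \<le> s i" "s i \<le> T"
  using assms grid_mono[of n s 0 i] grid_mono[of n s i n] by (auto simp: elementary_integrand_def)

lemma elementary_is_simple:
  fixes e :: "nat \<Rightarrow> 'w \<Rightarrow> real ^ 'r ^ 'm"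
  assumes "elementary_integrand M F T n s e"
  shows "simple_process (\<lambda>z. elementary_process n s e (snd z) (fst z)) (elementary_integral W n s e)"
proof -
  have "simple_process (\<lambda>z. \<Sum>i<k. indicator {s i..<s (Suc i)} (snd z) *\<^sub>R e i (fst z))
      (\<lambda>\<omega>. \<Sum>i<k. e i \<omega> *v (W (s (Suc i)) \<omega> - W (s i) \<omega>))" if "k \<le> n" for k
    using that
  proof (induction k)
    case 0
    show ?case by (simp add: simple_process.zero)
  next
    case (Suc k)
    then have k: "s k \<le> s (Suc k) \<and> e k \<in> borel_measurable (F (s k)) \<and> (\<exists>C. \<forall>\<omega>\<in>space M. norm (e k \<omega>) \<le> C)"
      using assms unfolding elementary_integrand_def by (metis Suc_le_lessD)
    then obtain C where "\<forall>\<omega>\<in>space M. norm (e k \<omega>) \<le> C" "e k \<in> borel_measurable (F (s k))" "s k \<le> s (Suc k)"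
      by blast
    with Suc elementary_grid_bounds[OF assms, of k]
    have "simple_process (\<lambda>z. indicator {s k..<s (Suc k)} (snd z) *\<^sub>R e k (fst z) + (\<Sum>i<k. indicator {s i..<s (Suc i)} (snd z) *\<^sub>R e i (fst z)))
      (\<lambda>\<omega>. e k \<omega> *v (W (s (Suc k)) \<omega> - W (s k) \<omega>) + (\<Sum>i<k. e i \<omega> *v (W (s (Suc i)) \<omega> - W (s i) \<omega>)))"
      by (intro simple_process.step) (auto simp del: sum_indicator_scaleR)
    then show ?case by (simp add: add.commute)
  qed
  from this[of n] show ?thesis
    by (simp add: elementary_process_def elementary_integral_def[abs_def])
qed

lemma elementary_process_outside:
  assumes "elementary_integrand M F T n s e" "t \<notin> {0..T}"
  shows "elementary_process n s e t \<omega> = 0"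
  unfolding elementary_process_def
proof (rule sum.neutral, rule ballI)
  fix i assume "i \<in> {..<n}"
  then show "indicator {s i..<s (Suc i)} t *\<^sub>R e i \<omega> = 0"
    using elementary_grid_bounds[OF assms(1), of i] elementary_grid_bounds[OF assms(1), of "Suc i"] assms(2)
    by (auto simp: indicator_def)
qed

text \<open>The elementary integrands that approximate \<open>H\<close> are simple processes and vanish off \<open>[0, T]\<close>, so
  that the approximation over \<open>[0, T]\<close> is one over the whole time axis.\<close>

lemma has_ito_integral_imp_ito:
  fixes H :: "real \<Rightarrow> 'w \<Rightarrow> real ^ 'r ^ 'm"
  assumes "has_ito_integral M F W T H J"
  shows "ito (\<lambda>z. indicator {0..T} (snd z) *\<^sub>R H (snd z) (fst z)) J"
proof -
  let ?H = "\<lambda>z. indicator {0..T} (snd z) *\<^sub>R H (snd z) (fst z)"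
  from assms have [measurable]: "?H \<in> borel_measurable P" "J \<in> borel_measurable M"
    by (auto simp: has_ito_integral_def intro: measurable_process_extend)
  obtain n s e where el: "\<And>k. elementary_integrand M F T (n k) (s k) (e k)"
    and l: "(\<lambda>k. \<integral>\<^sup>+\<omega>. (\<integral>\<^sup>+t\<in>{0..T}.
               ennreal ((norm (H t \<omega> - elementary_process (n k) (s k) (e k) t \<omega>))\<^sup>2) \<partial>lborel) \<partial>M) \<longlonglongrightarrow> 0"
    and l2: "(\<lambda>k. \<integral>\<^sup>+\<omega>. ennreal ((norm (J \<omega> - elementary_integral W (n k) (s k) (e k) \<omega>))\<^sup>2) \<partial>M) \<longlonglongrightarrow> 0"
    using assms unfolding has_ito_integral_def by blast
  note sp = elementary_is_simple[OF el]
  note [measurable] = simple_process_measurable[OF sp]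
  have "sqnorm P (\<lambda>z. ?H z - elementary_process (n k) (s k) (e k) (snd z) (fst z)) =
     (\<integral>\<^sup>+\<omega>. (\<integral>\<^sup>+t\<in>{0..T}.
               ennreal ((norm (H t \<omega> - elementary_process (n k) (s k) (e k) t \<omega>))\<^sup>2) \<partial>lborel) \<partial>M)" for k
    by (subst sqnorm_P_iterated, measurable)
      (auto intro!: nn_integral_cong simp: indicator_def elementary_process_outside[OF el])
  with l l2 sp show ?thesis
    unfolding ito_def sqnorm_def[of M]
    by (intro conjI exI[of _ "\<lambda>k z. elementary_process (n k) (s k) (e k) (snd z) (fst z)"]
        exI[of _ "\<lambda>k. elementary_integral W (n k) (s k) (e k)"]) auto
qed

section \<open>Integral processes on a grid\<close>

text \<open>Each \<open>J t\<close> is a version of the integral over \<open>[0, t]\<close>, chosen separately for every \<open>t\<close>; in particular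
  the paths of \<open>J\<close> need not be continuous.\<close>

definition ito_process :: "('w \<times> real \<Rightarrow> real ^ 'r ^ 'm) \<Rightarrow> (real \<Rightarrow> 'w \<Rightarrow> real ^ 'm) \<Rightarrow> bool" where
  "ito_process H J \<longleftrightarrow> (\<forall>t\<ge>0. ito (\<lambda>z. indicator {0..t} (snd z) *\<^sub>R H z) (J t))"

lemma ito_process_diff:
  assumes "ito_process H J" "ito_process H' J'"
  shows "ito_process (\<lambda>z. H z - H' z) (\<lambda>t \<omega>. J t \<omega> - J' t \<omega>)"
  unfolding ito_process_def scaleR_diff_right using assms
  by (auto simp: ito_process_def intro: ito_diff)

lemma ito_process_initial:
  assumes "ito_process H J"
  shows "AE \<omega> in M. J 0 \<omega> = 0"
proof -
  have i: "ito (\<lambda>z. indicator {0..0} (snd z) *\<^sub>R H z) (J 0)"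
    using assms unfolding ito_process_def by (metis order_refl)
  note [measurable] = ito_measurable[OF i]
  have "(\<integral>\<^sup>+t. ennreal ((norm (indicator {0..0} t *\<^sub>R H (\<omega>, t)))\<^sup>2) \<partial>lborel) = 0" for \<omega>
  proof -
    have "(\<integral>\<^sup>+t. ennreal ((norm (indicator {0..0} t *\<^sub>R H (\<omega>, t)))\<^sup>2) \<partial>lborel) = (\<integral>\<^sup>+(t::real). 0 \<partial>lborel)"
      using AE_lborel_singleton[of "0::real"] by (intro nn_integral_cong_AE) (auto elim!: eventually_mono)
    then show ?thesis by simp
  qed
  then have "sqnorm P (\<lambda>z. indicator {0..0} (snd z) *\<^sub>R H z) = (\<integral>\<^sup>+\<omega>. 0 \<partial>M)"
    by (simp only: sqnorm_P_iterated[OF ito_measurable(1)[OF i]] snd_conv)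
  with ito_inequality[OF i] have "sqnorm M (J 0) = 0" by simp
  then have "AE \<omega> in M. ennreal ((norm (J 0 \<omega>))\<^sup>2) = 0"
    unfolding sqnorm_def by (subst (asm) nn_integral_0_iff_AE) auto
  then show ?thesis by eventually_elim simp
qed

lemma ito_increment:
  assumes "ito_process H J" "0 \<le> s" "s \<le> t" "B \<in> sets (F s)"
  shows "ito (\<lambda>z. (indicator {s<..t} (snd z) * indicator B (fst z)) *\<^sub>R H z)
    (\<lambda>\<omega>. indicator B \<omega> *\<^sub>R (J t \<omega> - J s \<omega>))"
proof -
  have "ito (\<lambda>z. indicator {0..t} (snd z) *\<^sub>R H z - indicator {0..s} (snd z) *\<^sub>R H z) (\<lambda>\<omega>. J t \<omega> - J s \<omega>)"
    using assms by (intro ito_diff) (auto simp: ito_process_def)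
  also have "(\<lambda>z. indicator {0..t} (snd z) *\<^sub>R H z - indicator {0..s} (snd z) *\<^sub>R H z)
      = (\<lambda>z. indicator {s<..t} (snd z) *\<^sub>R H z)"
    using assms by (auto simp: fun_eq_iff indicator_def)
  finally have "ito (\<lambda>z. indicator B (fst z) *\<^sub>R (indicator {s<..t} (snd z) *\<^sub>R H z)) (\<lambda>\<omega>. indicator B \<omega> *\<^sub>R (J t \<omega> - J s \<omega>))"
    by (rule ito_restrict) (use assms in auto)
  then show ?thesis by (simp add: mult.commute)
qed

text \<open>A discrete stochastic integral of indicators of past events is again an Ito integral.  With
  decreasing events it plays the role of the stopped process.\<close>

lemma ito_stopped_grid:
  assumes "ito_process H J" "0 \<le> g 0" "\<And>i. i < n \<Longrightarrow> g i \<le> g (Suc i)"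
    and "\<And>i. i < n \<Longrightarrow> B i \<in> sets (F (g i))"
  shows "ito (\<lambda>z. \<Sum>i<n. (indicator {g i<..g (Suc i)} (snd z) * indicator (B i) (fst z)) *\<^sub>R H z)
    (\<lambda>\<omega>. \<Sum>i<n. indicator (B i) \<omega> *\<^sub>R (J (g (Suc i)) \<omega> - J (g i) \<omega>))"
proof (rule ito_sum)
  fix i assume i: "i < n"
  have "g 0 \<le> g i"
    using grid_mono[of n g 0 i] assms(3) i by auto
  then show "ito (\<lambda>z. (indicator {g i<..g (Suc i)} (snd z) * indicator (B i) (fst z)) *\<^sub>R H z)
    (\<lambda>\<omega>. indicator (B i) \<omega> *\<^sub>R (J (g (Suc i)) \<omega> - J (g i) \<omega>))"
    using assms i by (intro ito_increment[OF assms(1)]) auto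
qed

text \<open>At each time at most one of the intervals is active.\<close>

lemma grid_sum_norm_le:
  fixes h :: "'b :: real_normed_vector" and g :: "nat \<Rightarrow> real"
  assumes "\<And>i. i < n \<Longrightarrow> g i \<le> g (Suc i)" "\<And>i. i < n \<Longrightarrow> \<bar>\<beta> i\<bar> \<le> 1"
  shows "norm (\<Sum>i<n. (indicator {g i<..g (Suc i)} s * \<beta> i) *\<^sub>R h) \<le> indicator {g 0<..g n} s * norm h"
  using assms
proof (induction n)
  case (Suc n)
  have "g 0 \<le> g n"
    using grid_mono[of n g 0 n] Suc.prems by auto
  have "norm (\<Sum>i<Suc n. (indicator {g i<..g (Suc i)} s * \<beta> i) *\<^sub>R h)
    \<le> norm (\<Sum>i<n. (indicator {g i<..g (Suc i)} s * \<beta> i) *\<^sub>R h) + norm ((indicator {g n<..g (Suc n)} s * \<beta> n) *\<^sub>R h)"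
    unfolding sum.lessThan_Suc by (rule norm_triangle_ineq)
  also have "\<dots> \<le> indicator {g 0<..g n} s * norm h + indicator {g n<..g (Suc n)} s * norm h"
  proof (rule add_mono)
    show "norm (\<Sum>i<n. (indicator {g i<..g (Suc i)} s * \<beta> i) *\<^sub>R h) \<le> indicator {g 0<..g n} s * norm h"
    by (rule Suc.IH) (use Suc.prems in auto)
    show "norm ((indicator {g n<..g (Suc n)} s * \<beta> n) *\<^sub>R h) \<le> indicator {g n<..g (Suc n)} s * norm h"
    using Suc.prems(2)[of n] by (auto simp: indicator_def mult_left_le_one_le)
  qed
  also have "\<dots> = indicator {g 0<..g (Suc n)} s * norm h"
    using \<open>g 0 \<le> g n\<close> Suc.prems(1)[of n] by (auto simp: indicator_def)
  finally show ?case .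
qed simp

section \<open>Events of small probability\<close>

text \<open>A property of outcomes, not necessarily measurable, holds outside an event of probability at
  most \<open>\<eta>\<close>.\<close>

definition holds_off :: "real \<Rightarrow> ('w \<Rightarrow> bool) \<Rightarrow> bool" where
  "holds_off \<eta> Q \<longleftrightarrow> (\<exists>E\<in>sets M. prob E \<le> \<eta> \<and> (\<forall>\<omega>\<in>space M - E. Q \<omega>))"

lemma holds_off_mono:
  assumes "holds_off \<eta> Q" "\<eta> \<le> \<eta>'" "\<And>\<omega>. \<omega> \<in> space M \<Longrightarrow> Q \<omega> \<Longrightarrow> Q' \<omega>"
  shows "holds_off \<eta>' Q'"
proof -
  obtain E where "E \<in> sets M" "prob E \<le> \<eta>" "\<forall>\<omega>\<in>space M - E. Q \<omega>"
    using assms(1) unfolding holds_off_def by blast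
  with assms(2,3) show ?thesis
    unfolding holds_off_def by (intro bexI[of _ E]) auto
qed

lemma holds_off_AE:
  assumes "AE \<omega> in M. Q \<omega>"
  shows "holds_off 0 Q"
proof -
  from assms obtain N where "{\<omega>\<in>space M. \<not> Q \<omega>} \<subseteq> N" "emeasure M N = 0" "N \<in> sets M"
    by (rule AE_E)
  then show ?thesis
    unfolding holds_off_def by (intro bexI[of _ N]) (auto simp: measure_def)
qed

lemma holds_off_conj:
  assumes "holds_off \<eta> Q" "holds_off \<eta>' Q'"
  shows "holds_off (\<eta> + \<eta>') (\<lambda>\<omega>. Q \<omega> \<and> Q' \<omega>)"
proof -
  obtain E E' where E: "E \<in> sets M" "prob E \<le> \<eta>" "\<forall>\<omega>\<in>space M - E. Q \<omega>"
    and E': "E' \<in> sets M" "prob E' \<le> \<eta>'" "\<forall>\<omega>\<in>space M - E'. Q' \<omega>"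
    using assms unfolding holds_off_def by blast
  have "prob (E \<union> E') \<le> \<eta> + \<eta>'"
    using measure_Un_le[OF E(1) E'(1)] E(2) E'(2) by linarith
  with E E' show ?thesis unfolding holds_off_def by (intro bexI[of _ "E \<union> E'"]) auto
qed

lemma holds_off_AE_conj:
  assumes "holds_off \<eta> Q" "AE \<omega> in M. Q' \<omega>"
  shows "holds_off \<eta> (\<lambda>\<omega>. Q \<omega> \<and> Q' \<omega>)"
  using holds_off_conj[OF assms(1) holds_off_AE[OF assms(2)]] by simp

lemma holds_off_all_less:
  assumes "\<And>i. i < (n::nat) \<Longrightarrow> holds_off \<eta> (Q i)"
  shows "holds_off (real n * \<eta>) (\<lambda>\<omega>. \<forall>i<n. Q i \<omega>)"
  using assms
proof (induction n)
  case 0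
  then show ?case by (simp add: holds_off_def exI[of _ "{}"]) (auto intro!: bexI[of _ "{}"])
next
  case (Suc n)
  have "holds_off (real n * \<eta> + \<eta>) (\<lambda>\<omega>. (\<forall>i<n. Q i \<omega>) \<and> Q n \<omega>)"
    by (intro holds_off_conj Suc) auto
  then show ?case
    by (rule holds_off_mono) (auto simp: algebra_simps less_Suc_eq)
qed

lemma holds_off_Chebyshev:
  fixes Z :: "'w \<Rightarrow> 'b :: euclidean_space"
  assumes [measurable]: "Z \<in> borel_measurable M" and a: "sqnorm M Z \<le> ennreal a" "0 \<le> a" and l: "l > 0"
  shows "holds_off (a / l\<^sup>2) (\<lambda>\<omega>. norm (Z \<omega>) < l)"
proof -
  let ?E = "{\<omega>\<in>space M. l \<le> norm (Z \<omega>)}"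
  have "emeasure M ?E \<le> emeasure M {\<omega>\<in>space M. 1 \<le> ennreal (1 / l\<^sup>2) * ennreal ((norm (Z \<omega>))\<^sup>2)}"
  proof (rule emeasure_mono)
    show "?E \<subseteq> {\<omega> \<in> space M. 1 \<le> ennreal (1 / l\<^sup>2) * ennreal ((norm (Z \<omega>))\<^sup>2)}"
    proof safe
      fix \<omega> assume "l \<le> norm (Z \<omega>)"
      then have "l\<^sup>2 \<le> (norm (Z \<omega>))\<^sup>2" using l by (intro power_mono) auto
      then have "1 \<le> 1 / l\<^sup>2 * (norm (Z \<omega>))\<^sup>2" using l by (simp add: field_simps)
      then show "1 \<le> ennreal (1 / l\<^sup>2) * ennreal ((norm (Z \<omega>))\<^sup>2)"
        by (simp add: ennreal_mult[symmetric] ennreal_1[symmetric] del: ennreal_1)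
    qed
  qed measurable
  also have "\<dots> \<le> ennreal (1 / l\<^sup>2) * (\<integral>\<^sup>+\<omega>. ennreal ((norm (Z \<omega>))\<^sup>2) * indicator (space M) \<omega> \<partial>M)"
    by (rule nn_integral_Markov_inequality) auto
  also have "(\<integral>\<^sup>+\<omega>. ennreal ((norm (Z \<omega>))\<^sup>2) * indicator (space M) \<omega> \<partial>M) = sqnorm M Z"
    unfolding sqnorm_def by (intro nn_integral_cong) auto
  also have "ennreal (1 / l\<^sup>2) * sqnorm M Z \<le> ennreal (1 / l\<^sup>2) * ennreal a"
    by (intro mult_left_mono a) auto
  also have "\<dots> = ennreal (a / l\<^sup>2)" using a by (simp add: ennreal_mult[symmetric])
  finally have "prob ?E \<le> a / l\<^sup>2" using a l by (simp add: emeasure_eq_measure)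
  then show ?thesis unfolding holds_off_def by (intro bexI[of _ ?E]) auto
qed

text \<open>The outcomes violating \<open>Q'\<close> lie in almost all exceptional events, that is, in an increasing union
  of events of probability at most \<open>\<eta>\<close>.\<close>

lemma holds_off_frequently:
  assumes h: "\<And>n::nat. holds_off \<eta> (Q n)" and Q: "\<And>\<omega>. \<omega> \<in> space M \<Longrightarrow> \<not> Q' \<omega> \<Longrightarrow> \<forall>\<^sub>F n in sequentially. \<not> Q n \<omega>"
  shows "holds_off \<eta> Q'"
proof -
  obtain E where E: "\<And>n. E n \<in> sets M" "\<And>n. prob (E n) \<le> \<eta>" "\<And>n \<omega>. \<omega> \<in> space M - E n \<Longrightarrow> Q n \<omega>"
    using h unfolding holds_off_def by metis
  define A where "A m = (\<Inter>n\<in>{m..}. E n)" for m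
  have A[measurable]: "A m \<in> sets M" for m unfolding A_def using E by (intro sets.countable_INT) auto
  have inc: "incseq A" by (auto simp: incseq_def A_def)
  have "prob (\<Union>m. A m) \<le> \<eta>"
  proof (rule LIMSEQ_le_const2)
    show "(\<lambda>m. prob (A m)) \<longlonglongrightarrow> prob (\<Union>m. A m)"
      using inc A by (intro finite_Lim_measure_incseq) auto
    have "prob (A m) \<le> \<eta>" for m
      using finite_measure_mono[of "A m" "E m"] E by (force simp: A_def intro: order_trans)
    then show "\<exists>N. \<forall>n\<ge>N. prob (A n) \<le> \<eta>" by blast
  qed
  moreover have "Q' \<omega>" if "\<omega> \<in> space M - (\<Union>m. A m)" for \<omega>
  proof (rule ccontr)
    assume "\<not> Q' \<omega>"
    with Q[of \<omega>] that obtain m where "\<forall>n\<ge>m. \<not> Q n \<omega>" by (auto simp: eventually_sequentially)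
    then have "\<omega> \<in> A m" using E(3) that unfolding A_def by blast
    with that show False by auto
  qed
  ultimately show ?thesis
    unfolding holds_off_def by (intro bexI[of _ "\<Union>m. A m"]) (auto intro: sets.countable_UN)
qed

text \<open>The events that \<open>Q n\<close> still fails for some \<open>n \<ge> m\<close> decrease, as \<open>m\<close> grows, to a null set.\<close>

lemma holds_off_eventually:
  assumes [measurable]: "\<And>n::nat. Measurable.pred M (Q n)" and Q: "AE \<omega> in M. \<forall>\<^sub>F n in sequentially. Q n \<omega>"
    and "\<eta> > 0"
  shows "\<exists>n>0. holds_off \<eta> (Q n)"
proof -
  define A where "A m = {\<omega>\<in>space M. \<exists>n\<ge>m. \<not> Q n \<omega>}" for m :: nat
  have A[measurable]: "A m \<in> sets M" for m unfolding A_def by measurable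
  have dec: "decseq A" unfolding decseq_def A_def using order_trans by blast
  have "(\<lambda>m. prob (A m)) \<longlonglongrightarrow> prob (\<Inter>m. A m)"
    using dec A by (intro finite_Lim_measure_decseq) auto
  moreover have "prob (\<Inter>m. A m) = 0"
  proof -
    have "AE \<omega> in M. \<omega> \<notin> (\<Inter>m. A m)"
      using Q by eventually_elim (force simp: A_def eventually_sequentially)
    moreover have "(\<Inter>m. A m) \<in> sets M" by measurable
    ultimately show ?thesis by (simp add: prob_eq_0)
  qed
  ultimately have "(\<lambda>m. prob (A m)) \<longlonglongrightarrow> 0" by simp
  then have "\<forall>\<^sub>F m in sequentially. prob (A m) < \<eta>"
    using assms(3) by (rule order_tendstoD)
  then obtain m where "prob (A m) < \<eta>" "m > 0"
    using eventually_gt_at_top[of "0::nat"] by (metis (mono_tags, lifting) eventually_conj eventually_sequentially order_refl)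
  then show ?thesis
    unfolding holds_off_def by (intro exI[of _ m] conjI bexI[of _ "A m"]) (auto simp: A_def)
qed

section \<open>Inequalities for integral processes\<close>

text \<open>Kolmogorov's argument.  Switch the integrand off at the first grid time \<open>g k\<close> at which the outcome
  is not in \<open>G k\<close>: the resulting integral has the value \<open>J (g k) - J (g 0)\<close>, and its second moment is
  bounded independently of the grid.\<close>

lemma ito_maximal_inequality:
  fixes H :: "'w \<times> real \<Rightarrow> real ^ 'r ^ 'm"
  assumes J: "ito_process H J" and T: "0 \<le> T" and c: "\<And>z. z \<in> space P \<Longrightarrow> 0 \<le> snd z \<Longrightarrow> norm (H z) \<le> c"
    and g: "0 \<le> g 0" "\<And>i. i < n \<Longrightarrow> g i \<le> g (Suc i)" "g n \<le> T"
    and G: "\<And>i. i < n \<Longrightarrow> G i \<in> sets (F (g i))" and l: "l > 0"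
  shows "holds_off (4 * (c\<^sup>2 * T) / l\<^sup>2)
    (\<lambda>\<omega>. \<forall>k\<le>n. (\<forall>j<k. \<omega> \<in> G j) \<longrightarrow> \<omega> \<notin> G k \<longrightarrow> norm (J (g k) \<omega> - J (g 0) \<omega>) < l)"
proof -
  define B where "B i = (\<Inter>j\<in>{..i}. G j)" for i
  have gmono: "g i \<le> g j" if "i \<le> j" "j \<le> n" for i j
    using grid_mono[of n g i j] g(2) that by auto
  have B: "B i \<in> sets (F (g i))" if "i < n" for i
    unfolding B_def
  proof (rule sets.finite_INT)
    fix j assume "j \<in> {..i}"
    then show "G j \<in> sets (F (g i))"
      using G[of j] that sets_F_mono[OF gmono[of j i]] by auto
  qed auto
  let ?K = "\<lambda>z. \<Sum>i<n. (indicator {g i<..g (Suc i)} (snd z) * indicator (B i) (fst z)) *\<^sub>R H z"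
  let ?Z = "\<lambda>\<omega>. \<Sum>i<n. indicator (B i) \<omega> *\<^sub>R (J (g (Suc i)) \<omega> - J (g i) \<omega>)"
  have i: "ito ?K ?Z" by (rule ito_stopped_grid[OF J g(1,2) B])
  have "sqnorm P ?K \<le> sqnorm P (\<lambda>z. indicator {0..T} (snd z) * c)"
  proof (rule sqnorm_mono_AE, rule AE_I2)
    fix z assume z: "z \<in> space P"
    have "norm (?K z) \<le> indicator {g 0<..g n} (snd z) * norm (H z)"
      by (rule grid_sum_norm_le) (use g in \<open>auto simp: indicator_def\<close>)
    also have "\<dots> \<le> norm (indicator {0..T} (snd z) * c)"
      using c[OF z] g by (auto simp: indicator_def)
    finally show "norm (?K z) \<le> norm (indicator {0..T} (snd z) * c)" .
  qed
  also have "\<dots> = (\<integral>\<^sup>+\<omega>. \<integral>\<^sup>+t. ennreal (c\<^sup>2) * indicator {0..T} t \<partial>lborel \<partial>M)"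
  proof -
    have "ennreal ((norm (indicator {0..T} t * c))\<^sup>2) = ennreal (c\<^sup>2) * indicator {0..T} t" for t :: real
      by (auto simp: indicator_def)
    moreover have "(\<lambda>z. indicator {0..T} (snd z) * c) \<in> borel_measurable P" by measurable
    ultimately show ?thesis by (simp only: sqnorm_P_iterated snd_conv)
  qed
  also have "\<dots> = ennreal (c\<^sup>2 * T)"
    using T by (simp add: nn_integral_cmult ennreal_mult emeasure_space_1)
  finally have "sqnorm P ?K \<le> ennreal (c\<^sup>2 * T)" .
  then have "4 * sqnorm P ?K \<le> 4 * ennreal (c\<^sup>2 * T)"
    by (rule mult_left_mono) simp
  then have "sqnorm M ?Z \<le> 4 * ennreal (c\<^sup>2 * T)"
    using ito_inequality[OF i] by (rule order_trans[rotated])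
  also have "\<dots> = ennreal (4 * (c\<^sup>2 * T))"
    using T by (simp add: ennreal_mult')
  finally have "holds_off (4 * (c\<^sup>2 * T) / l\<^sup>2) (\<lambda>\<omega>. norm (?Z \<omega>) < l)"
    using T l by (intro holds_off_Chebyshev ito_measurable[OF i]) auto
  then show ?thesis
  proof (rule holds_off_mono, simp, intro allI impI)
    fix \<omega> k assume Z: "norm (?Z \<omega>) < l" and k: "k \<le> n" "\<forall>j<k. \<omega> \<in> G j" "\<omega> \<notin> G k"
    have "?Z \<omega> = (\<Sum>i<n. if i < k then J (g (Suc i)) \<omega> - J (g i) \<omega> else 0)"
      using k by (intro sum.cong) (auto simp: B_def indicator_def not_less)
    also have "\<dots> = (\<Sum>i<k. J (g (Suc i)) \<omega> - J (g i) \<omega>)"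
      using k by (intro sum.mono_neutral_cong_right) auto
    also have "\<dots> = J (g k) \<omega> - J (g 0) \<omega>"
      by (rule sum_lessThan_telescope)
    finally show "norm (J (g k) \<omega> - J (g 0) \<omega>) < l" using Z by simp
  qed
qed

end

section \<open>Lipschitz bounds and continuous paths\<close>

text \<open>Continuity is given for each directional derivative separately.  In finite dimension this
  suffices, since the derivatives in the basis directions bound the operator norm.\<close>

lemma C1_on_Lipschitz:
  fixes f :: "'a :: euclidean_space \<Rightarrow> 'b :: real_normed_vector"
  assumes "C_k_on 1 S f" "compact K" "convex K" "K \<subseteq> S"
  shows "\<exists>L\<ge>0. \<forall>x\<in>K. \<forall>y\<in>K. norm (f x - f y) \<le> L * norm (x - y)"
proof -
  let ?D = "\<lambda>x. frechet_derivative f (at x)"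
  have d: "\<And>x. x \<in> S \<Longrightarrow> f differentiable (at x)" and c: "\<And>v. continuous_on S (\<lambda>x. ?D x v)"
    using assms(1) by auto
  have "\<exists>C. \<forall>x\<in>K. norm (?D x v) \<le> C" for v
  proof -
    have "compact ((\<lambda>x. ?D x v) ` K)"
      using c assms by (intro compact_continuous_image) (auto intro: continuous_on_subset)
    from compact_imp_bounded[OF this] show ?thesis by (auto simp: bounded_iff)
  qed
  then obtain C where C: "\<And>x v. x \<in> K \<Longrightarrow> norm (?D x v) \<le> C v" by metis
  define L where "L = (\<Sum>v\<in>Basis. \<bar>C v\<bar>)"
  have L: "norm (?D x v) \<le> L * norm v" if x: "x \<in> K" for x v
  proof -
    have lin: "linear (?D x)"
      using d x assms(4) by (intro linear_frechet_derivative) auto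
    have "?D x v = ?D x (\<Sum>b\<in>Basis. (v \<bullet> b) *\<^sub>R b)"
      by (simp add: euclidean_representation)
    also have "\<dots> = (\<Sum>b\<in>Basis. (v \<bullet> b) *\<^sub>R ?D x b)"
      by (simp add: linear_sum[OF lin] linear_cmul[OF lin])
    also have "norm \<dots> \<le> (\<Sum>b\<in>Basis. norm v * \<bar>C b\<bar>)"
    proof (rule sum_norm_le)
      fix b :: 'a assume "b \<in> Basis"
      then have "\<bar>v \<bullet> b\<bar> \<le> norm v" by (simp add: Basis_le_norm)
      moreover have "norm (?D x b) \<le> \<bar>C b\<bar>" using C[OF x, of b] by linarith
      ultimately show "norm ((v \<bullet> b) *\<^sub>R ?D x b) \<le> norm v * \<bar>C b\<bar>"
        by (auto intro!: mult_mono)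
    qed
    finally show ?thesis by (simp add: L_def sum_distrib_left mult.commute)
  qed
  have "norm (f x - f y) \<le> L * norm (x - y)" if "x \<in> K" "y \<in> K" for x y
  proof (rule differentiable_bound[OF assms(3) _ _ that])
    fix z assume z: "z \<in> K"
    then show "(f has_derivative ?D z) (at z within K)"
      using d assms(4) by (auto intro!: has_derivative_at_withinI[OF frechet_derivative_works[THEN iffD1]])
    show "onorm (?D z) \<le> L" by (rule onorm_le) (rule L[OF z])
  qed
  moreover have "L \<ge> 0" by (simp add: L_def sum_nonneg)
  ultimately show ?thesis by blast
qed

lemma path_stays_in_open:
  fixes y :: "real \<Rightarrow> 'a :: topological_space"
  assumes "continuous_on {0..} y" "open V" "0 \<le> s" "y s \<in> V"
  shows "\<exists>e>0. \<forall>u\<ge>0. \<bar>u - s\<bar> < e \<longrightarrow> y u \<in> V"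
proof -
  have "openin (top_of_set {0..}) ({0..} \<inter> y -` V)"
    by (rule continuous_openin_preimage_gen[OF assms(1,2)])
  then have "\<forall>u\<in>{0..} \<inter> y -` V. \<exists>e>0. \<forall>u'\<in>{0..}. dist u' u < e \<longrightarrow> u' \<in> {0..} \<inter> y -` V"
    unfolding openin_euclidean_subtopology_iff by blast
  moreover have "s \<in> {0..} \<inter> y -` V" using assms by auto
  ultimately obtain e where "e > 0" "\<forall>u'\<in>{0..}. dist u' s < e \<longrightarrow> u' \<in> {0..} \<inter> y -` V" by blast
  then show ?thesis by (intro exI[of _ e]) (auto simp: dist_real_def)
qed

text \<open>As \<open>V\<close> is open, a continuous path that is in \<open>V\<close> up to time \<open>s\<close> stays there a little longer.\<close>

lemma exit_time_gtI:
  assumes cont: "continuous_on {0..} Y" and V: "open V" and Y: "\<And>u. 0 \<le> u \<Longrightarrow> p u = Some (Y u)"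
    and inV: "\<forall>u\<in>{0..s}. Y u \<in> V" and "0 \<le> s"
  shows "ereal s < exit_time p V"
proof -
  obtain e where e: "e > 0" "\<And>u. 0 \<le> u \<Longrightarrow> \<bar>u - s\<bar> < e \<Longrightarrow> Y u \<in> V"
    using path_stays_in_open[OF cont V, of s] assms by auto
  have "ereal (s + e) \<le> exit_time p V"
    unfolding exit_time_def
  proof (rule Inf_greatest, safe)
    fix t assume t: "0 < t" "p t \<notin> Some ` V"
    then have "Y t \<notin> V" using Y[of t] by auto
    then have "\<not> t \<le> s" "\<not> \<bar>t - s\<bar> < e" using inV e(2)[of t] t by auto
    then show "ereal (s + e) \<le> ereal t" by simp
  qed
  with e(1) show ?thesis by (metis ereal_less(2) ereal_less_eq(3) less_add_same_cancel1 less_ereal.simps(1) order_less_le_trans)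
qed

context ito_setting
begin

text \<open>Sample the path at the last point of a grid before the present time and refine the grid.
  The paths in a null set containing the discontinuous ones are replaced by \<open>0\<close>.\<close>

lemma jointly_measurable_version:
  fixes Y :: "real \<Rightarrow> 'w \<Rightarrow> 'b :: euclidean_space"
  assumes Y: "\<And>t. 0 \<le> t \<Longrightarrow> Y t \<in> borel_measurable M"
    and cont: "AE \<omega> in M. continuous_on {0..} (\<lambda>t. Y t \<omega>)"
  shows "\<exists>Y'. (\<lambda>z. Y' (snd z) (fst z)) \<in> borel_measurable P \<and> (AE \<omega> in M. \<forall>t\<ge>0. Y' t \<omega> = Y t \<omega>)"
proof -
  from cont obtain N where N: "{\<omega>\<in>space M. \<not> continuous_on {0..} (\<lambda>t. Y t \<omega>)} \<subseteq> N"
    "emeasure M N = 0" "N \<in> sets M" by (rule AE_E)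
  define O' where "O' = space M - N"
  have [measurable]: "O' \<in> sets M" using N by (auto simp: O'_def)
  define Y' where "Y' t \<omega> = (if \<omega> \<in> O' \<and> 0 \<le> t then Y t \<omega> else 0)" for t \<omega>
  define A where "A n z = (if fst z \<in> O' \<and> 0 \<le> snd z then Y (real (nat \<lfloor>snd z * real (Suc n)\<rfloor>) / real (Suc n)) (fst z) else 0)"
    for n and z :: "'w \<times> real"
  have "A n \<in> borel_measurable P" for n
  proof -
    have "(\<lambda>z. Y (real k / real (Suc n)) (fst z)) \<in> borel_measurable P" for k
      by (rule measurable_compose[OF measurable_fst Y]) auto
    then have [measurable]: "(\<lambda>z. Y (real (nat \<lfloor>snd z * real (Suc n)\<rfloor>) / real (Suc n)) (fst z)) \<in> borel_measurable P"
      by (rule measurable_compose_countable) measurable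
    show ?thesis unfolding A_def by measurable
  qed
  moreover have "(\<lambda>n. A n z) \<longlonglongrightarrow> Y' (snd z) (fst z)" if "z \<in> space P" for z
  proof (cases "fst z \<in> O' \<and> 0 \<le> snd z")
    case True
    let ?t = "snd z"
    define q where "q n = real (nat \<lfloor>?t * real (Suc n)\<rfloor>) / real (Suc n)" for n
    have q0: "0 \<le> q n" for n by (simp add: q_def)
    have q: "?t - 1 / real (Suc n) \<le> q n" "q n \<le> ?t" for n
    proof -
      have e: "real (nat \<lfloor>?t * real (Suc n)\<rfloor>) = of_int \<lfloor>?t * real (Suc n)\<rfloor>"
        using True by (simp add: of_nat_nat)
      have "of_int \<lfloor>?t * real (Suc n)\<rfloor> \<le> ?t * real (Suc n)" by (rule of_int_floor_le)
      then show "q n \<le> ?t" unfolding q_def e by (simp add: field_simps)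
      have "?t * real (Suc n) - 1 \<le> of_int \<lfloor>?t * real (Suc n)\<rfloor>" by linarith
      then have "(?t * real (Suc n) - 1) / real (Suc n) \<le> q n"
        unfolding q_def e by (intro divide_right_mono) auto
      then show "?t - 1 / real (Suc n) \<le> q n" by (simp add: diff_divide_distrib)
    qed
    have "(\<lambda>n. ?t - 1 / real (Suc n)) \<longlonglongrightarrow> ?t - 0"
      by (intro tendsto_diff tendsto_const LIMSEQ_inverse_real_of_nat[unfolded inverse_eq_divide])
    then have "q \<longlonglongrightarrow> ?t"
      using q by (intro tendsto_sandwich[of "\<lambda>n. ?t - 1 / real (Suc n)" q sequentially "\<lambda>_. ?t"]) auto
    moreover have "continuous_on {0..} (\<lambda>t. Y t (fst z))"
      using True N by (auto simp: O'_def)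
    ultimately have "(\<lambda>n. Y (q n) (fst z)) \<longlonglongrightarrow> Y ?t (fst z)"
      using True by (intro continuous_on_tendsto_compose[where s = "{0..}" and f = "\<lambda>t. Y t (fst z)"])
        (auto simp: q0)
    then show ?thesis using True by (simp add: A_def Y'_def q_def)
  qed (auto simp: A_def Y'_def)
  ultimately have "(\<lambda>z. Y' (snd z) (fst z)) \<in> borel_measurable P"
    by (rule borel_measurable_LIMSEQ_metric)
  moreover have "AE \<omega> in M. \<forall>t\<ge>0. Y' t \<omega> = Y t \<omega>"
    by (rule AE_I[OF _ N(2,3)]) (auto simp: Y'_def O'_def)
  ultimately show ?thesis by blast
qed

section \<open>Solutions as processes for all times\<close>

text \<open>The equation for a process \<open>Y\<close> that is defined for all times, with almost surely continuous
  paths, as long as it stays in \<open>V\<close>.  Here \<open>H\<close> is the stochastic integrand, equal to \<open>\<sigma>(Y)\<close>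
  until \<open>Y\<close> leaves \<open>V\<close>, and \<open>J\<close> is its integral.  The exceptional null set of the equation
  may depend on the time.\<close>

definition solves_in :: "(real ^ 'm) set \<Rightarrow> (real ^ 'm \<Rightarrow> real ^ 'm) \<Rightarrow> (real ^ 'm \<Rightarrow> real ^ 'r ^ 'm) \<Rightarrow> real ^ 'm
    \<Rightarrow> (real \<Rightarrow> 'w \<Rightarrow> real ^ 'm) \<Rightarrow> ('w \<times> real \<Rightarrow> real ^ 'r ^ 'm) \<Rightarrow> (real \<Rightarrow> 'w \<Rightarrow> real ^ 'm) \<Rightarrow> bool" where
  "solves_in V b \<sigma> x Y H J \<longleftrightarrow>
     (\<forall>t\<ge>0. Y t \<in> borel_measurable (F t)) \<and>
     (AE \<omega> in M. Y 0 \<omega> = x \<and> continuous_on {0..} (\<lambda>t. Y t \<omega>)) \<and>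
     ito_process H J \<and>
     (AE \<omega> in M. \<forall>s\<ge>0. (\<forall>u\<in>{0..s}. Y u \<omega> \<in> V) \<longrightarrow> H (\<omega>, s) = \<sigma> (Y s \<omega>)) \<and>
     (\<forall>t\<ge>0. AE \<omega> in M. (\<forall>u\<in>{0..t}. Y u \<omega> \<in> V) \<longrightarrow>
        Y t \<omega> = x + integral {0..t} (\<lambda>s. b (Y s \<omega>)) + J t \<omega>)"

text \<open>A solution that almost surely never dies becomes an everywhere defined process when the starting
  point is used as value after death.  Changing it on a null set would not do here, as the
  filtration need not contain the null sets; this choice keeps the process adapted.\<close>

lemma local_solution_solves_in:
  fixes \<sigma> :: "real ^ 'm \<Rightarrow> real ^ 'r ^ 'm"
  assumes sol: "local_solution M F W S b \<sigma> x X"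
    and alive: "AE \<omega> in M. \<forall>t\<ge>0. X t \<omega> \<noteq> None"
    and V: "open V" "x \<in> V" "compact (closure V)" "closure V \<subseteq> S"
    and c: "\<And>y. y \<in> V \<Longrightarrow> norm (\<sigma> y) \<le> c" "0 \<le> c"
  defines "Y \<equiv> \<lambda>t \<omega>. case X t \<omega> of None \<Rightarrow> x | Some y \<Rightarrow> y"
  shows "\<exists>H J. solves_in V b \<sigma> x Y H J \<and> (\<forall>z\<in>space P. 0 \<le> snd z \<longrightarrow> norm (H z) \<le> c)"
proof -
  have path: "\<And>\<omega>. \<omega> \<in> space M \<Longrightarrow> X 0 \<omega> = Some x"
    "\<And>\<omega>. \<omega> \<in> space M \<Longrightarrow> continuous_on {t. 0 \<le> t \<and> ereal t < lifetime (\<lambda>t. X t \<omega>)} (\<lambda>t. the (X t \<omega>))"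
    and meas: "\<And>t A. 0 \<le> t \<Longrightarrow> A \<in> sets borel \<Longrightarrow> {\<omega>\<in>space M. X t \<omega> \<in> Some ` A} \<in> sets (F t)"
    using sol unfolding local_solution_def by auto
  let ?h = "\<lambda>s \<omega>. if ereal s < exit_time (\<lambda>t. X t \<omega>) V then \<sigma> (the (X s \<omega>)) else 0"
  define Q where "Q t J \<longleftrightarrow> has_ito_integral M F W t ?h J \<and>
          (AE \<omega> in M. ereal t < exit_time (\<lambda>t. X t \<omega>) V \<longrightarrow>
             the (X t \<omega>) = x + integral {0..t} (\<lambda>s. b (the (X s \<omega>))) + J \<omega>)" for t J
  have "\<forall>t\<ge>0. \<exists>J. Q t J"
    using sol V unfolding local_solution_def Q_def by simp
  then obtain J where "\<And>t. 0 \<le> t \<Longrightarrow> Q t (J t)" by metis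
  then have J: "\<And>t. 0 \<le> t \<Longrightarrow> has_ito_integral M F W t ?h (J t)"
    "\<And>t. 0 \<le> t \<Longrightarrow> AE \<omega> in M. ereal t < exit_time (\<lambda>t. X t \<omega>) V \<longrightarrow>
             the (X t \<omega>) = x + integral {0..t} (\<lambda>s. b (the (X s \<omega>))) + J t \<omega>"
    unfolding Q_def by blast+
  define H where "H z = ?h (snd z) (fst z)" for z
  have "Y t \<in> borel_measurable (F t)" if t: "0 \<le> t" for t
  proof (rule measurableI)
    fix A :: "(real ^ 'm) set" assume A: "A \<in> sets borel"
    have "Y t -` A \<inter> space (F t) = {\<omega>\<in>space M. X t \<omega> \<in> Some ` A} \<union>
        (if x \<in> A then space (F t) - {\<omega>\<in>space M. X t \<omega> \<in> Some ` UNIV} else {})"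
      by (auto simp: Y_def image_iff split: option.splits)
    also have "\<dots> \<in> sets (F t)"
      using meas[OF t A] sets.compl_sets[OF meas[OF t, of UNIV]] by (simp del: space_F add: sets.Un)
    finally show "Y t -` A \<inter> space (F t) \<in> sets (F t)" .
  qed auto
  moreover have aliveY: "AE \<omega> in M. Y 0 \<omega> = x \<and> continuous_on {0..} (\<lambda>t. Y t \<omega>) \<and> (\<forall>t\<ge>0. X t \<omega> = Some (Y t \<omega>))"
    using alive AE_space
  proof eventually_elim
    case (elim \<omega>)
    have XY: "X t \<omega> = Some (Y t \<omega>)" if "0 \<le> t" for t
    proof -
      from elim(1) that obtain y where "X t \<omega> = Some y" by blast
      then show ?thesis by (simp add: Y_def)
    qed
    have "lifetime (\<lambda>t. X t \<omega>) = \<infinity>"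
      unfolding lifetime_def using elim(1) by (auto simp: Inf_eq_PInfty top_ereal_def)
    with path(2)[OF elim(2)] have "continuous_on {0..} (\<lambda>t. the (X t \<omega>))"
      by (simp add: atLeast_def)
    then have "continuous_on {0..} (\<lambda>t. Y t \<omega>)"
      by (rule continuous_on_eq) (use XY in auto)
    with XY path(1)[OF elim(2)] show ?case by (auto simp: Y_def)
  qed
  moreover have "ito_process H J"
    unfolding ito_process_def H_def using has_ito_integral_imp_ito[OF J(1)] by simp
  moreover have "AE \<omega> in M. \<forall>s\<ge>0. (\<forall>u\<in>{0..s}. Y u \<omega> \<in> V) \<longrightarrow> H (\<omega>, s) = \<sigma> (Y s \<omega>)"
    using aliveY
  proof eventually_elim
    case (elim \<omega>)
    show ?case
    proof (intro allI impI)
      fix s :: real assume s: "0 \<le> s" "\<forall>u\<in>{0..s}. Y u \<omega> \<in> V"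
      then have "ereal s < exit_time (\<lambda>t. X t \<omega>) V"
        using elim V by (intro exit_time_gtI[where Y = "\<lambda>t. Y t \<omega>"]) auto
      then show "H (\<omega>, s) = \<sigma> (Y s \<omega>)" using elim s by (simp add: H_def)
    qed
  qed
  moreover have "AE \<omega> in M. (\<forall>u\<in>{0..t}. Y u \<omega> \<in> V) \<longrightarrow>
        Y t \<omega> = x + integral {0..t} (\<lambda>s. b (Y s \<omega>)) + J t \<omega>" if t: "0 \<le> t" for t
    using aliveY J(2)[OF t]
  proof eventually_elim
    case (elim \<omega>)
    show ?case
    proof
      assume "\<forall>u\<in>{0..t}. Y u \<omega> \<in> V"
      then have "ereal t < exit_time (\<lambda>t. X t \<omega>) V"
        using elim V t by (intro exit_time_gtI[where Y = "\<lambda>t. Y t \<omega>"]) auto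
      with elim have "the (X t \<omega>) = x + integral {0..t} (\<lambda>s. b (the (X s \<omega>))) + J t \<omega>" by blast
      also have "integral {0..t} (\<lambda>s. b (the (X s \<omega>))) = integral {0..t} (\<lambda>s. b (Y s \<omega>))"
        using elim by (intro Henstock_Kurzweil_Integration.integral_cong) auto
      finally show "Y t \<omega> = x + integral {0..t} (\<lambda>s. b (Y s \<omega>)) + J t \<omega>"
        using elim t by simp
    qed
  qed
  moreover have "norm (H z) \<le> c" if z: "z \<in> space P" "0 \<le> snd z" for z
  proof (cases "ereal (snd z) < exit_time (\<lambda>t. X t (fst z)) V")
    case True
    have "X (snd z) (fst z) \<in> Some ` V"
    proof (cases "snd z = 0")
      case True
      then show ?thesis using path(1)[of "fst z"] z V by (auto simp: space_pair_measure)
    next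
      case False
      show ?thesis
      proof (rule ccontr)
        assume "X (snd z) (fst z) \<notin> Some ` V"
        with False z have "exit_time (\<lambda>t. X t (fst z)) V \<le> ereal (snd z)"
          unfolding exit_time_def by (intro Inf_lower) auto
        with True show False by simp
      qed
    qed
    then show ?thesis using c by (auto simp: H_def)
  qed (use c in \<open>simp add: H_def\<close>)
  ultimately show ?thesis
    unfolding solves_in_def by (intro exI[of _ H] exI[of _ J]) (auto elim: eventually_mono)
qed

end

text \<open>Let \<open>s0\<close> be the first time at which \<open>\<phi>\<close> reaches the level \<open>r\<close>.  The lower level \<open>a\<close> is exceeded on an
  interval before \<open>s0\<close>, and every sufficiently fine grid has a point there.\<close>

lemma grid_point_before_exit:
  fixes \<phi> :: "real \<Rightarrow> real"
  assumes cont: "continuous_on {0..} \<phi>" and "\<phi> 0 < r" "a < r" and u: "0 \<le> u" "u \<le> T" "r < \<phi> u"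
  shows "\<forall>\<^sub>F n in sequentially. \<exists>i\<le>Suc n. a < \<phi> (T * real i / real (Suc n)) \<and> (\<forall>s\<in>{0..T * real i / real (Suc n)}. \<phi> s \<le> r)"
proof -
  have "closedin (top_of_set {0..u}) ({0..u} \<inter> \<phi> -` {r..})"
    using cont by (intro continuous_closedin_preimage) (auto intro: continuous_on_subset)
  then have "compact ({0..u} \<inter> \<phi> -` {r..})"
    by (rule closedin_compact[rotated]) auto
  moreover have "{0..u} \<inter> \<phi> -` {r..} \<noteq> {}" using u by (auto intro: exI[of _ u])
  ultimately obtain s0 where "s0 \<in> {0..u} \<inter> \<phi> -` {r..}" "\<forall>s\<in>{0..u} \<inter> \<phi> -` {r..}. s0 \<le> s"
    using compact_attains_inf by metis
  then have s0: "s0 \<in> {0..u}" "r \<le> \<phi> s0" and min: "\<And>s. s \<in> {0..u} \<Longrightarrow> r \<le> \<phi> s \<Longrightarrow> s0 \<le> s"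
    by auto
  have pos: "0 < s0" using s0 assms(2) by (cases "s0 = 0") auto
  obtain e where e: "e > 0" "\<And>s. 0 \<le> s \<Longrightarrow> \<bar>s - s0\<bar> < e \<Longrightarrow> a < \<phi> s"
    using path_stays_in_open[OF cont, of "{a<..}" s0] s0 assms(3) by auto
  have T: "T > 0" using pos s0(1) u(2) by simp
  have "\<forall>\<^sub>F n in sequentially. T * inverse (real (Suc n)) < min e s0"
    using e(1) pos by (intro eventually_mesh_less) auto
  then show ?thesis
  proof eventually_elim
    case (elim n)
    define N where "N = real (Suc n)"
    have N: "N > 0" "T / N < e" "T / N < s0" using elim by (auto simp: N_def divide_inverse)
    define j where "j = nat \<lceil>s0 * N / T\<rceil>"
    have j: "s0 * N / T \<le> real j" "real j < s0 * N / T + 1" "0 < j"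
      using pos N T by (auto simp: j_def) linarith+
    define i where "i = j - 1"
    have ij: "real i = real j - 1" using j by (simp add: i_def)
    have lt: "T * real i / N < s0"
    proof -
      have "T * real j < s0 * N + T" using j(2) N T by (simp add: field_simps)
      then have "T * real i < s0 * N" using ij by (simp add: right_diff_distrib)
      then show ?thesis using N by (simp add: field_simps)
    qed
    have ge: "s0 - T / N \<le> T * real i / N"
    proof -
      have "s0 \<le> T * real j / N" using j(1) N T by (simp add: field_simps)
      then show ?thesis using ij by (simp add: right_diff_distrib diff_divide_distrib)
    qed
    have "real i \<le> N"
    proof -
      have "T * real i < T * N" using lt N s0 u by (simp add: field_simps)
        (meson less_le_trans mult_left_mono order_less_imp_le order_trans)
      then show ?thesis using T by simp
    qed
    then have iN: "i \<le> Suc n" by (simp add: N_def)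
    have "a < \<phi> (T * real i / N)"
      using lt ge N T by (intro e(2)) auto
    moreover have "\<phi> s \<le> r" if "s \<in> {0..T * real i / N}" for s
      using min[of s] that lt s0 by (cases "r \<le> \<phi> s") auto
    ultimately show ?case using iN unfolding N_def by blast
  qed
qed

context ito_setting
begin

section \<open>Slow exit and continuous dependence on the starting point\<close>

text \<open>While the path stays within distance \<open>r\<close> of \<open>x\<close>, the drift moves it by at most \<open>c * T \<le> r / 4\<close>.
  If the path goes further, then fine grids have a first point at which its distance from \<open>x\<close> is at
  least \<open>3 * r / 4\<close>, and this point comes before the distance exceeds \<open>r\<close>.  The stochastic integral
  is then at least \<open>r / 4\<close> in norm, and the maximal inequality bounds the probability of that by a
  quantity that tends to \<open>0\<close> with \<open>T\<close>, uniformly in the starting point.\<close>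

lemma leaves_slowly:
  assumes sol: "solves_in V b \<sigma> x Y H J" and Hc: "\<And>z. z \<in> space P \<Longrightarrow> 0 \<le> snd z \<Longrightarrow> norm (H z) \<le> c"
    and r: "0 < r" "cball x r \<subseteq> V" and b: "continuous_on V b" "\<And>y. y \<in> V \<Longrightarrow> norm (b y) \<le> c"
    and T: "0 < T" "c * T \<le> r / 4"
  shows "holds_off (64 * c\<^sup>2 * T / r\<^sup>2) (\<lambda>\<omega>. \<forall>u\<in>{0..T}. norm (Y u \<omega> - x) \<le> r)"
proof -
  have meas: "\<And>t. 0 \<le> t \<Longrightarrow> Y t \<in> borel_measurable (F t)" and J: "ito_process H J"
    and path: "AE \<omega> in M. Y 0 \<omega> = x \<and> continuous_on {0..} (\<lambda>t. Y t \<omega>)"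
    and eq: "\<And>t. 0 \<le> t \<Longrightarrow> AE \<omega> in M. (\<forall>u\<in>{0..t}. Y u \<omega> \<in> V) \<longrightarrow>
        Y t \<omega> = x + integral {0..t} (\<lambda>s. b (Y s \<omega>)) + J t \<omega>"
    using sol by (auto simp: solves_in_def)
  define g where "g n i = T * real i / real (Suc n)" for n i
  have g0: "0 \<le> g n i" for n i using T by (simp add: g_def)
  define G where "G n i = {\<omega>\<in>space M. norm (Y (g n i) \<omega> - x) < 3 * r / 4}" for n i
  have G: "G n i \<in> sets (F (g n i))" for n i
  proof -
    have [measurable]: "Y (g n i) \<in> borel_measurable (F (g n i))" using meas g0 by blast
    have "{\<omega>\<in>space (F (g n i)). norm (Y (g n i) \<omega> - x) < 3 * r / 4} \<in> sets (F (g n i))" by measurable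
    then show ?thesis by (simp add: G_def)
  qed
  define Q where "Q n \<omega> \<longleftrightarrow> (\<forall>k\<le>Suc n. (\<forall>j<k. \<omega> \<in> G n j) \<longrightarrow> \<omega> \<notin> G n k \<longrightarrow> norm (J (g n k) \<omega> - J (g n 0) \<omega>) < r / 4)"
    for n \<omega>
  have Q: "holds_off (4 * (c\<^sup>2 * T) / (r / 4)\<^sup>2) (Q n)" for n
    unfolding Q_def
    by (rule ito_maximal_inequality[OF J]) (use Hc T r G in \<open>auto simp: g_def intro!: divide_right_mono\<close>)
  \<comment> \<open>The equation is needed at countably many times only, and so holds at all of them almost surely.\<close>
  define good where "good \<omega> \<longleftrightarrow> Y 0 \<omega> = x \<and> continuous_on {0..} (\<lambda>t. Y t \<omega>) \<and> J 0 \<omega> = 0 \<and>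
     (\<forall>n i. (\<forall>u\<in>{0..g n i}. Y u \<omega> \<in> V) \<longrightarrow>
        Y (g n i) \<omega> = x + integral {0..g n i} (\<lambda>s. b (Y s \<omega>)) + J (g n i) \<omega>)" for \<omega>
  have "AE \<omega> in M. \<forall>n i. (\<forall>u\<in>{0..g n i}. Y u \<omega> \<in> V) \<longrightarrow>
        Y (g n i) \<omega> = x + integral {0..g n i} (\<lambda>s. b (Y s \<omega>)) + J (g n i) \<omega>"
    unfolding AE_all_countable using eq g0 by blast
  then have good: "AE \<omega> in M. good \<omega>"
    using path ito_process_initial[OF J] unfolding good_def by eventually_elim blast
  have "holds_off (4 * (c\<^sup>2 * T) / (r / 4)\<^sup>2) (\<lambda>\<omega>. good \<omega> \<longrightarrow> (\<forall>u\<in>{0..T}. norm (Y u \<omega> - x) \<le> r))"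
  proof (rule holds_off_frequently[OF Q])
    fix \<omega> assume w: "\<omega> \<in> space M" and "\<not> (good \<omega> \<longrightarrow> (\<forall>u\<in>{0..T}. norm (Y u \<omega> - x) \<le> r))"
    then obtain u where gd: "good \<omega>" and u: "0 \<le> u" "u \<le> T" "r < norm (Y u \<omega> - x)" by auto
    have "continuous_on {0..} (\<lambda>t. norm (Y t \<omega> - x))"
      using gd by (auto simp: good_def intro!: continuous_intros)
    from grid_point_before_exit[OF this _ _ u, of "3 * r / 4"]
    have "\<forall>\<^sub>F n in sequentially. \<exists>i\<le>Suc n. 3 * r / 4 < norm (Y (g n i) \<omega> - x) \<and> (\<forall>s\<in>{0..g n i}. norm (Y s \<omega> - x) \<le> r)"
      using gd r by (auto simp: good_def g_def)
    then show "\<forall>\<^sub>F n in sequentially. \<not> Q n \<omega>"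
    proof eventually_elim
      case (elim n)
      then obtain i where i: "i \<le> Suc n" "3 * r / 4 < norm (Y (g n i) \<omega> - x)" "\<forall>s\<in>{0..g n i}. norm (Y s \<omega> - x) \<le> r"
        by blast
      \<comment> \<open>The maximal inequality speaks of the first grid point outside, which is at or before \<open>g n i\<close>.\<close>
      define k where "k = (LEAST k. \<omega> \<notin> G n k)"
      have "\<omega> \<notin> G n i" using i by (simp add: G_def)
      then have k: "\<omega> \<notin> G n k" "k \<le> i" "\<forall>j<k. \<omega> \<in> G n j"
        unfolding k_def by (rule LeastI, rule Least_le) (auto dest: not_less_Least)
      have gk: "g n k \<le> g n i" using k T by (auto simp: g_def intro!: divide_right_mono)
      have gT: "g n k \<le> T"
        using k(2) i(1) T unfolding g_def by (intro grid_point_le) auto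
      have inb: "Y u \<omega> \<in> V" if "u \<in> {0..g n k}" for u
        using i(3) that gk r(2) by (force simp: dist_norm norm_minus_commute mem_cball)
      have ci: "continuous_on {0..g n k} (\<lambda>s. b (Y s \<omega>))"
        using gd inb by (intro continuous_on_compose2[OF b(1)]) (auto simp: good_def intro: continuous_on_subset)
      have "norm (integral {0..g n k} (\<lambda>s. b (Y s \<omega>))) \<le> c * (g n k - 0)"
        using inb b(2) g0 by (intro integral_bound[OF _ ci]) auto
      also have "\<dots> \<le> r / 4"
      proof -
        have "0 \<le> norm (b x)" by simp
        also have "norm (b x) \<le> c" using r by (intro b(2)) auto
        finally have "c * g n k \<le> c * T" using gT by (intro mult_left_mono) auto
        with T show ?thesis by simp
      qed
      finally have int: "norm (integral {0..g n k} (\<lambda>s. b (Y s \<omega>))) \<le> r / 4" .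
      have "Y (g n k) \<omega> - x = integral {0..g n k} (\<lambda>s. b (Y s \<omega>)) + J (g n k) \<omega>"
        using gd inb by (auto simp: good_def)
      then have "norm (Y (g n k) \<omega> - x) \<le> norm (integral {0..g n k} (\<lambda>s. b (Y s \<omega>))) + norm (J (g n k) \<omega>)"
        by (metis norm_triangle_ineq)
      moreover have "3 * r / 4 \<le> norm (Y (g n k) \<omega> - x)" using k(1) w by (auto simp: G_def)
      ultimately have "r / 4 \<le> norm (J (g n k) \<omega>)" using int r by linarith
      then have "\<not> norm (J (g n k) \<omega> - J (g n 0) \<omega>) < r / 4" using gd by (simp add: good_def g_def)
      with k i show "\<not> Q n \<omega>" unfolding Q_def by (meson order_trans)
    qed
  qed
  from holds_off_AE_conj[OF this good] show ?thesis
    by (rule holds_off_mono) (auto simp: power_divide)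
qed

text \<open>On \<open>B t\<close> the integral is the one whose integrand is switched off, at the points of a grid, as soon
  as the outcome leaves the decreasing family \<open>B\<close>.  Refining the grid, the integrand that is left
  outside of the family tends to \<open>0\<close>, because \<open>B\<close> is continuous from the left.  So only the integrand
  before leaving the family counts.\<close>

lemma stopped_ito_inequality:
  fixes H :: "'w \<times> real \<Rightarrow> real ^ 'r ^ 'm"
  assumes J: "ito_process H J"
    and Hc: "\<And>z. z \<in> space P \<Longrightarrow> 0 \<le> snd z \<Longrightarrow> norm (H z) \<le> c"
    and B: "\<And>s. 0 \<le> s \<Longrightarrow> B s \<in> sets (F s)" "\<And>s s'. 0 \<le> s \<Longrightarrow> s \<le> s' \<Longrightarrow> B s' \<subseteq> B s"
    and left: "\<And>s \<omega>. 0 < s \<Longrightarrow> \<omega> \<in> space M \<Longrightarrow> \<omega> \<notin> B s \<Longrightarrow> \<exists>v. 0 \<le> v \<and> v < s \<and> \<omega> \<notin> B v"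
    and Bm[measurable]: "(\<lambda>z. indicator (B (snd z)) (fst z) :: real) \<in> borel_measurable P"
    and t: "0 \<le> t"
  shows "sqnorm M (\<lambda>\<omega>. indicator (B t) \<omega> *\<^sub>R J t \<omega>)
    \<le> 4 * sqnorm P (\<lambda>z. (indicator {0..t} (snd z) * indicator (B (snd z)) (fst z)) *\<^sub>R H z)"
proof -
  define g where "g n i = t * real i / real (Suc n)" for n i
  have g0: "0 \<le> g n i" for n i using t by (simp add: g_def)
  have gS: "g n i \<le> g n (Suc i)" for n i using t by (auto simp: g_def intro!: divide_right_mono mult_left_mono)
  have gt: "g n (Suc n) = t" for n by (simp add: g_def)
  \<comment> \<open>The integrand \<open>K n\<close> and its integral \<open>Z n\<close>; the part of \<open>K n\<close> outside of the family \<open>B\<close> is \<open>R n\<close>.\<close>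
  define K where "K n z = (\<Sum>i<Suc n. (indicator {g n i<..g n (Suc i)} (snd z) * indicator (B (g n i)) (fst z)) *\<^sub>R H z)" for n z
  define Z where "Z n \<omega> = (\<Sum>i<Suc n. indicator (B (g n i)) \<omega> *\<^sub>R (J (g n (Suc i)) \<omega> - J (g n i) \<omega>))" for n \<omega>
  have ito: "ito (K n) (Z n)" for n
    unfolding K_def Z_def by (rule ito_stopped_grid[OF J]) (use g0 gS B in auto)
  have [measurable]: "K n \<in> borel_measurable P" for n using ito by (rule ito_measurable)
  let ?B = "\<lambda>z. (indicator {0..t} (snd z) * indicator (B (snd z)) (fst z)) *\<^sub>R H z"
  have "ito (\<lambda>z. indicator {0..t} (snd z) *\<^sub>R H z) (J t)"
    using J t by (auto simp: ito_process_def)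
  note [measurable] = ito_measurable(1)[OF this]
  have "(\<lambda>z. indicator (B (snd z)) (fst z) *\<^sub>R (indicator {0..t} (snd z) *\<^sub>R H z)) \<in> borel_measurable P"
    by measurable
  then have [measurable]: "?B \<in> borel_measurable P" by (simp add: mult.commute)
  define R where "R n z = (1 - indicator (B (snd z)) (fst z)) *\<^sub>R K n z" for n z
  have [measurable]: "R n \<in> borel_measurable P" for n unfolding R_def by measurable
  have Kle: "norm (K n z) \<le> indicator {0<..t} (snd z) * norm (H z)" for n z
    using grid_sum_norm_le[of "Suc n" "g n" "\<lambda>i. indicator (B (g n i)) (fst z)" "snd z" "H z"] gS gt
    by (simp add: K_def g_def[of n 0] indicator_def)
  have bound: "sqnorm M (\<lambda>\<omega>. indicator (B t) \<omega> *\<^sub>R J t \<omega>) \<le> 4 * (sqnorm P ?B + sqnorm P (R n))" for n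
  proof -
    have "sqnorm M (\<lambda>\<omega>. indicator (B t) \<omega> *\<^sub>R J t \<omega>) \<le> sqnorm M (Z n)"
    proof (rule sqnorm_mono_AE)
      show "AE \<omega> in M. norm (indicator (B t) \<omega> *\<^sub>R J t \<omega>) \<le> norm (Z n \<omega>)"
        using ito_process_initial[OF J]
      proof eventually_elim
        case (elim \<omega>)
        show ?case
        proof (cases "\<omega> \<in> B t")
          case True
          have "\<omega> \<in> B (g n i)" if "i < Suc n" for i
            using True B(2)[OF g0, of n i t] grid_mono[of "Suc n" "g n" i "Suc n"] gS gt that by auto
          then have "Z n \<omega> = (\<Sum>i<Suc n. J (g n (Suc i)) \<omega> - J (g n i) \<omega>)"
            unfolding Z_def by (intro sum.cong) auto
          also have "\<dots> = J (g n (Suc n)) \<omega> - J (g n 0) \<omega>"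
            by (rule sum_lessThan_telescope)
          also have "\<dots> = J t \<omega>"
            using elim by (simp add: gt g_def[of n 0])
          finally show ?thesis using True by simp
        qed simp
      qed
    qed
    also have "\<dots> \<le> 4 * sqnorm P (K n)" by (rule ito_inequality[OF ito])
    also have "sqnorm P (K n) \<le> sqnorm P ?B + sqnorm P (R n)"
    proof -
      have "sqnorm P (K n) \<le> (\<integral>\<^sup>+z. ennreal ((norm (?B z))\<^sup>2) + ennreal ((norm (R n z))\<^sup>2) \<partial>P)"
        unfolding sqnorm_def
      proof (rule nn_integral_mono)
        fix z
        have "(norm (K n z))\<^sup>2 \<le> (norm (?B z))\<^sup>2 + (norm (R n z))\<^sup>2"
        proof (cases "fst z \<in> B (snd z)")
          case True
          have "(norm (K n z))\<^sup>2 \<le> (norm (?B z))\<^sup>2"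
            using Kle[of n z] True
            by (intro power_mono) (cases "0 < snd z", auto simp: indicator_def split: if_splits)
          then show ?thesis by (simp add: add_increasing2)
        qed (simp add: R_def)
        then show "ennreal ((norm (K n z))\<^sup>2) \<le> ennreal ((norm (?B z))\<^sup>2) + ennreal ((norm (R n z))\<^sup>2)"
          by (simp add: ennreal_plus[symmetric] del: ennreal_plus norm_scaleR)
      qed
      also have "\<dots> = sqnorm P ?B + sqnorm P (R n)"
        unfolding sqnorm_def by (rule nn_integral_add) measurable
      finally show ?thesis .
    qed
    finally show ?thesis by (simp add: mult_left_mono)
  qed
  have "(\<lambda>n. sqnorm P (R n)) \<longlonglongrightarrow> (\<integral>\<^sup>+z. 0 \<partial>P)"
    unfolding sqnorm_def
  proof (rule nn_integral_dominated_convergence[where w = "\<lambda>z. ennreal (c\<^sup>2) * indicator {0..t} (snd z)"])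
    show "AE z in P. ennreal ((norm (R n z))\<^sup>2) \<le> ennreal (c\<^sup>2) * indicator {0..t} (snd z)" for n
    proof (rule AE_I2)
      fix z assume z: "z \<in> space P"
      have "norm (R n z) \<le> norm (K n z)" by (auto simp: R_def indicator_def)
      also note Kle
      finally have "norm (R n z) \<le> indicator {0..t} (snd z) * c"
        using Hc[OF z] order_trans[OF norm_ge_zero Hc[OF z]]
        by (cases "0 < snd z") (auto simp: indicator_def split: if_splits)
      then have "(norm (R n z))\<^sup>2 \<le> (indicator {0..t} (snd z) * c)\<^sup>2" by (intro power_mono) auto
      then show "ennreal ((norm (R n z))\<^sup>2) \<le> ennreal (c\<^sup>2) * indicator {0..t} (snd z)"
        by (auto simp: indicator_def intro: ennreal_leI)
    qed
    have "(\<integral>\<^sup>+z. ennreal (c\<^sup>2) * indicator {0..t} (snd z) \<partial>P) = (\<integral>\<^sup>+\<omega>. \<integral>\<^sup>+s. ennreal (c\<^sup>2) * indicator {0..t} s \<partial>lborel \<partial>M)"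
      by (subst lborel.nn_integral_fst[symmetric]) auto
    also have "\<dots> < \<infinity>" using t by (simp add: nn_integral_cmult emeasure_space_1 ennreal_mult_less_top)
    finally show "(\<integral>\<^sup>+z. ennreal (c\<^sup>2) * indicator {0..t} (snd z) \<partial>P) < \<infinity>" .
    show "AE z in P. (\<lambda>n. ennreal ((norm (R n z))\<^sup>2)) \<longlonglongrightarrow> 0"
    proof (rule AE_I2)
      fix z assume z: "z \<in> space P"
      have "\<forall>\<^sub>F n in sequentially. R n z = 0"
      proof (cases "fst z \<in> B (snd z) \<or> \<not> 0 < snd z")
        case True
        then show ?thesis using Kle[of _ z] by (auto simp: R_def indicator_def split: if_splits)
      next
        case False
        then obtain v where v: "0 \<le> v" "v < snd z" "fst z \<notin> B v"
          using left[of "snd z" "fst z"] z by (auto simp: space_pair_measure)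
        have "\<forall>\<^sub>F n in sequentially. t * inverse (real (Suc n)) < snd z - v"
          using v by (intro eventually_mesh_less) auto
        then show ?thesis
        proof eventually_elim
          case (elim n)
          have "indicator {g n i<..g n (Suc i)} (snd z) * indicator (B (g n i)) (fst z) = (0::real)" for i
          proof (cases "snd z \<in> {g n i<..g n (Suc i)}")
            case True
            have "g n (Suc i) = g n i + t * inverse (real (Suc n))"
              by (simp add: g_def divide_inverse algebra_simps)
            with True elim have "v \<le> g n i" by auto
            then have "fst z \<notin> B (g n i)" using B(2)[OF v(1)] v(3) by auto
            then show ?thesis by simp
          qed simp
          then show ?case
            by (simp only: R_def K_def scaleR_zero_left sum.neutral_const scaleR_zero_right)
        qed
      qed
      then have "\<forall>\<^sub>F n in sequentially. ennreal ((norm (R n z))\<^sup>2) = 0" by eventually_elim simp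
      then show "(\<lambda>n. ennreal ((norm (R n z))\<^sup>2)) \<longlonglongrightarrow> 0" by (rule tendsto_eventually)
    qed
  qed measurable
  then have "(\<lambda>n. 4 * (sqnorm P ?B + sqnorm P (R n))) \<longlonglongrightarrow> 4 * (sqnorm P ?B + 0)"
    by (intro ennreal_tendsto_cmult tendsto_add tendsto_const) auto
  from LIMSEQ_le_const[OF this] bound show ?thesis by simp
qed

end

lemma path_in_closed:
  fixes y :: "real \<Rightarrow> 'a :: metric_space"
  assumes cont: "continuous_on {0..} y" and C: "closed C" "y 0 \<in> C"
    and q: "\<And>q::rat. \<bar>of_rat q :: real\<bar> < t \<Longrightarrow> y \<bar>of_rat q\<bar> \<in> C" and u: "0 \<le> u" "u \<le> t"
  shows "y u \<in> C"
proof (rule ccontr)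
  assume nC: "y u \<notin> C"
  with C have "u \<noteq> 0" by auto
  obtain e where e: "e > 0" "\<And>s. 0 \<le> s \<Longrightarrow> \<bar>s - u\<bar> < e \<Longrightarrow> y s \<notin> C"
    using path_stays_in_open[OF cont, of "- C" u] C nC u by auto
  have "max 0 (u - e) < u" using u \<open>u \<noteq> 0\<close> e by auto
  from of_rat_dense[OF this] obtain q where q': "max 0 (u - e) < of_rat q" "of_rat q < u" by blast
  then have "y (of_rat q) \<notin> C" by (intro e) auto
  moreover have "y (of_rat q) \<in> C" using q[of q] q' u by auto
  ultimately show False by blast
qed

text \<open>The Cauchy-Schwarz inequality, from the nonnegativity of the variance of \<open>|f|\<close>.\<close>

lemma norm_integral_squared_le:
  fixes f :: "real \<Rightarrow> 'a :: euclidean_space"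
  assumes f: "continuous_on {0..t} f" and t: "0 \<le> t"
  shows "ennreal ((norm (integral {0..t} f))\<^sup>2) \<le> ennreal t * (\<integral>\<^sup>+s. indicator {0..t} s * ennreal ((norm (f s))\<^sup>2) \<partial>lborel)"
proof (cases "t = 0")
  case True
  then show ?thesis by simp
next
  case False
  with t have t0: "t > 0" by simp
  have c1: "continuous_on {0..t} (\<lambda>s. norm (f s))" and c2: "continuous_on {0..t} (\<lambda>s. (norm (f s))\<^sup>2)"
    using f by (auto intro!: continuous_intros)
  note i = integrable_continuous_real[OF f] integrable_continuous_real[OF c1] integrable_continuous_real[OF c2]
  define m where "m = integral {0..t} (\<lambda>s. norm (f s))"
  have "norm (integral {0..t} f) \<le> m"
    unfolding m_def by (rule integral_norm_bound_integral[OF i(1,2)]) auto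
  then have 1: "(norm (integral {0..t} f))\<^sup>2 \<le> m\<^sup>2" by (intro power_mono) auto
  have "0 \<le> integral {0..t} (\<lambda>s. (norm (f s) - m / t)\<^sup>2)"
    by (rule integral_nonneg[OF integrable_continuous_real]) (auto intro!: continuous_intros f)
  also have "integral {0..t} (\<lambda>s. (norm (f s) - m / t)\<^sup>2) =
    integral {0..t} (\<lambda>s. (norm (f s))\<^sup>2 - (2 * m / t) * norm (f s) + (m / t)\<^sup>2)"
    by (intro Henstock_Kurzweil_Integration.integral_cong) (simp add: power2_diff algebra_simps)
  also have "\<dots> = integral {0..t} (\<lambda>s. (norm (f s))\<^sup>2) - (2 * m / t) * m + t * (m / t)\<^sup>2"
  proof -
    have "((\<lambda>s. (norm (f s))\<^sup>2 - (2 * m / t) * norm (f s) + (m / t)\<^sup>2) has_integral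
        (integral {0..t} (\<lambda>s. (norm (f s))\<^sup>2) - (2 * m / t) * m + (m / t)\<^sup>2 * (t - 0))) {0..t}"
      unfolding m_def using t has_integral_const_real[of "(integral {0..t} (\<lambda>s. norm (f s)) / t)\<^sup>2" 0 t]
      by (intro has_integral_add has_integral_diff has_integral_mult_right integrable_integral i) (auto simp: mult.commute)
    from integral_unique[OF this] show ?thesis by (simp add: mult.commute)
  qed
  also have "\<dots> = integral {0..t} (\<lambda>s. (norm (f s))\<^sup>2) - m\<^sup>2 / t"
    using t0 by (simp add: power2_eq_square field_simps)
  finally have 2: "m\<^sup>2 \<le> t * integral {0..t} (\<lambda>s. (norm (f s))\<^sup>2)"
    using t0 by (simp add: field_simps)
  have 3: "(\<integral>\<^sup>+s. indicator {0..t} s * ennreal ((norm (f s))\<^sup>2) \<partial>lborel) = ennreal (integral {0..t} (\<lambda>s. (norm (f s))\<^sup>2))"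
  proof -
    have "(\<integral>\<^sup>+s. ennreal (indicator {0..t} s * (norm (f s))\<^sup>2) \<partial>lborel) = ennreal (integral {0..t} (\<lambda>s. (norm (f s))\<^sup>2))"
      by (rule nn_integral_has_integral_lebesgue) (use integrable_integral[OF i(3)] in auto)
    then show ?thesis by (simp add: ennreal_mult' ennreal_indicator)
  qed
  have "ennreal ((norm (integral {0..t} f))\<^sup>2) \<le> ennreal (t * integral {0..t} (\<lambda>s. (norm (f s))\<^sup>2))"
    using 1 2 by (intro ennreal_leI) linarith
  then show ?thesis using t unfolding 3 by (simp add: ennreal_mult')
qed

lemma norm_add3_squared_le:
  fixes a b c :: "'a :: real_normed_vector"
  shows "(norm (a + b + c))\<^sup>2 \<le> 3 * (norm a)\<^sup>2 + 3 * (norm b)\<^sup>2 + 3 * (norm c)\<^sup>2"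
proof -
  have "norm (a + b + c) \<le> norm a + norm b + norm c"
    by (meson add_right_mono norm_triangle_ineq order_trans)
  then have "(norm (a + b + c))\<^sup>2 \<le> (norm a + norm b + norm c)\<^sup>2"
    by (intro power_mono) auto
  also have "\<dots> \<le> 3 * (norm a)\<^sup>2 + 3 * (norm b)\<^sup>2 + 3 * (norm c)\<^sup>2"
    using sum_squares_bound[of "norm a" "norm b"] sum_squares_bound[of "norm a" "norm c"] sum_squares_bound[of "norm b" "norm c"]
    by (simp add: power2_eq_square algebra_simps)
  finally show ?thesis .
qed

context ito_setting
begin

text \<open>Subtract the two equations.  Let \<open>d\<close> be the distance of the starting points and let \<open>m\<close> be the
  supremum over \<open>s \<le> T\<close> of the second moment of \<open>Y s - Y' s\<close> on the event that both paths have been in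
  \<open>C\<close> before \<open>s\<close>.  The drift terms contribute at most \<open>3 * T\<^sup>2 * L\<^sup>2 * m\<close>, by the Cauchy-Schwarz inequality, and
  the stochastic integrals at most \<open>12 * T * L\<^sup>2 * m\<close>, by the stopped inequality.  Hence
  \<open>m \<le> 3 * d\<^sup>2 + m / 2\<close> for short times \<open>T\<close>, and \<open>m \<le> 6 * d\<^sup>2\<close> as \<open>m\<close> is finite.\<close>

lemma stability:
  fixes x x' :: "real ^ 'm"
  assumes sol: "solves_in V b \<sigma> x Y H J" "solves_in V b \<sigma> x' Y' H' J'"
    and Hc: "\<And>z. z \<in> space P \<Longrightarrow> 0 \<le> snd z \<Longrightarrow> norm (H z) \<le> c"
      "\<And>z. z \<in> space P \<Longrightarrow> 0 \<le> snd z \<Longrightarrow> norm (H' z) \<le> c"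
    and C: "closed C" "C \<subseteq> V" "x \<in> C" "x' \<in> C" "\<And>y y'. y \<in> C \<Longrightarrow> y' \<in> C \<Longrightarrow> norm (y - y') \<le> D"
    and b: "continuous_on C b" "\<And>y y'. y \<in> C \<Longrightarrow> y' \<in> C \<Longrightarrow> norm (b y - b y') \<le> L * norm (y - y')"
    and \<sigma>: "\<And>y y'. y \<in> C \<Longrightarrow> y' \<in> C \<Longrightarrow> norm (\<sigma> y - \<sigma> y') \<le> L * norm (y - y')"
    and L: "0 \<le> L" and T: "3 * L\<^sup>2 * T * (T + 4) \<le> 1 / 2" and t: "0 \<le> t" "t \<le> T" and l: "0 < l"
  shows "holds_off (6 * (norm (x - x'))\<^sup>2 / l\<^sup>2)
    (\<lambda>\<omega>. (\<forall>u\<in>{0..T}. Y u \<omega> \<in> C \<and> Y' u \<omega> \<in> C) \<longrightarrow> norm (Y t \<omega> - Y' t \<omega>) < l)"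
proof -
  have YF: "\<And>t. 0 \<le> t \<Longrightarrow> Y t \<in> borel_measurable (F t)" "\<And>t. 0 \<le> t \<Longrightarrow> Y' t \<in> borel_measurable (F t)"
    and J: "ito_process H J" "ito_process H' J'"
    and path: "AE \<omega> in M. Y 0 \<omega> = x \<and> continuous_on {0..} (\<lambda>t. Y t \<omega>)"
       "AE \<omega> in M. Y' 0 \<omega> = x' \<and> continuous_on {0..} (\<lambda>t. Y' t \<omega>)"
    and H: "AE \<omega> in M. \<forall>s\<ge>0. (\<forall>u\<in>{0..s}. Y u \<omega> \<in> V) \<longrightarrow> H (\<omega>, s) = \<sigma> (Y s \<omega>)"
       "AE \<omega> in M. \<forall>s\<ge>0. (\<forall>u\<in>{0..s}. Y' u \<omega> \<in> V) \<longrightarrow> H' (\<omega>, s) = \<sigma> (Y' s \<omega>)"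
    and eq: "\<And>t. 0 \<le> t \<Longrightarrow> AE \<omega> in M. (\<forall>u\<in>{0..t}. Y u \<omega> \<in> V) \<longrightarrow>
        Y t \<omega> = x + integral {0..t} (\<lambda>s. b (Y s \<omega>)) + J t \<omega>"
       "\<And>t. 0 \<le> t \<Longrightarrow> AE \<omega> in M. (\<forall>u\<in>{0..t}. Y' u \<omega> \<in> V) \<longrightarrow>
        Y' t \<omega> = x' + integral {0..t} (\<lambda>s. b (Y' s \<omega>)) + J' t \<omega>"
    using sol by (auto simp: solves_in_def)
  have T0: "0 \<le> T" using t by simp
  have YM: "\<And>t. 0 \<le> t \<Longrightarrow> Y t \<in> borel_measurable M" "\<And>t. 0 \<le> t \<Longrightarrow> Y' t \<in> borel_measurable M"
    using YF measurable_F_M by blast+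
  have [measurable]: "C \<in> sets borel" using C by auto
  \<comment> \<open>Rational times keep the event measurable with respect to the past; the absolute value makes them
    nonnegative.\<close>
  define B where "B s = {\<omega>\<in>space M. \<forall>q::rat. \<bar>of_rat q\<bar> < s \<longrightarrow> Y \<bar>of_rat q\<bar> \<omega> \<in> C \<and> Y' \<bar>of_rat q\<bar> \<omega> \<in> C}" for s :: real
  have B_F: "B s \<in> sets (F s)" if "0 \<le> s" for s
  proof -
    have "{\<omega>\<in>space (F s). \<bar>of_rat q\<bar> < s \<longrightarrow> Y \<bar>of_rat q\<bar> \<omega> \<in> C \<and> Y' \<bar>of_rat q\<bar> \<omega> \<in> C} \<in> sets (F s)" for q :: rat
    proof (cases "\<bar>of_rat q\<bar> < s")
      case True
      then have [measurable]: "Y \<bar>of_rat q\<bar> \<in> borel_measurable (F s)" "Y' \<bar>of_rat q\<bar> \<in> borel_measurable (F s)"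
        using measurable_F_mono[OF YF(1), of "\<bar>of_rat q\<bar>" s] measurable_F_mono[OF YF(2), of "\<bar>of_rat q\<bar>" s] by auto
      show ?thesis by measurable
    next
      case False
      then have "{\<omega>\<in>space (F s). \<bar>of_rat q\<bar> < s \<longrightarrow> Y \<bar>of_rat q\<bar> \<omega> \<in> C \<and> Y' \<bar>of_rat q\<bar> \<omega> \<in> C} = space (F s)" by auto
      then show ?thesis using sets.top[of "F s"] by simp
    qed
    then have "{\<omega>\<in>space (F s). \<forall>q::rat. \<bar>of_rat q\<bar> < s \<longrightarrow> Y \<bar>of_rat q\<bar> \<omega> \<in> C \<and> Y' \<bar>of_rat q\<bar> \<omega> \<in> C} \<in> sets (F s)"
      by (rule sets.sets_Collect_countable_All)
    then show ?thesis by (simp only: B_def space_F)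
  qed
  have B_mono: "B s' \<subseteq> B s" if "s \<le> s'" for s s'
    unfolding B_def using order_less_le_trans[OF _ that] by blast
  have left: "\<exists>v. 0 \<le> v \<and> v < s \<and> \<omega> \<notin> B v" if "\<omega> \<in> space M" "\<omega> \<notin> B s" for s \<omega>
  proof -
    from that obtain q :: rat where q: "\<bar>of_rat q\<bar> < s" "\<not> (Y \<bar>of_rat q\<bar> \<omega> \<in> C \<and> Y' \<bar>of_rat q\<bar> \<omega> \<in> C)"
      by (auto simp: B_def)
    define a where "a = \<bar>of_rat q :: real\<bar>"
    have a: "0 \<le> a" "a < s" using q(1) by (simp_all only: a_def abs_ge_zero)
    then have "a < (a + s) / 2" by (simp add: less_divide_eq)
    then have "\<bar>of_rat q\<bar> < (a + s) / 2" by (simp only: a_def)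
    with q(2) have "\<omega> \<notin> B ((a + s) / 2)" unfolding B_def by blast
    moreover have "0 \<le> (a + s) / 2" "(a + s) / 2 < s" using a by (simp_all add: divide_less_eq)
    ultimately show ?thesis by blast
  qed
  have Bm[measurable]: "(\<lambda>z. indicator (B (snd z)) (fst z) :: real) \<in> borel_measurable P"
  proof -
    have [measurable]: "Y \<bar>of_rat q\<bar> \<in> borel_measurable M" "Y' \<bar>of_rat q\<bar> \<in> borel_measurable M" for q :: rat
      using YM by auto
    have "(\<lambda>z. if \<forall>q::rat. \<bar>of_rat q\<bar> < snd z \<longrightarrow> Y \<bar>of_rat q\<bar> (fst z) \<in> C \<and> Y' \<bar>of_rat q\<bar> (fst z) \<in> C then 1 else 0 :: real) \<in> borel_measurable P"
      by measurable
    then show ?thesis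
      by (rule measurable_cong[THEN iffD1, rotated]) (auto simp: B_def indicator_def space_pair_measure)
  qed
  have pathB: "AE \<omega> in M. \<forall>s\<ge>0. \<omega> \<in> B s \<longrightarrow> (\<forall>u\<in>{0..s}. Y u \<omega> \<in> C \<and> Y' u \<omega> \<in> C)"
    using path
  proof eventually_elim
    case (elim \<omega>)
    have "Y u \<omega> \<in> C" "Y' u \<omega> \<in> C" if "\<omega> \<in> B s" "0 \<le> u" "u \<le> s" for s u
      using path_in_closed[of "\<lambda>t. Y t \<omega>" C s u] path_in_closed[of "\<lambda>t. Y' t \<omega>" C s u] C(1,3,4) elim that
      unfolding B_def by blast+
    then show ?case by auto
  qed
  \<comment> \<open>Versions that are jointly measurable in time and outcome, as required by Tonelli's theorem.\<close>
  obtain Z Z' where Z[measurable]: "(\<lambda>z. Z (snd z) (fst z)) \<in> borel_measurable P" "(\<lambda>z. Z' (snd z) (fst z)) \<in> borel_measurable P"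
    and ZY: "AE \<omega> in M. \<forall>t\<ge>0. Z t \<omega> = Y t \<omega>" "AE \<omega> in M. \<forall>t\<ge>0. Z' t \<omega> = Y' t \<omega>"
    using jointly_measurable_version[of Y] jointly_measurable_version[of Y'] YM path by (auto elim: eventually_mono)
  define A where "A z = indicator (B (snd z)) (fst z) *\<^sub>R (Z (snd z) (fst z) - Z' (snd z) (fst z))" for z
  have Am[measurable]: "A \<in> borel_measurable P" unfolding A_def by measurable
  define f where "f s = (\<integral>\<^sup>+\<omega>. ennreal ((norm (A (\<omega>, s)))\<^sup>2) \<partial>M)" for s
  define k where "k s \<omega> = (\<integral>\<^sup>+u. indicator {0..s} u * ennreal ((norm (A (\<omega>, u)))\<^sup>2) \<partial>lborel)" for s \<omega>
  have [measurable]: "k s \<in> borel_measurable M" for s unfolding k_def by measurable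
  define m where "m = (SUP s\<in>{0..T}. f s)"
  have k_le: "(\<integral>\<^sup>+\<omega>. k s \<omega> \<partial>M) \<le> ennreal T * m" if s: "0 \<le> s" "s \<le> T" for s
  proof -
    interpret PP: pair_sigma_finite M lborel ..
    have "(\<integral>\<^sup>+\<omega>. k s \<omega> \<partial>M) = (\<integral>\<^sup>+u. \<integral>\<^sup>+\<omega>. indicator {0..s} u * ennreal ((norm (A (\<omega>, u)))\<^sup>2) \<partial>M \<partial>lborel)"
      unfolding k_def by (rule PP.Fubini'[symmetric]) (simp add: split_beta')
    also have "\<dots> \<le> (\<integral>\<^sup>+u. m * indicator {0..T} u \<partial>lborel)"
    proof (rule nn_integral_mono)
      fix u :: real
      have "(\<integral>\<^sup>+\<omega>. indicator {0..s} u * ennreal ((norm (A (\<omega>, u)))\<^sup>2) \<partial>M) = indicator {0..s} u * f u"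
        unfolding f_def by (rule nn_integral_cmult) measurable
      also have "\<dots> \<le> m * indicator {0..T} u"
        using s by (auto simp: indicator_def m_def intro!: SUP_upper)
      finally show "(\<integral>\<^sup>+\<omega>. indicator {0..s} u * ennreal ((norm (A (\<omega>, u)))\<^sup>2) \<partial>M) \<le> m * indicator {0..T} u" .
    qed
    also have "\<dots> = ennreal T * m" using T0 by (simp add: nn_integral_cmult mult.commute)
    finally show ?thesis .
  qed
  have stoch: "sqnorm M (\<lambda>\<omega>. indicator (B s) \<omega> *\<^sub>R (J s \<omega> - J' s \<omega>)) \<le> 4 * (ennreal (L\<^sup>2) * (\<integral>\<^sup>+\<omega>. k s \<omega> \<partial>M))"
    if s: "0 \<le> s" for s
  proof -
    have bd: "norm (H z - H' z) \<le> c + c" if "z \<in> space P" "0 \<le> snd z" for z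
      using norm_triangle_ineq4[of "H z" "H' z"] Hc(1)[OF that] Hc(2)[OF that] by linarith
    let ?R = "\<lambda>z. (indicator {0..s} (snd z) * indicator (B (snd z)) (fst z)) *\<^sub>R (H z - H' z)"
    have 1: "sqnorm M (\<lambda>\<omega>. indicator (B s) \<omega> *\<^sub>R (J s \<omega> - J' s \<omega>)) \<le> 4 * sqnorm P ?R"
      by (rule stopped_ito_inequality[OF ito_process_diff[OF J] bd B_F B_mono left Bm s]) auto
    have [measurable]: "?R \<in> borel_measurable P"
    proof -
      have "ito (\<lambda>z. indicator {0..s} (snd z) *\<^sub>R (H z - H' z)) (\<lambda>\<omega>. J s \<omega> - J' s \<omega>)"
        using ito_process_diff[OF J] s by (simp add: ito_process_def)
      note [measurable] = ito_measurable(1)[OF this]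
      have "(\<lambda>z. indicator (B (snd z)) (fst z) *\<^sub>R (indicator {0..s} (snd z) *\<^sub>R (H z - H' z))) \<in> borel_measurable P"
        by measurable
      then show ?thesis by (simp add: mult.commute)
    qed
    have "sqnorm P ?R = (\<integral>\<^sup>+\<omega>. \<integral>\<^sup>+u. ennreal ((norm (?R (\<omega>, u)))\<^sup>2) \<partial>lborel \<partial>M)"
      by (rule sqnorm_P_iterated) measurable
    also have "\<dots> \<le> (\<integral>\<^sup>+\<omega>. ennreal (L\<^sup>2) * k s \<omega> \<partial>M)"
    proof (rule nn_integral_mono_AE)
      show "AE \<omega> in M. (\<integral>\<^sup>+u. ennreal ((norm (?R (\<omega>, u)))\<^sup>2) \<partial>lborel) \<le> ennreal (L\<^sup>2) * k s \<omega>"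
        using pathB H ZY AE_space
      proof eventually_elim
        case (elim \<omega>)
        have mk: "(\<lambda>u. indicator {0..s} u * ennreal ((norm (A (\<omega>, u)))\<^sup>2)) \<in> borel_measurable lborel"
          using elim(6) by measurable
        have "(\<integral>\<^sup>+u. ennreal ((norm (?R (\<omega>, u)))\<^sup>2) \<partial>lborel)
          \<le> (\<integral>\<^sup>+u. ennreal (L\<^sup>2) * (indicator {0..s} u * ennreal ((norm (A (\<omega>, u)))\<^sup>2)) \<partial>lborel)"
        proof (rule nn_integral_mono)
          fix u
          show "ennreal ((norm (?R (\<omega>, u)))\<^sup>2) \<le> ennreal (L\<^sup>2) * (indicator {0..s} u * ennreal ((norm (A (\<omega>, u)))\<^sup>2))"
          proof (cases "u \<in> {0..s} \<and> \<omega> \<in> B u")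
            case True
            then have u: "0 \<le> u" and p: "\<forall>v\<in>{0..u}. Y v \<omega> \<in> C \<and> Y' v \<omega> \<in> C" using elim(1) by auto
            then have "H (\<omega>, u) = \<sigma> (Y u \<omega>)" "H' (\<omega>, u) = \<sigma> (Y' u \<omega>)"
              using elim(2,3) C(2) by (meson subsetD)+
            then have "norm (?R (\<omega>, u)) \<le> L * norm (A (\<omega>, u))"
              using True \<sigma>[of "Y u \<omega>" "Y' u \<omega>"] p u elim(4,5) by (simp add: A_def)
            then have "(norm (?R (\<omega>, u)))\<^sup>2 \<le> (L * norm (A (\<omega>, u)))\<^sup>2" by (rule power_mono) simp
            then show ?thesis
              using True by (simp add: power_mult_distrib ennreal_mult'[symmetric] ennreal_leI)
          qed auto
        qed
        also have "\<dots> = ennreal (L\<^sup>2) * k s \<omega>"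
          unfolding k_def by (rule nn_integral_cmult[OF mk])
        finally show ?case .
      qed
    qed
    also have "\<dots> = ennreal (L\<^sup>2) * (\<integral>\<^sup>+\<omega>. k s \<omega> \<partial>M)" by (rule nn_integral_cmult) measurable
    finally have "4 * sqnorm P ?R \<le> 4 * (ennreal (L\<^sup>2) * (\<integral>\<^sup>+\<omega>. k s \<omega> \<partial>M))" by (rule mult_left_mono) simp
    with 1 show ?thesis by (rule order_trans)
  qed
  have f_bound: "f s \<le> ennreal (3 * (norm (x - x'))\<^sup>2) + ennreal (1 / 2) * m" if s: "0 \<le> s" "s \<le> T" for s
  proof -
    let ?j = "\<lambda>\<omega>. indicator (B s) \<omega> *\<^sub>R (J s \<omega> - J' s \<omega>)"
    have jm[measurable]: "?j \<in> borel_measurable M"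
    proof -
      have "J s \<in> borel_measurable M" "J' s \<in> borel_measurable M"
        using J s(1) ito_measurable(2) unfolding ito_process_def by blast+
      moreover have "B s \<in> sets M"
        using B_F[OF s(1)] sets_F_subset[of s] by blast
      ultimately show ?thesis by simp
    qed
    have "f s \<le> (\<integral>\<^sup>+\<omega>. ennreal (3 * (norm (x - x'))\<^sup>2) + (ennreal (3 * T * L\<^sup>2) * k s \<omega> + 3 * ennreal ((norm (?j \<omega>))\<^sup>2)) \<partial>M)"
      unfolding f_def
    proof (rule nn_integral_mono_AE)
      show "AE \<omega> in M. ennreal ((norm (A (\<omega>, s)))\<^sup>2) \<le> ennreal (3 * (norm (x - x'))\<^sup>2) + (ennreal (3 * T * L\<^sup>2) * k s \<omega> + 3 * ennreal ((norm (?j \<omega>))\<^sup>2))"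
        using pathB ZY path eq(1)[OF s(1)] eq(2)[OF s(1)] AE_space
      proof eventually_elim
        case (elim \<omega>)
        show ?case
        proof (cases "\<omega> \<in> B s")
          case True
          then have p: "\<forall>u\<in>{0..s}. Y u \<omega> \<in> C \<and> Y' u \<omega> \<in> C" using elim(1) s by auto
          have c: "continuous_on {0..s} (\<lambda>u. b (Y u \<omega>))" "continuous_on {0..s} (\<lambda>u. b (Y' u \<omega>))"
          proof -
            have "continuous_on {0..s} (\<lambda>u. Y u \<omega>)" "continuous_on {0..s} (\<lambda>u. Y' u \<omega>)"
              using elim(4,5) by (auto intro: continuous_on_subset)
            then show "continuous_on {0..s} (\<lambda>u. b (Y u \<omega>))" "continuous_on {0..s} (\<lambda>u. b (Y' u \<omega>))"
              using p by (auto intro!: continuous_on_compose2[OF b(1)])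
          qed
          have e: "Y s \<omega> = x + integral {0..s} (\<lambda>u. b (Y u \<omega>)) + J s \<omega>"
              "Y' s \<omega> = x' + integral {0..s} (\<lambda>u. b (Y' u \<omega>)) + J' s \<omega>"
            using elim(6,7) p C(2) by blast+
          have ZYs: "Z s \<omega> = Y s \<omega>" "Z' s \<omega> = Y' s \<omega>" using elim(2,3) s(1) by blast+
          let ?f = "\<lambda>u. b (Y u \<omega>) - b (Y' u \<omega>)"
          have "Y s \<omega> - Y' s \<omega> = (x - x') + (integral {0..s} (\<lambda>u. b (Y u \<omega>)) - integral {0..s} (\<lambda>u. b (Y' u \<omega>))) + (J s \<omega> - J' s \<omega>)"
            unfolding e by (simp add: algebra_simps)
          also have "integral {0..s} (\<lambda>u. b (Y u \<omega>)) - integral {0..s} (\<lambda>u. b (Y' u \<omega>)) = integral {0..s} ?f"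
            using c by (intro Henstock_Kurzweil_Integration.integral_diff[symmetric] integrable_continuous_real)
          finally have "A (\<omega>, s) = (x - x') + integral {0..s} ?f + ?j \<omega>"
            using True ZYs by (simp add: A_def)
          then have "(norm (A (\<omega>, s)))\<^sup>2 \<le> 3 * (norm (x - x'))\<^sup>2 + 3 * (norm (integral {0..s} ?f))\<^sup>2 + 3 * (norm (?j \<omega>))\<^sup>2"
            by (simp only: norm_add3_squared_le)
          then have "ennreal ((norm (A (\<omega>, s)))\<^sup>2) \<le> ennreal (3 * (norm (x - x'))\<^sup>2 + 3 * (norm (integral {0..s} ?f))\<^sup>2 + 3 * (norm (?j \<omega>))\<^sup>2)"
            by (rule ennreal_leI)
          also have "\<dots> = ennreal (3 * (norm (x - x'))\<^sup>2) + (3 * ennreal ((norm (integral {0..s} ?f))\<^sup>2) + 3 * ennreal ((norm (?j \<omega>))\<^sup>2))"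
            by (simp add: ennreal_plus ennreal_mult add.assoc del: norm_scaleR)
          also have "3 * ennreal ((norm (integral {0..s} ?f))\<^sup>2) \<le> ennreal (3 * T * L\<^sup>2) * k s \<omega>"
          proof -
            have mk: "(\<lambda>u. indicator {0..s} u * ennreal ((norm (A (\<omega>, u)))\<^sup>2)) \<in> borel_measurable lborel"
              using elim(8) by measurable
            have "ennreal ((norm (integral {0..s} ?f))\<^sup>2) \<le> ennreal s * (\<integral>\<^sup>+u. indicator {0..s} u * ennreal ((norm (?f u))\<^sup>2) \<partial>lborel)"
              using c s by (intro norm_integral_squared_le continuous_on_diff)
            also have "(\<integral>\<^sup>+u. indicator {0..s} u * ennreal ((norm (?f u))\<^sup>2) \<partial>lborel)
               \<le> (\<integral>\<^sup>+u. ennreal (L\<^sup>2) * (indicator {0..s} u * ennreal ((norm (A (\<omega>, u)))\<^sup>2)) \<partial>lborel)"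
            proof (rule nn_integral_mono)
              fix u
              show "indicator {0..s} u * ennreal ((norm (?f u))\<^sup>2) \<le> ennreal (L\<^sup>2) * (indicator {0..s} u * ennreal ((norm (A (\<omega>, u)))\<^sup>2))"
              proof (cases "u \<in> {0..s}")
                case u: True
                have "\<omega> \<in> B u" using B_mono[of u s] u True by auto
                then have "norm (?f u) \<le> L * norm (A (\<omega>, u))"
                  using b(2)[of "Y u \<omega>" "Y' u \<omega>"] p u elim(2,3) by (simp add: A_def)
                then have "(norm (?f u))\<^sup>2 \<le> (L * norm (A (\<omega>, u)))\<^sup>2" by (rule power_mono) simp
                then show ?thesis
                  using u by (simp add: power_mult_distrib ennreal_mult'[symmetric] ennreal_leI)
              qed simp
            qed
            also have "\<dots> = ennreal (L\<^sup>2) * k s \<omega>"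
              unfolding k_def by (rule nn_integral_cmult[OF mk])
            finally have "ennreal ((norm (integral {0..s} ?f))\<^sup>2) \<le> ennreal s * (ennreal (L\<^sup>2) * k s \<omega>)"
              by (simp add: mult_left_mono)
            also have "\<dots> \<le> ennreal T * (ennreal (L\<^sup>2) * k s \<omega>)"
              using s by (intro mult_right_mono ennreal_leI) auto
            finally have "3 * ennreal ((norm (integral {0..s} ?f))\<^sup>2) \<le> 3 * (ennreal T * (ennreal (L\<^sup>2) * k s \<omega>))"
              by (rule mult_left_mono) simp
            also have "\<dots> = ennreal (3 * T * L\<^sup>2) * k s \<omega>"
              using T0 by (simp add: ennreal_mult mult.assoc)
            finally show ?thesis .
          qed
          finally show ?thesis by (simp add: add_mono)
        qed (simp add: A_def)
      qed
    qed
    also have "\<dots> = ennreal (3 * (norm (x - x'))\<^sup>2) + (ennreal (3 * T * L\<^sup>2) * (\<integral>\<^sup>+\<omega>. k s \<omega> \<partial>M) + 3 * sqnorm M ?j)"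
      unfolding sqnorm_def by (simp add: nn_integral_add nn_integral_cmult emeasure_space_1 del: norm_scaleR)
    also have "\<dots> \<le> ennreal (3 * (norm (x - x'))\<^sup>2) + (ennreal (3 * T * L\<^sup>2) * (ennreal T * m) + 3 * (4 * (ennreal (L\<^sup>2) * (ennreal T * m))))"
    proof (intro add_mono mult_left_mono order_refl)
      show "(\<integral>\<^sup>+\<omega>. k s \<omega> \<partial>M) \<le> ennreal T * m" by (rule k_le[OF s])
      have "4 * (ennreal (L\<^sup>2) * (\<integral>\<^sup>+\<omega>. k s \<omega> \<partial>M)) \<le> 4 * (ennreal (L\<^sup>2) * (ennreal T * m))"
        by (intro mult_left_mono k_le s) auto
      with stoch[OF s(1)] show "sqnorm M ?j \<le> 4 * (ennreal (L\<^sup>2) * (ennreal T * m))"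
        by (rule order_trans)
    qed auto
    also have "\<dots> = ennreal (3 * (norm (x - x'))\<^sup>2) + ennreal (3 * L\<^sup>2 * T * (T + 4)) * m"
    proof -
      have "ennreal (3 * T * L\<^sup>2) * (ennreal T * m) + 3 * (4 * (ennreal (L\<^sup>2) * (ennreal T * m)))
         = (ennreal (3 * T * L\<^sup>2 * T) + ennreal (12 * (L\<^sup>2 * T))) * m"
        using T0 by (simp add: ennreal_mult distrib_right mult.assoc[symmetric])
      also have "ennreal (3 * T * L\<^sup>2 * T) + ennreal (12 * (L\<^sup>2 * T)) = ennreal (3 * L\<^sup>2 * T * (T + 4))"
        using T0 by (simp add: ennreal_plus[symmetric] algebra_simps del: ennreal_plus)
      finally show ?thesis by simp
    qed
    also have "\<dots> \<le> ennreal (3 * (norm (x - x'))\<^sup>2) + ennreal (1 / 2) * m"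
      using T by (intro add_mono mult_right_mono ennreal_leI) auto
    finally show ?thesis .
  qed
  have "m \<le> ennreal (3 * (norm (x - x'))\<^sup>2) + ennreal (1 / 2) * m"
  proof -
    have "(SUP s\<in>{0..T}. f s) \<le> ennreal (3 * (norm (x - x'))\<^sup>2) + ennreal (1 / 2) * m"
      by (rule SUP_least) (use f_bound in auto)
    then show ?thesis by (simp only: m_def)
  qed
  \<comment> \<open>Finiteness, without which the first inequality for \<open>m\<close> would be void.\<close>
  moreover have "m \<le> ennreal (D\<^sup>2)"
    unfolding m_def
  proof (rule SUP_least)
    fix s assume s: "s \<in> {0..T}"
    have D0: "0 \<le> D" using C(5)[of x x] C(3) by simp
    have "f s \<le> (\<integral>\<^sup>+\<omega>. ennreal (D\<^sup>2) \<partial>M)"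
      unfolding f_def
    proof (rule nn_integral_mono_AE)
      show "AE \<omega> in M. ennreal ((norm (A (\<omega>, s)))\<^sup>2) \<le> ennreal (D\<^sup>2)"
        using pathB ZY
      proof eventually_elim
        case (elim \<omega>)
        have "norm (A (\<omega>, s)) \<le> D"
          using elim s C(5)[of "Y s \<omega>" "Y' s \<omega>"] D0 by (cases "\<omega> \<in> B s") (auto simp: A_def)
        then show ?case by (intro ennreal_leI power_mono) auto
      qed
    qed
    then show "f s \<le> ennreal (D\<^sup>2)" by (simp add: emeasure_space_1)
  qed
  then obtain m' where m': "m = ennreal m'" "0 \<le> m'"
    by (metis enn2real_nonneg ennreal_enn2real_if ennreal_neq_top neq_top_trans)
  ultimately have "ennreal m' \<le> ennreal (3 * (norm (x - x'))\<^sup>2 + 1 / 2 * m')"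
    by (simp add: ennreal_plus ennreal_mult del: times_divide_eq_left)
  then have "m' \<le> 3 * (norm (x - x'))\<^sup>2 + 1 / 2 * m'"
    using m' by (subst (asm) ennreal_le_iff) auto
  then have "m' \<le> 6 * (norm (x - x'))\<^sup>2" by simp
  moreover have "f t \<le> m" unfolding m_def using t by (intro SUP_upper) auto
  ultimately have "f t \<le> ennreal (6 * (norm (x - x'))\<^sup>2)"
    using m' by (metis ennreal_leI order_trans)
  then have "sqnorm M (\<lambda>\<omega>. A (\<omega>, t)) \<le> ennreal (6 * (norm (x - x'))\<^sup>2)"
    by (simp add: f_def sqnorm_def)
  then have "holds_off (6 * (norm (x - x'))\<^sup>2 / l\<^sup>2) (\<lambda>\<omega>. norm (A (\<omega>, t)) < l)"
    using l by (intro holds_off_Chebyshev) auto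
  from holds_off_AE_conj[OF holds_off_AE_conj[OF this ZY(1)] ZY(2)] show ?thesis
  proof (rule holds_off_mono)
    fix \<omega> assume w: "\<omega> \<in> space M" and h: "(norm (A (\<omega>, t)) < l \<and> (\<forall>t\<ge>0. Z t \<omega> = Y t \<omega>)) \<and> (\<forall>t\<ge>0. Z' t \<omega> = Y' t \<omega>)"
    show "(\<forall>u\<in>{0..T}. Y u \<omega> \<in> C \<and> Y' u \<omega> \<in> C) \<longrightarrow> norm (Y t \<omega> - Y' t \<omega>) < l"
    proof
      assume "\<forall>u\<in>{0..T}. Y u \<omega> \<in> C \<and> Y' u \<omega> \<in> C"
      then have "\<omega> \<in> B t" using w t by (auto simp: B_def)
      moreover have "Z t \<omega> = Y t \<omega>" "Z' t \<omega> = Y' t \<omega>" "norm (A (\<omega>, t)) < l" using h t(1) by blast+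
      ultimately show "norm (Y t \<omega> - Y' t \<omega>) < l" by (simp add: A_def)
    qed
  qed simp
qed

end

section \<open>Lifetimes and exit values\<close>

text \<open>A path that lives up to time \<open>N\<close> has a compact image on \<open>[0, N]\<close>, which is contained in some \<open>D k\<close>.
  So the exit times stay bounded only if the path dies; it is then dead at some integer time, since
  death is final.\<close>

lemma exit_times_of_exhaustion:
  fixes p :: "real \<Rightarrow> 'a :: t2_space option"
  assumes p0: "p 0 \<noteq> None"
    and range: "\<And>t. 0 \<le> t \<Longrightarrow> p t \<in> insert None (Some ` S)"
    and life: "\<And>t. 0 \<le> t \<Longrightarrow> p t \<noteq> None \<longleftrightarrow> ereal t < lifetime p"
    and cont: "continuous_on {t. 0 \<le> t \<and> ereal t < lifetime p} (\<lambda>t. the (p t))"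
    and D: "\<And>n. open (D n)" "\<And>n. D n \<subseteq> D (Suc n)" "(\<Union>n. D n) = S"
  shows "lim (\<lambda>n. exit_time p (D n)) < \<infinity> \<longleftrightarrow> (\<exists>n::nat. p (real n) = None)"
    and "\<And>t. \<forall>n::nat. p (real n) \<noteq> None \<Longrightarrow> 0 \<le> t \<Longrightarrow> p t \<noteq> None"
proof -
  have mono: "incseq (\<lambda>n. exit_time p (D n))"
    unfolding incseq_Suc_iff exit_time_def using D(2) by (intro allI Inf_superset_mono image_mono) auto
  have lim: "lim (\<lambda>n. exit_time p (D n)) = (SUP n. exit_time p (D n))"
    by (rule limI, rule LIMSEQ_SUP[OF mono])
  have alive: "p t \<noteq> None" if n: "\<forall>n::nat. p (real n) \<noteq> None" and t: "0 \<le> t" for t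
  proof -
    obtain n :: nat where "t \<le> real n" using real_arch_simple by blast
    moreover have "ereal (real n) < lifetime p" using n life[of "real n"] by simp
    ultimately have "ereal t < lifetime p" by (meson ereal_less_eq(3) order_le_less_trans)
    then show ?thesis using life[OF t] by simp
  qed
  then show "\<And>t. \<forall>n::nat. p (real n) \<noteq> None \<Longrightarrow> 0 \<le> t \<Longrightarrow> p t \<noteq> None" .
  show "lim (\<lambda>n. exit_time p (D n)) < \<infinity> \<longleftrightarrow> (\<exists>n::nat. p (real n) = None)"
  proof
    assume "\<exists>n::nat. p (real n) = None"
    then obtain n :: nat where n: "p (real n) = None" by blast
    with p0 have "0 < real n" by (cases "n = 0") auto
    then have "exit_time p (D k) \<le> ereal (real n)" for k
      unfolding exit_time_def using n by (intro Inf_lower) auto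
    then have "(SUP k. exit_time p (D k)) \<le> ereal (real n)" by (intro SUP_least) auto
    then show "lim (\<lambda>n. exit_time p (D n)) < \<infinity>" unfolding lim using order_le_less_trans by fastforce
  next
    assume fin: "lim (\<lambda>n. exit_time p (D n)) < \<infinity>"
    show "\<exists>n::nat. p (real n) = None"
    proof (rule ccontr)
      assume "\<not> (\<exists>n::nat. p (real n) = None)"
      then have nn: "\<forall>n::nat. p (real n) \<noteq> None" by simp
      have al: "p t \<noteq> None" if "0 \<le> t" for t by (rule alive[OF nn that])
      then have "{t. 0 \<le> t \<and> ereal t < lifetime p} = {0..}" using life by auto
      with cont have c: "continuous_on {0..} (\<lambda>t. the (p t))" by simp
      have "ereal (real N) \<le> (SUP k. exit_time p (D k))" for N :: nat
      proof -
        let ?A = "(\<lambda>t. the (p t)) ` {0..real N}"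
        have comp: "compact ?A"
          using c by (intro compact_continuous_image) (auto intro: continuous_on_subset)
        have cover: "?A \<subseteq> (\<Union>n\<in>UNIV. D n)"
        proof -
          have "the (p t) \<in> S" if "0 \<le> t" for t using al[OF that] range[OF that] by auto
          then show ?thesis using D(3) by auto
        qed
        obtain I where I: "finite I" "?A \<subseteq> (\<Union>n\<in>I. D n)"
          by (rule compactE_image[OF comp D(1) cover])
        define k where "k = Max (insert 0 I)"
        have "D n \<subseteq> D k" if "n \<in> I" for n
          using lift_Suc_mono_le[of D n k] D(2) I(1) that by (auto simp: k_def)
        with I have A: "?A \<subseteq> D k" by blast
        have "ereal (real N) \<le> exit_time p (D k)"
          unfolding exit_time_def
        proof (rule Inf_greatest, safe)
          fix t assume t: "0 < t" "p t \<notin> Some ` D k"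
          have "\<not> t \<le> real N"
          proof
            assume "t \<le> real N"
            then have "the (p t) \<in> D k" using A t by auto
            moreover have "p t = Some (the (p t))" using al[of t] t by auto
            ultimately show False using t(2) by (metis imageI)
          qed
          then show "ereal (real N) \<le> ereal t" by simp
        qed
        also have "\<dots> \<le> (SUP k. exit_time p (D k))" by (rule SUP_upper) auto
        finally show ?thesis .
      qed
      then have "(SUP k. exit_time p (D k)) = \<infinity>"
        by (intro ereal_top) (meson ereal_less_eq(3) order_trans real_arch_simple)
      with fin lim show False by simp
    qed
  qed
qed

text \<open>The exit time is at most \<open>t0\<close>, so that the exit value is the value of \<open>g\<close> at a point of the path
  before \<open>T\<close>.\<close>

lemma exit_value_near:
  assumes p: "\<And>t. 0 \<le> t \<Longrightarrow> p t = Some (y t)" and t0: "0 < t0" "t0 \<le> T" "y t0 \<notin> U"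
    and C: "\<And>u. 0 \<le> u \<Longrightarrow> u \<le> T \<Longrightarrow> Q (g (y u))"
  shows "Q (exit_value g p U)"
proof -
  have le: "exit_time p U \<le> ereal t0"
    unfolding exit_time_def using t0 p[of t0] by (intro Inf_lower) auto
  have ge: "0 \<le> exit_time p U"
    unfolding exit_time_def by (intro Inf_greatest) auto
  from le ge obtain \<tau> where \<tau>: "exit_time p U = ereal \<tau>" by (cases "exit_time p U") auto
  with le ge have "0 \<le> \<tau>" "\<tau> \<le> T" using t0 by auto
  then show ?thesis using C[of \<tau>] p[of \<tau>] by (simp add: exit_value_def \<tau>)
qed

text \<open>The path keeps a positive distance from \<open>A\<close> during a neighbourhood of \<open>t\<close>.\<close>

lemma grid_point_in_open:
  fixes y :: "real \<Rightarrow> 'a :: euclidean_space"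
  assumes y: "continuous_on {0..} y" and A: "closed A" "A \<noteq> {}" and T: "0 < T" and t: "0 \<le> t" "t < T" "y t \<notin> A"
  shows "\<forall>\<^sub>F n in sequentially. \<exists>i<Suc n. 1 / real (Suc n) < infdist (y (T * real i / real (Suc n))) A"
proof -
  define \<rho> where "\<rho> = infdist (y t) A / 2"
  have "infdist (y t) A > 0" using A t(3) in_closed_iff_infdist_zero[OF A] infdist_nonneg[of "y t" A] by fastforce
  then have \<rho>: "\<rho> > 0" by (simp add: \<rho>_def)
  have "open {v. \<rho> < infdist v A}"
    by (intro open_Collect_less continuous_intros)
  from path_stays_in_open[OF y this t(1)] obtain e where e: "e > 0" "\<And>u. 0 \<le> u \<Longrightarrow> \<bar>u - t\<bar> < e \<Longrightarrow> \<rho> < infdist (y u) A"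
    using \<rho> by (auto simp: \<rho>_def)
  note eventually_mesh_less[OF e(1), of T] eventually_mesh_less[OF \<rho>, of 1]
  then show ?thesis
  proof eventually_elim
    case (elim n)
    define N where "N = real (Suc n)"
    have N: "N > 0" "T / N < e" "1 / N < \<rho>" using elim by (auto simp: N_def divide_inverse)
    define i where "i = nat \<lfloor>t * N / T\<rfloor>"
    have i: "real i \<le> t * N / T" "t * N / T - 1 \<le> real i"
      using t T N by (auto simp: i_def)
    have "T * real i \<le> t * N" using i(1) T by (simp add: field_simps)
    then have le: "T * real i / N \<le> t" using N by (simp add: field_simps)
    have "t * N \<le> T * real i + T" using i(2) T by (simp add: field_simps)
    then have "(t * N - T) / N \<le> T * real i / N" using N by (intro divide_right_mono) auto
    then have ge: "t - T / N \<le> T * real i / N" using N by (simp add: diff_divide_distrib)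
    have "\<rho> < infdist (y (T * real i / N)) A"
      using le ge N T by (intro e(2)) auto
    moreover have "i < Suc n"
    proof -
      have "T * real i < T * N" using \<open>T * real i \<le> t * N\<close> t(2) N mult_strict_right_mono[of t T N] by linarith
      then show ?thesis using T by (simp add: N_def)
    qed
    ultimately show ?case using N(3) unfolding N_def by (intro exI[of _ i]) auto
  qed
qed

context ito_setting
begin

text \<open>The event of explosion coincides with that of being dead at some integer time.  It is therefore
  measurable, so that its measure \<open>0\<close> indeed makes it negligible.\<close>

lemma nonexplosive_AE_alive:
  assumes sol: "local_solution M F W S b \<sigma> x X"
    and D: "\<And>n. open (D n)" "\<And>n. D n \<subseteq> D (Suc n)" "(\<Union>n. D n) = S"
    and ne: "\<P>(\<omega> in M. lim (\<lambda>n. exit_time (\<lambda>t. X t \<omega>) (D n)) < \<infinity>) = 0"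
  shows "AE \<omega> in M. \<forall>t\<ge>0. X t \<omega> \<noteq> None"
proof -
  let ?N = "{\<omega>\<in>space M. \<exists>n::nat. X (real n) \<omega> = None}"
  have iff: "lim (\<lambda>n. exit_time (\<lambda>t. X t \<omega>) (D n)) < \<infinity> \<longleftrightarrow> (\<exists>n::nat. X (real n) \<omega> = None)"
    and alive: "\<forall>n::nat. X (real n) \<omega> \<noteq> None \<Longrightarrow> 0 \<le> t \<Longrightarrow> X t \<omega> \<noteq> None" if "\<omega> \<in> space M" for \<omega> t
  proof -
    have p: "X 0 \<omega> \<noteq> None" "\<And>t. 0 \<le> t \<Longrightarrow> X t \<omega> \<in> insert None (Some ` S)"
      "\<And>t. 0 \<le> t \<Longrightarrow> X t \<omega> \<noteq> None \<longleftrightarrow> ereal t < lifetime (\<lambda>t. X t \<omega>)"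
      "continuous_on {t. 0 \<le> t \<and> ereal t < lifetime (\<lambda>t. X t \<omega>)} (\<lambda>t. the (X t \<omega>))"
      using sol \<open>\<omega> \<in> space M\<close> unfolding local_solution_def by simp_all
    show "lim (\<lambda>n. exit_time (\<lambda>t. X t \<omega>) (D n)) < \<infinity> \<longleftrightarrow> (\<exists>n::nat. X (real n) \<omega> = None)"
      by (rule exit_times_of_exhaustion(1)[OF p D])
    show "X t \<omega> \<noteq> None" if "\<forall>n::nat. X (real n) \<omega> \<noteq> None" "0 \<le> t"
      by (rule exit_times_of_exhaustion(2)[OF p D that])
  qed
  have "{\<omega>\<in>space M. X (real n) \<omega> \<in> Some ` UNIV} \<in> sets M" for n :: nat
  proof -
    have "{\<omega>\<in>space M. X (real n) \<omega> \<in> Some ` UNIV} \<in> sets (F (real n))"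
    proof -
      have "\<forall>t\<ge>0. \<forall>A\<in>sets borel. {\<omega>\<in>space M. X t \<omega> \<in> Some ` A} \<in> sets (F t)"
        using sol by (simp add: local_solution_def)
      from this[rule_format, of "real n" UNIV] show ?thesis by simp
    qed
    then show ?thesis using sets_F_subset by blast
  qed
  then have "{\<omega>\<in>space M. \<not> (X (real n) \<omega> \<in> Some ` UNIV)} \<in> sets M" for n :: nat
    by (rule sets.sets_Collect_neg)
  then have "{\<omega>\<in>space M. \<exists>n::nat. \<not> (X (real n) \<omega> \<in> Some ` UNIV)} \<in> sets M"
    by (rule sets.sets_Collect_countable_Ex)
  also have "{\<omega>\<in>space M. \<exists>n::nat. \<not> (X (real n) \<omega> \<in> Some ` UNIV)} = ?N"
    by (auto simp: image_iff)
  finally have N: "?N \<in> sets M" .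
  have "prob ?N = 0" using ne iff by (simp cong: conj_cong)
  then have "AE \<omega> in M. \<omega> \<notin> ?N" using N by (simp add: prob_eq_0)
  then show ?thesis using AE_space
  proof eventually_elim
    case (elim \<omega>)
    then have "\<forall>n::nat. X (real n) \<omega> \<noteq> None" by simp
    then show ?case by (intro allI impI) (rule alive[OF elim(2)])
  qed
qed

text \<open>On the exceptional event, the values of \<open>f\<close> beyond \<open>K\<close> contribute little by the assumed bound, and
  the others differ from \<open>a\<close> by at most \<open>|K| + |a|\<close>.\<close>

lemma expectation_near:
  assumes f: "integrable M f" and h: "holds_off \<eta> (\<lambda>\<omega>. \<bar>f \<omega> - a\<bar> \<le> \<epsilon>)" and \<epsilon>: "0 \<le> \<epsilon>"
    and K: "(\<integral>\<omega>. \<bar>f \<omega>\<bar> * indicator {\<omega>. \<bar>f \<omega>\<bar> > K} \<omega> \<partial>M) \<le> \<epsilon>'"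
  shows "\<bar>(\<integral>\<omega>. f \<omega> \<partial>M) - a\<bar> \<le> \<epsilon> + \<epsilon>' + (\<bar>K\<bar> + \<bar>a\<bar>) * \<eta>"
proof -
  obtain E where E[measurable]: "E \<in> sets M" and pE: "prob E \<le> \<eta>" and out: "\<And>\<omega>. \<omega> \<in> space M - E \<Longrightarrow> \<bar>f \<omega> - a\<bar> \<le> \<epsilon>"
    using h unfolding holds_off_def by blast
  have [measurable]: "f \<in> borel_measurable M" using f by auto
  let ?t = "\<lambda>\<omega>. \<bar>f \<omega>\<bar> * indicator {\<omega>. \<bar>f \<omega>\<bar> > K} \<omega>"
  have ti: "integrable M ?t"
  proof (rule Bochner_Integration.integrable_bound[OF f])
    have "?t = (\<lambda>\<omega>. if \<bar>f \<omega>\<bar> > K then \<bar>f \<omega>\<bar> else 0)" by (auto simp: indicator_def)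
    then show "?t \<in> borel_measurable M" by simp
  qed (auto simp: indicator_def)
  have Ei: "integrable M (\<lambda>\<omega>. indicator E \<omega> :: real)"
    by (rule integrable_real_indicator) (auto simp: less_top[symmetric])
  have "\<bar>(\<integral>\<omega>. f \<omega> \<partial>M) - a\<bar> = \<bar>\<integral>\<omega>. f \<omega> - a \<partial>M\<bar>"
    using f by (simp add: prob_space)
  also have "\<dots> \<le> (\<integral>\<omega>. \<bar>f \<omega> - a\<bar> \<partial>M)" by (rule integral_abs_bound)
  also have "\<dots> \<le> (\<integral>\<omega>. \<epsilon> + ?t \<omega> + (\<bar>K\<bar> + \<bar>a\<bar>) * indicator E \<omega> \<partial>M)"
  proof (rule integral_mono)
    show "integrable M (\<lambda>\<omega>. \<bar>f \<omega> - a\<bar>)" using f by simp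
    show "integrable M (\<lambda>\<omega>. \<epsilon> + ?t \<omega> + (\<bar>K\<bar> + \<bar>a\<bar>) * indicator E \<omega>)" using ti Ei by simp
    show "\<bar>f \<omega> - a\<bar> \<le> \<epsilon> + ?t \<omega> + (\<bar>K\<bar> + \<bar>a\<bar>) * indicator E \<omega>" if "\<omega> \<in> space M" for \<omega>
      using out[of \<omega>] that \<epsilon> by (cases "\<omega> \<in> E") (auto simp: indicator_def)
  qed
  also have "\<dots> = \<epsilon> + (\<integral>\<omega>. ?t \<omega> \<partial>M) + (\<bar>K\<bar> + \<bar>a\<bar>) * prob E"
    using ti Ei by (simp add: prob_space)
  also have "\<dots> \<le> \<epsilon> + \<epsilon>' + (\<bar>K\<bar> + \<bar>a\<bar>) * \<eta>"
    using K pE by (intro add_mono mult_left_mono) auto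
  finally show ?thesis .
qed

end

section \<open>Convergence of the expected exit value\<close>

theorem theorem6p4:
  fixes M :: "'w measure" and F :: "real \<Rightarrow> 'w measure"
    and W :: "real \<Rightarrow> 'w \<Rightarrow> real ^ 'r"
    and S U :: "(real ^ 'm) set" and D :: "nat \<Rightarrow> (real ^ 'm) set"
    and b :: "real ^ 'm \<Rightarrow> real ^ 'm" and \<sigma> :: "real ^ 'm \<Rightarrow> real ^ 'r ^ 'm"
    and X :: "real ^ 'm \<Rightarrow> real \<Rightarrow> 'w \<Rightarrow> (real ^ 'm) option"
    and xs :: "real ^ 'm" and g :: "real ^ 'm \<Rightarrow> real"
  assumes "open S" and "smooth_on S b" and "smooth_on S \<sigma>"
    and "filtered_prob_space M F" and "brownian_motion M F W"
    and sol: "\<And>x. x \<in> S \<Longrightarrow> maximal_solution M F W S b \<sigma> x (X x)"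
    and D: "\<And>n. open (D n)" "\<And>n. bounded (D n)" "\<And>n. closure (D n) \<subseteq> D (Suc n)"
           "(\<Union>n. D n) = S"
    and U: "open U" "U \<noteq> {}" "- U \<noteq> {}" "closure U \<subseteq> S"
    and "xs \<in> frontier U" and "continuous_on S g"
    and nonexplosive:
      "\<And>x. x \<in> S \<Longrightarrow> \<P>(\<omega> in M. lim (\<lambda>n. exit_time (\<lambda>t. X x t \<omega>) (D n)) < \<infinity>) = 0"
    and exit_finite: "\<And>x. x \<in> U \<Longrightarrow> \<P>(\<omega> in M. exit_time (\<lambda>t. X x t \<omega>) U < \<infinity>) = 1"
    and a: "\<exists>\<delta>>0. uniformly_integrable M {x \<in> U. norm (x - xs) < \<delta>}
              (\<lambda>x \<omega>. exit_value g (\<lambda>t. X x t \<omega>) U)"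
    and b: "\<forall>\<delta>1>0. \<exists>n. \<exists>\<delta>2>0. \<forall>x\<in>U. norm (x - xs) < \<delta>2 \<longrightarrow>
              \<P>(\<omega> in M. exit_time (\<lambda>t. X x t \<omega>) (D n) < exit_time (\<lambda>t. X x t \<omega>) U) < \<delta>1"
    and c: "\<P>(\<omega> in M. exit_time0 (\<lambda>t. X xs t \<omega>) (closure U) = 0) = 1"
  shows "((\<lambda>x. \<integral>\<omega>. exit_value g (\<lambda>t. X x t \<omega>) U \<partial>M) \<longlongrightarrow> g xs) (at xs within U)"
proof (rule tendstoI)
  fix \<epsilon> :: real assume \<epsilon>: "0 < \<epsilon>"
  interpret ito_setting M F W
    by unfold_locales fact+
  note open_S = \<open>open S\<close> and regular = c
  have xsU: "xs \<in> closure U" "xs \<notin> U"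
    using \<open>xs \<in> frontier U\<close> U(1) by (auto simp: frontier_def interior_open)
  then have xsS: "xs \<in> S" using U(4) by blast
  define Y where "Y x t \<omega> = (case X x t \<omega> of None \<Rightarrow> x | Some y \<Rightarrow> y)" for x t \<omega>
  have lsol: "local_solution M F W S b \<sigma> x (X x)" if "x \<in> S" for x
    using sol[OF that] by (simp add: maximal_solution_def)
  have D_mono: "D n \<subseteq> D (Suc n)" for n using D(3)[of n] closure_subset by blast
  have alive: "AE \<omega> in M. \<forall>t\<ge>0. X x t \<omega> \<noteq> None" if "x \<in> S" for x
    by (rule nonexplosive_AE_alive[OF lsol[OF that] D(1) D_mono D(4) nonexplosive[OF that]])
  have XY: "AE \<omega> in M. \<forall>t\<ge>0. X x t \<omega> = Some (Y x t \<omega>)" if "x \<in> S" for x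
    using alive[OF that]
  proof eventually_elim
    case (elim \<omega>)
    have "X x t \<omega> = Some (Y x t \<omega>)" if "0 \<le> t" for t
      using elim that by (cases "X x t \<omega>") (auto simp: Y_def)
    then show ?case by blast
  qed

  obtain \<delta> K where \<delta>: "\<delta> > 0" and ui: "\<And>x. x \<in> U \<Longrightarrow> norm (x - xs) < \<delta> \<Longrightarrow> integrable M (\<lambda>\<omega>. exit_value g (\<lambda>t. X x t \<omega>) U)"
    and K: "\<And>x. x \<in> U \<Longrightarrow> norm (x - xs) < \<delta> \<Longrightarrow>
       (\<integral>\<omega>. \<bar>exit_value g (\<lambda>t. X x t \<omega>) U\<bar> * indicator {\<omega>. \<bar>exit_value g (\<lambda>t. X x t \<omega>) U\<bar> > K} \<omega> \<partial>M) < \<epsilon> / 4"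
  proof -
    from a obtain \<delta> where "\<delta> > 0" and u: "uniformly_integrable M {x \<in> U. norm (x - xs) < \<delta>} (\<lambda>x \<omega>. exit_value g (\<lambda>t. X x t \<omega>) U)"
      by blast
    moreover have "0 < \<epsilon> / 4" using \<epsilon> by simp
    ultimately show ?thesis
      using that unfolding uniformly_integrable_def by blast
  qed
  \<comment> \<open>The probability \<open>\<eta>\<close> that remains permissible for the exceptional event; four events share it.\<close>
  define \<eta> where "\<eta> = \<epsilon> / (4 * (\<bar>K\<bar> + \<bar>g xs\<bar> + 1))"
  have \<eta>: "\<eta> > 0" "(\<bar>K\<bar> + \<bar>g xs\<bar>) * \<eta> \<le> \<epsilon> / 4"
    using \<epsilon> by (auto simp: \<eta>_def field_simps add_pos_nonneg)

  \<comment> \<open>The solutions are observed in the ball \<open>C\<close> of radius \<open>R\<close>, where \<open>g\<close> is nearly constant, and solve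
    the equation in the larger ball \<open>V\<close>.  Starting points are taken within \<open>R / 2\<close>, so that leaving
    \<open>C\<close> requires a displacement of at least \<open>R / 2\<close>.\<close>
  obtain R where R: "R > 0" "cball xs (2 * R) \<subseteq> S" "\<And>y. y \<in> cball xs R \<Longrightarrow> \<bar>g y - g xs\<bar> \<le> \<epsilon> / 4"
  proof -
    obtain e1 where e1: "e1 > 0" "cball xs e1 \<subseteq> S" using open_S xsS open_contains_cball by blast
    have "isCont g xs" using \<open>continuous_on S g\<close> open_S xsS by (simp add: continuous_on_eq_continuous_at)
    then obtain e2 where e2: "e2 > 0" "\<And>y. dist y xs < e2 \<Longrightarrow> dist (g y) (g xs) < \<epsilon> / 4"
      using \<epsilon> unfolding continuous_at_eps_delta by (metis divide_pos_pos zero_less_numeral)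
    have "min (e1 / 2) (e2 / 2) > 0" using e1 e2 by simp
    moreover have "cball xs (2 * min (e1 / 2) (e2 / 2)) \<subseteq> S"
      using subset_trans[OF subset_cball e1(2)] by simp
    moreover have "\<bar>g y - g xs\<bar> \<le> \<epsilon> / 4" if "y \<in> cball xs (min (e1 / 2) (e2 / 2))" for y
    proof -
      have "dist y xs < e2" using that e2(1) by (simp add: dist_commute)
      from e2(2)[OF this] show ?thesis by (simp add: dist_real_def)
    qed
    ultimately show ?thesis by (rule that)
  qed
  define V where "V = ball xs (2 * R)"
  define C where "C = cball xs R"
  have V: "open V" "closure V = cball xs (2 * R)" using R by (auto simp: V_def)
  have C: "closed C" "compact C" "convex C" "C \<subseteq> V" "C \<subseteq> S" using R by (auto simp: C_def V_def)
  have smooth: "C_k_on 1 S b" "C_k_on 1 S \<sigma>" "C_k_on 0 S b" "C_k_on 0 S \<sigma>"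
    using \<open>smooth_on S b\<close> \<open>smooth_on S \<sigma>\<close> unfolding smooth_on_def by blast+
  have cont: "continuous_on S b" "continuous_on S \<sigma>" using smooth(3,4) by simp_all
  obtain c where c: "c \<ge> 0" "\<And>y. y \<in> V \<Longrightarrow> norm (b y) \<le> c" "\<And>y. y \<in> V \<Longrightarrow> norm (\<sigma> y) \<le> c"
  proof -
    have "bounded (b ` cball xs (2 * R))" "bounded (\<sigma> ` cball xs (2 * R))"
      using cont R(2) by (auto intro!: compact_imp_bounded compact_continuous_image intro: continuous_on_subset)
    then obtain c1 c2 where "\<And>y. y \<in> cball xs (2 * R) \<Longrightarrow> norm (b y) \<le> c1" "\<And>y. y \<in> cball xs (2 * R) \<Longrightarrow> norm (\<sigma> y) \<le> c2"
      unfolding bounded_iff by blast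
    then have "norm (b y) \<le> max 0 (max c1 c2)" "norm (\<sigma> y) \<le> max 0 (max c1 c2)" if "y \<in> V" for y
      using that ball_subset_cball[of xs "2 * R"] by (auto simp: V_def le_max_iff_disj subset_iff)
    then show ?thesis by (rule that[rotated]) (assumption | rule max.cobounded1)+
  qed
  obtain L where L: "L \<ge> 0" "\<And>y y'. y \<in> C \<Longrightarrow> y' \<in> C \<Longrightarrow> norm (b y - b y') \<le> L * norm (y - y')"
    "\<And>y y'. y \<in> C \<Longrightarrow> y' \<in> C \<Longrightarrow> norm (\<sigma> y - \<sigma> y') \<le> L * norm (y - y')"
  proof -
    obtain L1 L2 where "L1 \<ge> 0" "L2 \<ge> 0" and l: "\<forall>y\<in>C. \<forall>y'\<in>C. norm (b y - b y') \<le> L1 * norm (y - y')"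
      "\<forall>y\<in>C. \<forall>y'\<in>C. norm (\<sigma> y - \<sigma> y') \<le> L2 * norm (y - y')"
      using C1_on_Lipschitz[OF smooth(1) C(2,3,5)] C1_on_Lipschitz[OF smooth(2) C(2,3,5)] by blast
    have "L1 * norm (y - y') \<le> max L1 L2 * norm (y - y')" "L2 * norm (y - y') \<le> max L1 L2 * norm (y - y')" for y y' :: "real ^ 'm"
      by (auto intro!: mult_right_mono)
    then have "\<And>y y'. y \<in> C \<Longrightarrow> y' \<in> C \<Longrightarrow> norm (b y - b y') \<le> max L1 L2 * norm (y - y')"
      "\<And>y y'. y \<in> C \<Longrightarrow> y' \<in> C \<Longrightarrow> norm (\<sigma> y - \<sigma> y') \<le> max L1 L2 * norm (y - y')"
      using l by (meson order_trans)+
    then show ?thesis using \<open>L1 \<ge> 0\<close> by (intro that[of "max L1 L2"]) auto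
  qed
  \<comment> \<open>The three smallness conditions on \<open>T\<close> come from \<open>leaves_slowly\<close> (with radius \<open>R / 2\<close>) and \<open>stability\<close>.\<close>
  obtain T where T: "T > 0" "c * T \<le> R / 8" "256 * c\<^sup>2 * T / R\<^sup>2 \<le> \<eta> / 4" "3 * L\<^sup>2 * T * (T + 4) \<le> 1 / 2"
  proof -
    have l: "((\<lambda>T. c * T) \<longlongrightarrow> 0) (at_right 0)" "((\<lambda>T. 256 * c\<^sup>2 * T / R\<^sup>2) \<longlongrightarrow> 0) (at_right 0)"
      "((\<lambda>T. 3 * L\<^sup>2 * T * (T + 4)) \<longlongrightarrow> 0) (at_right 0)"
      using R(1) by (auto intro!: tendsto_eq_intros)
    have pos: "0 < R / 8" "0 < \<eta> / 4" "0 < (1::real) / 2" using R(1) \<eta>(1) by simp_all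
    note order_tendstoD(2)[OF l(1) pos(1)] order_tendstoD(2)[OF l(2) pos(2)] order_tendstoD(2)[OF l(3) pos(3)]
    then have "\<forall>\<^sub>F T in at_right (0::real). 0 < T \<and> c * T < R / 8 \<and> 256 * c\<^sup>2 * T / R\<^sup>2 < \<eta> / 4 \<and> 3 * L\<^sup>2 * T * (T + 4) < 1 / 2"
      using eventually_at_right_less[of "0::real"] by eventually_elim blast
    then obtain T where "0 < T \<and> c * T < R / 8 \<and> 256 * c\<^sup>2 * T / R\<^sup>2 < \<eta> / 4 \<and> 3 * L\<^sup>2 * T * (T + 4) < 1 / 2"
      using eventually_happens[of _ "at_right (0::real)"] by (auto simp: trivial_limit_at_right_real)
    then show ?thesis by (intro that[of T]) auto
  qed

  have solves: "\<exists>H J. solves_in V b \<sigma> x (Y x) H J \<and> (\<forall>z\<in>space P. 0 \<le> snd z \<longrightarrow> norm (H z) \<le> c)"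
    if "x \<in> ball xs (R / 2)" for x
  proof -
    have x: "x \<in> V" "x \<in> S" using that R by (auto simp: V_def subset_iff dist_commute)
    have cl: "compact (closure V)" "closure V \<subseteq> S" unfolding V(2) using R(2) by auto
    have Yx: "Y x = (\<lambda>t \<omega>. case X x t \<omega> of None \<Rightarrow> x | Some y \<Rightarrow> y)"
      by (simp add: fun_eq_iff Y_def)
    show ?thesis
      unfolding Yx by (rule local_solution_solves_in[OF lsol[OF x(2)] alive[OF x(2)] V(1) x(1) cl c(3,1)])
  qed
  have inC: "holds_off (\<eta> / 4) (\<lambda>\<omega>. \<forall>u\<in>{0..T}. Y x u \<omega> \<in> C)" if x: "x \<in> ball xs (R / 2)" for x
  proof -
    from solves[OF x] obtain H J where s: "solves_in V b \<sigma> x (Y x) H J" "\<And>z. z \<in> space P \<Longrightarrow> 0 \<le> snd z \<Longrightarrow> norm (H z) \<le> c"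
      by blast
    have sub: "cball x (R / 2) \<subseteq> C"
      unfolding C_def using x by (intro cball_subset_cball_iff[THEN iffD2]) (auto simp: dist_commute)
    have "holds_off (64 * c\<^sup>2 * T / (R / 2)\<^sup>2) (\<lambda>\<omega>. \<forall>u\<in>{0..T}. norm (Y x u \<omega> - x) \<le> R / 2)"
    proof (rule leaves_slowly[OF s])
      show "cball x (R / 2) \<subseteq> V" using sub C(4) by (rule order_trans)
      have "V \<subseteq> S" using closure_subset[of V] V(2) R(2) by blast
      then show "continuous_on V b" by (rule continuous_on_subset[OF cont(1)])
    qed (use R(1) T c in auto)
    then show ?thesis
    proof (rule holds_off_mono)
      show "64 * c\<^sup>2 * T / (R / 2)\<^sup>2 \<le> \<eta> / 4" using T(3) by (simp add: power_divide)
      fix \<omega> assume "\<forall>u\<in>{0..T}. norm (Y x u \<omega> - x) \<le> R / 2"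
      then show "\<forall>u\<in>{0..T}. Y x u \<omega> \<in> C"
        using sub by (auto simp: subset_iff dist_norm norm_minus_commute)
    qed
  qed

  have xsB: "xs \<in> ball xs (R / 2)" using R by simp
  from solves[OF xsB] obtain H0 J0 where s0: "solves_in V b \<sigma> xs (Y xs) H0 J0"
    "\<And>z. z \<in> space P \<Longrightarrow> 0 \<le> snd z \<Longrightarrow> norm (H0 z) \<le> c" by blast
  \<comment> \<open>Regularity of \<open>xs\<close>: before time \<open>T\<close> the path from \<open>xs\<close> has left the closure of \<open>U\<close> by a definite
    distance, and this can be seen on a finite grid.\<close>
  define Q where "Q n \<omega> \<longleftrightarrow> (\<exists>i<Suc n. 1 / real (Suc n) < infdist (Y xs (T * real i / real (Suc n)) \<omega>) (closure U))" for n \<omega>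
  have "AE \<omega> in M. exit_time0 (\<lambda>t. X xs t \<omega>) (closure U) = 0"
  proof -
    have "AE \<omega> in M. \<omega> \<in> {\<omega>\<in>space M. exit_time0 (\<lambda>t. X xs t \<omega>) (closure U) = 0}"
      using regular by (rule AE_prob_1)
    then show ?thesis by eventually_elim simp
  qed
  moreover have "AE \<omega> in M. continuous_on {0..} (\<lambda>t. Y xs t \<omega>)"
    using s0(1) by (auto simp: solves_in_def elim: eventually_mono)
  ultimately have "AE \<omega> in M. \<forall>\<^sub>F n in sequentially. Q n \<omega>"
    using XY[OF xsS]
  proof eventually_elim
    case (elim \<omega>)
    have "exit_time0 (\<lambda>t. X xs t \<omega>) (closure U) < ereal T" using elim(1) T(1) by simp
    then obtain t where t: "0 \<le> t" "X xs t \<omega> \<notin> Some ` closure U" "t < T"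
      unfolding exit_time0_def Inf_less_iff by auto
    then have "Y xs t \<omega> \<notin> closure U" using elim(3) by auto
    with grid_point_in_open[OF elim(2) closed_closure _ T(1) t(1,3)] U(2) show ?case
      by (simp add: Q_def)
  qed
  moreover have "Measurable.pred M (Q n)" for n
  proof -
    have m: "Y xs (T * real i / real (Suc n)) \<in> borel_measurable M" for i
      using s0(1) T(1) measurable_F_M unfolding solves_in_def by (metis divide_nonneg_nonneg mult_nonneg_nonneg of_nat_0_le_iff order_less_imp_le)
    have [measurable]: "(\<lambda>\<omega>. infdist (Y xs (T * real i / real (Suc n)) \<omega>) (closure U)) \<in> borel_measurable M" for i
      by (rule borel_measurable_continuous_on[OF _ m, of "\<lambda>y. infdist y (closure U)"]) (intro continuous_intros)
    show ?thesis unfolding Q_def by measurable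
  qed
  ultimately obtain n where Q: "holds_off (\<eta> / 4) (Q n)"
    using holds_off_eventually[of Q "\<eta> / 4"] \<eta>(1) by auto
  define l where "l = 1 / real (Suc n)"
  have l: "l > 0" by (simp add: l_def)

  have key: "dist (\<integral>\<omega>. exit_value g (\<lambda>t. X x t \<omega>) U \<partial>M) (g xs) < \<epsilon>"
    if x: "x \<in> U" "norm (x - xs) < \<delta>" "norm (x - xs) < R / 2" and small: "real (Suc n) * (6 * (norm (xs - x))\<^sup>2 / l\<^sup>2) < \<eta> / 4" for x
  proof -
    have xB: "x \<in> ball xs (R / 2)" using x by (simp add: dist_norm norm_minus_commute)
    have xS: "x \<in> S" using x U(4) closure_subset by blast
    from solves[OF xB] obtain H J where s: "solves_in V b \<sigma> x (Y x) H J"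
      "\<And>z. z \<in> space P \<Longrightarrow> 0 \<le> snd z \<Longrightarrow> norm (H z) \<le> c" by blast
    have close: "holds_off (\<eta> / 4) (\<lambda>\<omega>. \<forall>i<Suc n. (\<forall>u\<in>{0..T}. Y xs u \<omega> \<in> C \<and> Y x u \<omega> \<in> C) \<longrightarrow>
        norm (Y xs (T * real i / real (Suc n)) \<omega> - Y x (T * real i / real (Suc n)) \<omega>) < l)"
    proof (rule holds_off_mono[OF holds_off_all_less])
      fix i assume i: "i < Suc n"
      have diam: "norm (y - y') \<le> R + R" if "y \<in> C" "y' \<in> C" for y y'
        using that norm_triangle_ineq4[of "y - xs" "y' - xs"] by (simp add: C_def dist_norm norm_minus_commute)
      have "T * real i / real (Suc n) \<le> T"
        using i T(1) by (intro grid_point_le) auto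
      moreover have "xs \<in> C" "x \<in> C" using xB R(1) by (auto simp: C_def)
      ultimately show "holds_off (6 * (norm (xs - x))\<^sup>2 / l\<^sup>2) (\<lambda>\<omega>. (\<forall>u\<in>{0..T}. Y xs u \<omega> \<in> C \<and> Y x u \<omega> \<in> C) \<longrightarrow>
          norm (Y xs (T * real i / real (Suc n)) \<omega> - Y x (T * real i / real (Suc n)) \<omega>) < l)"
        using T(1) continuous_on_subset[OF cont(1) C(5)]
        by (intro stability[OF s0(1) s(1) s0(2) s(2) C(1,4) _ _ diam _ L(2,3,1) T(4) _ _ l]) auto
    qed (use small in auto)
    have "AE \<omega> in M. (\<forall>t\<ge>0. X x t \<omega> = Some (Y x t \<omega>)) \<and> Y x 0 \<omega> = x"
      using XY[OF xS] s(1) unfolding solves_in_def by (auto elim: eventually_elim2)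
    from holds_off_AE_conj[OF holds_off_conj[OF holds_off_conj[OF inC[OF xB] inC[OF xsB]] holds_off_conj[OF Q close]] this]
    have "holds_off \<eta> (\<lambda>\<omega>. \<bar>exit_value g (\<lambda>t. X x t \<omega>) U - g xs\<bar> \<le> \<epsilon> / 4)"
    proof (rule holds_off_mono)
      fix \<omega>
      assume "(((\<forall>u\<in>{0..T}. Y x u \<omega> \<in> C) \<and> (\<forall>u\<in>{0..T}. Y xs u \<omega> \<in> C)) \<and> Q n \<omega> \<and>
        (\<forall>i<Suc n. (\<forall>u\<in>{0..T}. Y xs u \<omega> \<in> C \<and> Y x u \<omega> \<in> C) \<longrightarrow>
        norm (Y xs (T * real i / real (Suc n)) \<omega> - Y x (T * real i / real (Suc n)) \<omega>) < l)) \<and>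
        (\<forall>t\<ge>0. X x t \<omega> = Some (Y x t \<omega>)) \<and> Y x 0 \<omega> = x"
      then have h: "\<forall>u\<in>{0..T}. Y x u \<omega> \<in> C" "Q n \<omega>"
        "\<And>i. i < Suc n \<Longrightarrow> norm (Y xs (T * real i / real (Suc n)) \<omega> - Y x (T * real i / real (Suc n)) \<omega>) < l"
        "\<And>t. 0 \<le> t \<Longrightarrow> X x t \<omega> = Some (Y x t \<omega>)" "Y x 0 \<omega> = x" by blast+
      from h(2) obtain i where i: "i < Suc n" "l < infdist (Y xs (T * real i / real (Suc n)) \<omega>) (closure U)"
        by (auto simp: Q_def l_def)
      define t0 where "t0 = T * real i / real (Suc n)"
      \<comment> \<open>The path from \<open>x\<close> is closer to the path from \<open>xs\<close> than the latter is to \<open>U\<close>.\<close>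
      have out: "Y x t0 \<omega> \<notin> U"
      proof
        assume "Y x t0 \<omega> \<in> U"
        then have "infdist (Y xs t0 \<omega>) (closure U) \<le> dist (Y xs t0 \<omega>) (Y x t0 \<omega>)"
          using closure_subset by (intro infdist_le) blast
        then show False using i(2) h(3)[OF i(1)] by (simp add: t0_def dist_norm)
      qed
      \<comment> \<open>Only positive times count for the exit time.\<close>
      have "t0 \<noteq> 0" using out h(5) x(1) by metis
      then have t0: "0 < t0" using T(1) by (simp add: t0_def)
      have "t0 \<le> T"
        using i T(1) unfolding t0_def by (intro grid_point_le) auto
      then show "\<bar>exit_value g (\<lambda>t. X x t \<omega>) U - g xs\<bar> \<le> \<epsilon> / 4"
        using h(1) R(3)
        by (intro exit_value_near[where p = "\<lambda>t. X x t \<omega>" and y = "\<lambda>t. Y x t \<omega>" and g = g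
              and Q = "\<lambda>v. \<bar>v - g xs\<bar> \<le> \<epsilon> / 4", OF h(4) t0 _ out]) (auto simp: C_def)
    qed simp
    from expectation_near[OF ui[OF x(1,2)] this _ less_imp_le[OF K[OF x(1,2)]]] \<epsilon>
    have "\<bar>(\<integral>\<omega>. exit_value g (\<lambda>t. X x t \<omega>) U \<partial>M) - g xs\<bar> \<le> \<epsilon> / 4 + \<epsilon> / 4 + (\<bar>K\<bar> + \<bar>g xs\<bar>) * \<eta>"
      by simp
    with \<eta>(2) \<epsilon> show ?thesis by (simp add: dist_real_def)
  qed
  have lim: "((\<lambda>x. norm (x - xs)) \<longlongrightarrow> 0) (at xs within U)"
    "((\<lambda>x. real (Suc n) * (6 * (norm (xs - x))\<^sup>2 / l\<^sup>2)) \<longlongrightarrow> 0) (at xs within U)"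
    using l by (auto intro!: tendsto_eq_intros)
  have "0 < R / 2" "0 < \<eta> / 4" using R(1) \<eta>(1) by simp_all
  note order_tendstoD(2)[OF lim(1) \<delta>] order_tendstoD(2)[OF lim(1) this(1)] order_tendstoD(2)[OF lim(2) this(2)]
  moreover have "\<forall>\<^sub>F x in at xs within U. x \<in> U"
    by (auto simp: eventually_at_filter)
  ultimately show "\<forall>\<^sub>F x in at xs within U. dist (\<integral>\<omega>. exit_value g (\<lambda>t. X x t \<omega>) U \<partial>M) (g xs) < \<epsilon>"
    by eventually_elim (rule key)
qed

end
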